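(* Let $K$ be a field (of arbitrary characteristic) and $K(T)$ the field of rational functions in one variable. The ring maps determined by $$\mathrm{Q}_{K(T)/K}\longrightarrow K(T)\otimes_K\Lambda_K[S],\quad T\otimes1\otimes1\mapsto T+S,\quad 1\otimes T\otimes 1\mapsto T-S,\quad 1\otimes1\otimes T\mapsto T,$$ $$K(T)\otimes_K\Lambda_K[S]\longrightarrow\mathrm{Q}_{K(T)/K},\quad T\mapsto1\otimes1\otimes T,\quad S\mapsto T\otimes1\otimes1-1\otimes1\otimes T$$ are inverse isomorphisms, and so in particular $\mathrm{W}_{K(T)/K}\cong K(T)$. Consequently, the $K(T)$-vector space $$\ker\left(\mathrm{Quad}_{K(T)/K}(K(T)^2,K(T))\to\mathrm{Quad}_{K(T)}(K(T),K(T))^2\right)$$ of $K(T)/K$-quadratic forms on $K(T)^2$ that vanish on both $K(T)\oplus0$ and $0\oplus K(T)$ (the map being given by restriction to the two summands) is isomorphic to $$\mathrm{Hom}_{K(T)}(K(T)\otimes_K\Lambda_K[S],K(T))=\mathrm{Hom}_K(\Lambda_K[S],K(T))=K(T)^2,$$ with $f\colon K(T)\otimes_K\Lambda_K[S]\to K(T)$ corresponding to the form $$(F,G)\longmapsto f(F(T+S)G(T-S))=FG\,f(1)+(F'G-FG')f(S),$$ and similarly $$\mathrm{Quad}_{K(T)/K}(K(T)^2,K(T))\cong\mathrm{Quad}_{K(T)}(K(T)^2,K(T))\oplus K(T).$$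
   Context: For a map $q$ between abelian groups, $\mathrm{pol}_q(x,y)=q(x+y)-q(x)-q(y)$. For a homomorphism $\varphi\colon R\to A$ of commutative rings and $A$-modules $M,N$, $\mathrm{Quad}_\varphi(M,N)=\mathrm{Quad}_{A/R}(M,N)$ denotes the $A$-module (under pointwise operations) of maps $q\colon M\to N$ with $q(am)=a^2q(m)$ for all $a\in A$, $m\in M$, and with $\mathrm{pol}_q$ being $R$-bilinear (such $q$ are called $A/R$-quadratic); $\mathrm{Quad}_A=\mathrm{Quad}_{\mathrm{id}_A}$. Let $\Delta_\varphi\subseteq A\otimes_R A$ be the $R$-subalgebra spanned by the elements $a\otimes a$; regard $A$ as a $\Delta_\varphi$-algebra via multiplication. Put $\mathrm{Q}_\varphi=\mathrm{Q}_{A/R}=(A\otimes_R A)\otimes_{\Delta_\varphi}A$, an $A$-algebra via $a\mapsto1\otimes1\otimes a$, augmented over $A$ by multiplication, and let $\mathrm{W}_\varphi=\mathrm{W}_{A/R}$ be the kernel of the augmentation $\mathrm{Q}_\varphi\to A$. $\Lambda_K[S]=K[S]/(S^2)$. For a rational function $F\in K(T)$, $F(T\pm S)\in K(T)\otimes_K\Lambda_K[S]$ denotes the result of substituting $T\pm S$ for $T$, i.e. the image of $F$ under the $K$-algebra map $K(T)\to K(T)\otimes_K\Lambda_K[S]$ with $T\mapsto T\pm S$, and $F'$ is the derivative of $F$ with respect to $T$. *)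

theory Defs
  imports "HOL-Algebra.Algebra" "HOL-Algebra.Algebraic_Closure_Type"
begin

section \<open>Modules and algebras\<close>

text \<open>A ring \<open>A\<close> as an algebra along a ring homomorphism into \<open>A\<close>; in particular
  \<open>alg_along A id\<close> is \<open>A\<close> as an algebra, and as a module, over itself.\<close>

definition alg_along :: "('a, 'c) ring_scheme \<Rightarrow> ('r \<Rightarrow> 'a) \<Rightarrow> ('r, 'a) module" where
  "alg_along A \<phi> =
     \<lparr>carrier = carrier A, monoid.mult = monoid.mult A, one = one A, ring.zero = ring.zero A,
      add = add A, module.smult = (\<lambda>r a. \<phi> r \<otimes>\<^bsub>A\<^esub> a)\<rparr>"

definition mod_homs :: "('r, 'c) ring_scheme \<Rightarrow> ('r, 'm) module \<Rightarrow> ('r, 'n) module \<Rightarrow> ('m \<Rightarrow> 'n) set"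
  where
  "mod_homs R M N = {h \<in> carrier M \<rightarrow>\<^sub>E carrier N.
     (\<forall>x\<in>carrier M. \<forall>y\<in>carrier M. h (x \<oplus>\<^bsub>M\<^esub> y) = h x \<oplus>\<^bsub>N\<^esub> h y) \<and>
     (\<forall>r\<in>carrier R. \<forall>x\<in>carrier M. h (r \<odot>\<^bsub>M\<^esub> x) = r \<odot>\<^bsub>N\<^esub> h x)}"

definition mod_isos :: "('r, 'c) ring_scheme \<Rightarrow> ('r, 'm) module \<Rightarrow> ('r, 'n) module \<Rightarrow> ('m \<Rightarrow> 'n) set"
  where
  "mod_isos R M N = {h \<in> mod_homs R M N. bij_betw h (carrier M) (carrier N)}"

definition alg_homs :: "('r, 'c) ring_scheme \<Rightarrow> ('r, 'm) module \<Rightarrow> ('r, 'n) module \<Rightarrow> ('m \<Rightarrow> 'n) set"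
  where
  "alg_homs R M N = mod_homs R M N \<inter> ring_hom M N"

definition ker_mod :: "('r, 'm) module \<Rightarrow> ('n, 'c) ring_scheme \<Rightarrow> ('m \<Rightarrow> 'n) \<Rightarrow> ('r, 'm) module" where
  "ker_mod M N h = M\<lparr>carrier := a_kernel M N h\<rparr>"

text \<open>The fields \<open>mult\<close> and \<open>one\<close> of the module record play no role in a module, so the next two
  constructions leave them undefined.\<close>

definition prod_mod :: "('r, 'm) module \<Rightarrow> ('r, 'n) module \<Rightarrow> ('r, 'm \<times> 'n) module" where
  "prod_mod M N =
     \<lparr>carrier = carrier M \<times> carrier N, monoid.mult = undefined, one = undefined,
      ring.zero = (\<zero>\<^bsub>M\<^esub>, \<zero>\<^bsub>N\<^esub>),
      add = (\<lambda>(x, y) (x', y'). (x \<oplus>\<^bsub>M\<^esub> x', y \<oplus>\<^bsub>N\<^esub> y')),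
      module.smult = (\<lambda>r (x, y). (r \<odot>\<^bsub>M\<^esub> x, r \<odot>\<^bsub>N\<^esub> y))\<rparr>"

text \<open>A set \<open>H\<close> of functions from (the carrier of) \<open>M\<close> to \<open>N\<close>, with the pointwise operations
  of \<open>N\<close>. The scalars of \<open>M\<close> need not be those of \<open>N\<close>.\<close>

definition fun_mod :: "('s, 'm) module \<Rightarrow> ('r, 'n) module \<Rightarrow> ('m \<Rightarrow> 'n) set \<Rightarrow> ('r, 'm \<Rightarrow> 'n) module"
  where
  "fun_mod M N H =
     \<lparr>carrier = H, monoid.mult = undefined, one = undefined,
      ring.zero = (\<lambda>x\<in>carrier M. \<zero>\<^bsub>N\<^esub>),
      add = (\<lambda>f g. \<lambda>x\<in>carrier M. f x \<oplus>\<^bsub>N\<^esub> g x),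
      module.smult = (\<lambda>r f. \<lambda>x\<in>carrier M. r \<odot>\<^bsub>N\<^esub> f x)\<rparr>"


section \<open>Quadratic maps\<close>

definition pol :: "('r, 'm) module \<Rightarrow> ('r, 'n) module \<Rightarrow> ('m \<Rightarrow> 'n) \<Rightarrow> 'm \<Rightarrow> 'm \<Rightarrow> 'n" where
  "pol M N q x y = q (x \<oplus>\<^bsub>M\<^esub> y) \<ominus>\<^bsub>N\<^esub> q x \<ominus>\<^bsub>N\<^esub> q y"

text \<open>Bilinearity over \<open>R\<close>, where \<open>R\<close> acts on the \<open>A\<close>-modules \<open>M\<close> and \<open>N\<close> through
  \<open>\<phi> : R \<rightarrow> A\<close>.\<close>

definition bilinear_along ::
  "('r, 'c) ring_scheme \<Rightarrow> ('r \<Rightarrow> 'a) \<Rightarrow> ('a, 'm) module \<Rightarrow> ('a, 'n) module \<Rightarrow> ('m \<Rightarrow> 'm \<Rightarrow> 'n) \<Rightarrow> bool"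
  where
  "bilinear_along R \<phi> M N b \<longleftrightarrow>
     (\<forall>x\<in>carrier M. \<forall>x'\<in>carrier M. \<forall>y\<in>carrier M.
        b (x \<oplus>\<^bsub>M\<^esub> x') y = b x y \<oplus>\<^bsub>N\<^esub> b x' y \<and>
        b y (x \<oplus>\<^bsub>M\<^esub> x') = b y x \<oplus>\<^bsub>N\<^esub> b y x') \<and>
     (\<forall>r\<in>carrier R. \<forall>x\<in>carrier M. \<forall>y\<in>carrier M.
        b (\<phi> r \<odot>\<^bsub>M\<^esub> x) y = \<phi> r \<odot>\<^bsub>N\<^esub> b x y \<and>
        b x (\<phi> r \<odot>\<^bsub>M\<^esub> y) = \<phi> r \<odot>\<^bsub>N\<^esub> b x y)"

definition Quad ::
  "('r, 'c) ring_scheme \<Rightarrow> ('a, 'd) ring_scheme \<Rightarrow> ('r \<Rightarrow> 'a) \<Rightarrow>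
   ('a, 'm) module \<Rightarrow> ('a, 'n) module \<Rightarrow> ('a, 'm \<Rightarrow> 'n) module" where
  "Quad R A \<phi> M N = fun_mod M N {q \<in> carrier M \<rightarrow>\<^sub>E carrier N.
     (\<forall>a\<in>carrier A. \<forall>m\<in>carrier M. q (a \<odot>\<^bsub>M\<^esub> m) = (a [^]\<^bsub>A\<^esub> (2::nat)) \<odot>\<^bsub>N\<^esub> q m) \<and>
     bilinear_along R \<phi> M N (pol M N q)}"

definition restrict_summands ::
  "('a, 'm) module \<Rightarrow> ('a, 'n) module \<Rightarrow> ('m \<times> 'n \<Rightarrow> 'p) \<Rightarrow> ('m \<Rightarrow> 'p) \<times> ('n \<Rightarrow> 'p)" where
  "restrict_summands M N q = (\<lambda>m\<in>carrier M. q (m, \<zero>\<^bsub>N\<^esub>), \<lambda>n\<in>carrier N. q (\<zero>\<^bsub>M\<^esub>, n))"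


section \<open>Tensor products of commutative algebras\<close>

text \<open>The integral monoid ring of the multiplicative monoid \<open>A \<times> B\<close>. Additively this is the free
  abelian group on \<open>A \<times> B\<close>. The span of the usual relations for the tensor product is stable under
  multiplication by the basis elements \<open>(c, d)\<close>, so it coincides with the ideal that they generate.\<close>

definition free_pair_ring ::
  "('a, 'c) ring_scheme \<Rightarrow> ('b, 'd) ring_scheme \<Rightarrow> ('a \<times> 'b \<Rightarrow>\<^sub>0 int) ring" where
  "free_pair_ring A B =
     \<lparr>carrier = {c. Poly_Mapping.keys c \<subseteq> carrier A \<times> carrier B},
      monoid.mult = (\<lambda>x y. frag_extend (\<lambda>(a, b).
        frag_extend (\<lambda>(a', b'). frag_of (a \<otimes>\<^bsub>A\<^esub> a', b \<otimes>\<^bsub>B\<^esub> b')) y) x),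
      one = frag_of (\<one>\<^bsub>A\<^esub>, \<one>\<^bsub>B\<^esub>), ring.zero = 0, add = (+)\<rparr>"

definition tensor_rels ::
  "('r, 'c) ring_scheme \<Rightarrow> ('r, 'a) module \<Rightarrow> ('r, 'b) module \<Rightarrow> ('a \<times> 'b \<Rightarrow>\<^sub>0 int) set" where
  "tensor_rels R A B =
     {frag_of (a \<oplus>\<^bsub>A\<^esub> a', b) - frag_of (a, b) - frag_of (a', b) | a a' b.
        a \<in> carrier A \<and> a' \<in> carrier A \<and> b \<in> carrier B} \<union>
     {frag_of (a, b \<oplus>\<^bsub>B\<^esub> b') - frag_of (a, b) - frag_of (a, b') | a b b'.
        a \<in> carrier A \<and> b \<in> carrier B \<and> b' \<in> carrier B} \<union>
     {frag_of (r \<odot>\<^bsub>A\<^esub> a, b) - frag_of (a, r \<odot>\<^bsub>B\<^esub> b) | r a b.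
        r \<in> carrier R \<and> a \<in> carrier A \<and> b \<in> carrier B}"

definition tensor_ideal ::
  "('r, 'c) ring_scheme \<Rightarrow> ('r, 'a) module \<Rightarrow> ('r, 'b) module \<Rightarrow> ('a \<times> 'b \<Rightarrow>\<^sub>0 int) set" where
  "tensor_ideal R A B = Idl\<^bsub>free_pair_ring A B\<^esub> (tensor_rels R A B)"

definition tensor_ring ::
  "('r, 'c) ring_scheme \<Rightarrow> ('r, 'a) module \<Rightarrow> ('r, 'b) module \<Rightarrow> ('a \<times> 'b \<Rightarrow>\<^sub>0 int) set ring" where
  "tensor_ring R A B = free_pair_ring A B Quot tensor_ideal R A B"

definition tens ::
  "('r, 'c) ring_scheme \<Rightarrow> ('r, 'a) module \<Rightarrow> ('r, 'b) module \<Rightarrow> 'a \<Rightarrow> 'b \<Rightarrow> ('a \<times> 'b \<Rightarrow>\<^sub>0 int) set"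
  where
  "tens R A B a b = tensor_ideal R A B +>\<^bsub>free_pair_ring A B\<^esub> frag_of (a, b)"

text \<open>Meant for ring homomorphisms \<open>f\<close> and \<open>g\<close> that agree on \<open>R\<close> and have a commutative codomain
  \<open>C\<close>: then such an \<open>h\<close> exists, and it is unique because pure tensors generate the tensor product.\<close>

definition tensor_lift ::
  "('r, 'c) ring_scheme \<Rightarrow> ('r, 'a) module \<Rightarrow> ('r, 'b) module \<Rightarrow> ('e, 'd) ring_scheme \<Rightarrow>
   ('a \<Rightarrow> 'e) \<Rightarrow> ('b \<Rightarrow> 'e) \<Rightarrow> ('a \<times> 'b \<Rightarrow>\<^sub>0 int) set \<Rightarrow> 'e" where
  "tensor_lift R A B C f g = (THE h.
     h \<in> ring_hom (tensor_ring R A B) C \<and> h \<in> extensional (carrier (tensor_ring R A B)) \<and>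
     (\<forall>a\<in>carrier A. \<forall>b\<in>carrier B. h (tens R A B a b) = f a \<otimes>\<^bsub>C\<^esub> g b))"


section \<open>The algebra Q and its augmentation kernel W\<close>

type_synonym 'a sq = "('a \<times> 'a \<Rightarrow>\<^sub>0 int) set"
type_synonym 'a qalg = "('a sq \<times> 'a \<Rightarrow>\<^sub>0 int) set"

definition sq_ring :: "('r, 'c) ring_scheme \<Rightarrow> ('a, 'd) ring_scheme \<Rightarrow> ('r \<Rightarrow> 'a) \<Rightarrow> 'a sq ring" where
  "sq_ring R A \<phi> = tensor_ring R (alg_along A \<phi>) (alg_along A \<phi>)"

definition sq_tens :: "('r, 'c) ring_scheme \<Rightarrow> ('a, 'd) ring_scheme \<Rightarrow> ('r \<Rightarrow> 'a) \<Rightarrow> 'a \<Rightarrow> 'a \<Rightarrow> 'a sq"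
  where
  "sq_tens R A \<phi> = tens R (alg_along A \<phi>) (alg_along A \<phi>)"

definition sq_mult :: "('r, 'c) ring_scheme \<Rightarrow> ('a, 'd) ring_scheme \<Rightarrow> ('r \<Rightarrow> 'a) \<Rightarrow> 'a sq \<Rightarrow> 'a" where
  "sq_mult R A \<phi> = tensor_lift R (alg_along A \<phi>) (alg_along A \<phi>) A id id"

text \<open>The subring generated by the image of \<open>R\<close> and the elements \<open>a \<otimes> a\<close>. As these elements are closed
  under multiplication, this is also their \<open>R\<close>-linear span.\<close>

definition Delta_ring :: "('r, 'c) ring_scheme \<Rightarrow> ('a, 'd) ring_scheme \<Rightarrow> ('r \<Rightarrow> 'a) \<Rightarrow> 'a sq ring" where
  "Delta_ring R A \<phi> = (sq_ring R A \<phi>)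
     \<lparr>carrier := generate_ring (sq_ring R A \<phi>)
        ((\<lambda>r. sq_tens R A \<phi> (\<phi> r) \<one>\<^bsub>A\<^esub>) ` carrier R \<union> (\<lambda>a. sq_tens R A \<phi> a a) ` carrier A)\<rparr>"

definition Q_ring :: "('r, 'c) ring_scheme \<Rightarrow> ('a, 'd) ring_scheme \<Rightarrow> ('r \<Rightarrow> 'a) \<Rightarrow> 'a qalg ring" where
  "Q_ring R A \<phi> =
     tensor_ring (Delta_ring R A \<phi>) (alg_along (sq_ring R A \<phi>) id) (alg_along A (sq_mult R A \<phi>))"

definition Q_tens ::
  "('r, 'c) ring_scheme \<Rightarrow> ('a, 'd) ring_scheme \<Rightarrow> ('r \<Rightarrow> 'a) \<Rightarrow> 'a \<Rightarrow> 'a \<Rightarrow> 'a \<Rightarrow> 'a qalg" where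
  "Q_tens R A \<phi> x y z =
     tens (Delta_ring R A \<phi>) (alg_along (sq_ring R A \<phi>) id) (alg_along A (sq_mult R A \<phi>))
       (sq_tens R A \<phi> x y) z"

definition Q_alg :: "('r, 'c) ring_scheme \<Rightarrow> ('a, 'd) ring_scheme \<Rightarrow> ('r \<Rightarrow> 'a) \<Rightarrow> ('a, 'a qalg) module"
  where
  "Q_alg R A \<phi> = alg_along (Q_ring R A \<phi>) (\<lambda>a. Q_tens R A \<phi> \<one>\<^bsub>A\<^esub> \<one>\<^bsub>A\<^esub> a)"

definition Q_aug :: "('r, 'c) ring_scheme \<Rightarrow> ('a, 'd) ring_scheme \<Rightarrow> ('r \<Rightarrow> 'a) \<Rightarrow> 'a qalg \<Rightarrow> 'a" where
  "Q_aug R A \<phi> =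
     tensor_lift (Delta_ring R A \<phi>) (alg_along (sq_ring R A \<phi>) id) (alg_along A (sq_mult R A \<phi>))
       A (sq_mult R A \<phi>) id"

definition W_mod :: "('r, 'c) ring_scheme \<Rightarrow> ('a, 'd) ring_scheme \<Rightarrow> ('r \<Rightarrow> 'a) \<Rightarrow> ('a, 'a qalg) module"
  where
  "W_mod R A \<phi> = ker_mod (Q_alg R A \<phi>) A (Q_aug R A \<phi>)"


section \<open>Rational functions and dual numbers over a field\<close>

definition ratfun_const :: "'k::field \<Rightarrow> 'k poly fract" where
  "ratfun_const c = Fraction_Field.Fract [:c:] 1"

definition ratfun_var :: "'k::field poly fract" where
  "ratfun_var = Fraction_Field.Fract [:0, 1:] 1"

definition ratfun_deriv :: "'k::field poly fract \<Rightarrow> 'k poly fract" where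
  "ratfun_deriv F = (THE D. \<forall>p q. q \<noteq> 0 \<and> F = Fraction_Field.Fract p q \<longrightarrow>
     D = Fraction_Field.Fract (pderiv p * q - p * pderiv q) (q * q))"

lemma ratfun_deriv_Fract:
  fixes p q :: "'k::field poly"
  assumes "q \<noteq> 0"
  shows "ratfun_deriv (Fraction_Field.Fract p q)
    = Fraction_Field.Fract (pderiv p * q - p * pderiv q) (q * q)"
proof -
  have indep: "(pderiv p * q - p * pderiv q) * (s * s) = (pderiv r * s - r * pderiv s) * (q * q)"
    if eq: "p * s = r * q" for r s :: "'k poly"
  proof -
    have d: "pderiv p * s + p * pderiv s = pderiv r * q + r * pderiv q"
      using arg_cong[OF eq, of pderiv] by (simp add: pderiv_mult algebra_simps)
    have "(pderiv p * q - p * pderiv q) * (s * s)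
        = (pderiv p * s + p * pderiv s) * (q * s) - (p * s) * (pderiv s * q + pderiv q * s)"
      by (simp add: algebra_simps)
    also have "\<dots> = (pderiv r * q + r * pderiv q) * (q * s) - (r * q) * (pderiv s * q + pderiv q * s)"
      by (simp only: d eq)
    also have "\<dots> = (pderiv r * s - r * pderiv s) * (q * q)"
      by (simp add: algebra_simps)
    finally show ?thesis .
  qed
  show ?thesis
    unfolding ratfun_deriv_def
  proof (rule the_equality)
    show "\<forall>r s. s \<noteq> 0 \<and> Fraction_Field.Fract p q = Fraction_Field.Fract r s \<longrightarrow>
      Fraction_Field.Fract (pderiv p * q - p * pderiv q) (q * q)
        = Fraction_Field.Fract (pderiv r * s - r * pderiv s) (s * s)"
      using assms indep by (auto simp: eq_fract)
  qed (use assms in blast)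
qed

text \<open>For \<open>p(u)\<close> invertible whenever \<open>p \<noteq> 0\<close>: the image of \<open>F\<close> under the unique \<open>K\<close>-algebra map
  \<open>K(T) \<rightarrow> B\<close> that sends \<open>T\<close> to \<open>u\<close>.\<close>

definition ratfun_subst :: "('k::field, 'b) module \<Rightarrow> 'b \<Rightarrow> 'k poly fract \<Rightarrow> 'b" where
  "ratfun_subst B u F =
     (THE h. h \<in> alg_homs (ring_of_type_algebra :: 'k ring)
               (alg_along (ring_of_type_algebra :: 'k poly fract ring) ratfun_const) B \<and>
             h ratfun_var = u) F"

definition dual_ideal :: "'k::field poly set" where
  "dual_ideal = PIdl\<^bsub>ring_of_type_algebra\<^esub> ([:0, 1:] ^ 2)"

definition dual_ring :: "'k::field poly set ring" where
  "dual_ring = ring_of_type_algebra Quot dual_ideal"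

definition dual_class :: "'k::field poly \<Rightarrow> 'k poly set" where
  "dual_class p = dual_ideal +>\<^bsub>ring_of_type_algebra\<^esub> p"

definition dual_alg :: "('k::field, 'k poly set) module" where
  "dual_alg = alg_along dual_ring (\<lambda>c. dual_class [:c:])"

end

(*
  Everything is compared with the dual numbers K(T)[e]/(e^2), realised on pairs (F, G) = F + G e.

  Write x, y, t for the images of T in the three tensor factors of Q. The diagonal elements of T and
  T + 1 give x y = t^2 and (x + 1)(y + 1) = (t + 1)^2, hence x + y = 2 t, and therefore e = x - t
  satisfies e^2 = x^2 - x (x + y) + x y = 0. So F + G e is well defined in Q. In the other direction
  F (x) 1 goes to F + F' e and 1 (x) F to F - F' e; on a diagonal element the product of the two is
  a^2, without e-part, so the map descends to Q. Ring homomorphisms from K(T) are determined by their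
  values on K and T, which makes the two maps mutually inverse.

  A K(T)/K-quadratic form on the plane is the sum of its restrictions to the axes and a K-bilinear
  b with b(HF, HG) = H^2 b(F, G). The same two relations show that b is a combination of FG and
  F'G - FG'.
*)
theory Submission
  imports Defs
begin

section \<open>Tensor products of commutative algebras\<close>

text \<open>Characteristic 2 shapes the argument. There x - y, which is twice e, vanishes, and a
  quadratic form is not recovered from its polar form. So e is taken to be x - t, with no halving.
  Linear relations are won by comparing the squares at T and T + 1, which needs no division, and the
  coefficients of a form on the two axes are kept apart from its cross form. Under the comparison
  the augmentation of Q becomes F + G e -> F, so W is the line of multiples of e. The statements on
  forms are not deduced from the structure of Q. Forms are classified directly by four coefficients;
  the link with the tensor product is that F(T + S) G(T - S) has the coordinates F G and F'G - FG',
  which are also the two basic cross forms. The tensor products are quotients of free rings and the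
  maps out of them definite descriptions, so maps are obtained from a universal property and
  compared on generators. For K(T) the generators K and T suffice because inverses in a commutative
  ring are unique. Functionals and the forms in the kernel are parametrised by pairs (c, d), and the
  isomorphisms between them are the identity on these pairs.\<close>

lemma alg_along_simps [simp]:
  "carrier (alg_along A \<phi>) = carrier A"
  "monoid.mult (alg_along A \<phi>) = monoid.mult A"
  "one (alg_along A \<phi>) = one A"
  "ring.zero (alg_along A \<phi>) = ring.zero A"
  "add (alg_along A \<phi>) = add A"
  "module.smult (alg_along A \<phi>) = (\<lambda>r a. \<phi> r \<otimes>\<^bsub>A\<^esub> a)"
  by (auto simp: alg_along_def)

text \<open>\<open>alg_along\<close> rebuilds the record at another type, so ring facts are carried
  over field by field.\<close>

lemma cring_cong:
  assumes "cring A" and "carrier B = carrier A" "monoid.mult B = monoid.mult A"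
    "one B = one A" "ring.zero B = ring.zero A" "add B = add A"
  shows "cring B"
proof -
  interpret cring A by fact
  show ?thesis
  proof (intro cringI abelian_groupI comm_monoidI)
    show "\<exists>y\<in>carrier B. y \<oplus>\<^bsub>B\<^esub> x = \<zero>\<^bsub>B\<^esub>" if "x \<in> carrier B" for x
      using that assms(2-) by (auto intro!: bexI[of _ "\<ominus>\<^bsub>A\<^esub> x"] simp: l_neg)
  qed (simp_all add: assms(2-) m_assoc a_assoc l_distr, auto simp: m_comm a_comm)
qed

lemma cring_alg_along [simp, intro]: "cring A \<Longrightarrow> cring (alg_along A \<phi>)"
  by (rule cring_cong) auto

lemma ring_hom_cong:
  assumes "carrier A' = carrier A" "monoid.mult A' = monoid.mult A" "one A' = one A" "add A' = add A"
    "carrier B' = carrier B" "monoid.mult B' = monoid.mult B" "one B' = one B" "add B' = add B"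
  shows "ring_hom A' B' = ring_hom A B"
  by (simp add: ring_hom_def assms)

lemma ring_hom_alg_along [simp]:
  "ring_hom (alg_along A \<phi>) B = ring_hom A B"
  "ring_hom A (alg_along B \<psi>) = ring_hom A B"
  by (rule ring_hom_cong; simp)+

lemma a_minus_cong:
  assumes "carrier A' = carrier A" "add A' = add A" "ring.zero A' = ring.zero A"
  shows "a_minus A' x y = a_minus A x y"
  by (simp add: a_minus_def a_inv_def m_inv_def assms)

lemma a_minus_alg_along [simp]: "a_minus (alg_along A \<phi>) = a_minus A"
  by (intro ext a_minus_cong) auto

lemma ring_hom_minus:
  assumes "h \<in> ring_hom R S" "ring R" "ring S" "x \<in> carrier R" "y \<in> carrier R"
  shows "h (x \<ominus>\<^bsub>R\<^esub> y) = h x \<ominus>\<^bsub>S\<^esub> h y"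
proof -
  interpret ring_hom_ring R S h
    using assms by (intro ring_hom_ringI2)
  show ?thesis
    using assms(4,5) by (simp add: a_minus_def)
qed

lemma ring_hom_a_inv:
  assumes "h \<in> ring_hom R S" "ring R" "ring S" "x \<in> carrier R"
  shows "h (\<ominus>\<^bsub>R\<^esub> x) = \<ominus>\<^bsub>S\<^esub> h x"
proof -
  interpret ring_hom_ring R S h
    using assms by (intro ring_hom_ringI2)
  show ?thesis
    using assms(4) by simp
qed

lemma restrict_ring_hom:
  assumes "h \<in> ring_hom R S" "ring R"
  shows "restrict h (carrier R) \<in> ring_hom R S"
proof -
  interpret ring R by fact
  show ?thesis
    using assms(1) by (auto simp: ring_hom_def Pi_iff)
qed

section \<open>The free ring on pairs\<close>

lemma free_pair_ring_sel:
  "carrier (free_pair_ring A B) = {c. Poly_Mapping.keys c \<subseteq> carrier A \<times> carrier B}"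
  "one (free_pair_ring A B) = frag_of (\<one>\<^bsub>A\<^esub>, \<one>\<^bsub>B\<^esub>)"
  "ring.zero (free_pair_ring A B) = 0"
  "add (free_pair_ring A B) = (+)"
  by (auto simp: free_pair_ring_def)

text \<open>Linearity of \<open>frag_extend\<close> in the function, rather than in the element, is
  what makes the product of the free ring additive in its second factor.\<close>

lemma frag_extend_fun_diff:
  "frag_extend (\<lambda>i. f i - g i) x = frag_extend f x - frag_extend g x"
  using subset_UNIV by (induction x rule: frag_induction) (auto simp: frag_extend_diff)

lemma free_pair_mult_of:
  "frag_of (a, b) \<otimes>\<^bsub>free_pair_ring A B\<^esub> frag_of (a', b') = frag_of (a \<otimes>\<^bsub>A\<^esub> a', b \<otimes>\<^bsub>B\<^esub> b')"
  by (simp add: free_pair_ring_def)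

lemma free_pair_mult_diff:
  "(x - y) \<otimes>\<^bsub>free_pair_ring A B\<^esub> z = x \<otimes>\<^bsub>free_pair_ring A B\<^esub> z - y \<otimes>\<^bsub>free_pair_ring A B\<^esub> z"
  "z \<otimes>\<^bsub>free_pair_ring A B\<^esub> (x - y) = z \<otimes>\<^bsub>free_pair_ring A B\<^esub> x - z \<otimes>\<^bsub>free_pair_ring A B\<^esub> y"
  by (auto simp: free_pair_ring_def frag_extend_diff case_prod_unfold
      frag_extend_fun_diff[symmetric])

lemma free_pair_mult_zero:
  "0 \<otimes>\<^bsub>free_pair_ring A B\<^esub> x = 0"
  "x \<otimes>\<^bsub>free_pair_ring A B\<^esub> 0 = 0"
  using free_pair_mult_diff(1)[where x=0 and y=0 and z=x] free_pair_mult_diff(2)[where x=0 and y=0 and z=x] by auto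

lemma keys_diff_subset:
  assumes "Poly_Mapping.keys x \<subseteq> S" "Poly_Mapping.keys y \<subseteq> S"
  shows "Poly_Mapping.keys (x - y) \<subseteq> S"
  using keys_diff[of x y] assms by blast

text \<open>Differences cover sums and negatives at once, so each induction over the free group has
  a single closure step.\<close>

lemma frag_induction' [consumes 1, case_names zero one diff]:
  assumes "Poly_Mapping.keys c \<subseteq> S"
    and "P 0" and "\<And>x. x \<in> S \<Longrightarrow> P (frag_of x)"
    and "\<And>a b. \<lbrakk>Poly_Mapping.keys a \<subseteq> S; Poly_Mapping.keys b \<subseteq> S; P a; P b\<rbrakk> \<Longrightarrow> P (a - b)"
  shows "P c"
  using free_Abelian_group_induct[of c S P] assms by blast

text \<open>Closure, commutativity, associativity and the unit law hold on pairs because they hold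
  in \<open>A\<close> and \<open>B\<close>; nested inductions spread them to integer
  combinations.\<close>

lemma cring_free_pair_ring:
  assumes A: "cring A" and B: "cring B"
  shows "cring (free_pair_ring A B)"
proof -
  interpret A: cring A by fact
  interpret B: cring B by fact
  let ?F = "free_pair_ring A B"
  let ?S = "carrier A \<times> carrier B"
  have closed: "Poly_Mapping.keys (x \<otimes>\<^bsub>?F\<^esub> y) \<subseteq> ?S"
    if "Poly_Mapping.keys x \<subseteq> ?S" "Poly_Mapping.keys y \<subseteq> ?S" for x y
    using that(1)
  proof (induction x rule: frag_induction')
    case (one p)
    show ?case
      using that(2)
    proof (induction y rule: frag_induction')
      case (one p')
      then show ?case
        using \<open>p \<in> ?S\<close> by (cases p; cases p') (auto simp: free_pair_mult_of)
    qed (auto simp: free_pair_mult_zero free_pair_mult_diff dest!: keys_diff[THEN subsetD])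
  qed (auto simp: free_pair_mult_zero free_pair_mult_diff dest!: keys_diff[THEN subsetD])
  have comm: "x \<otimes>\<^bsub>?F\<^esub> y = y \<otimes>\<^bsub>?F\<^esub> x"
    if "Poly_Mapping.keys x \<subseteq> ?S" "Poly_Mapping.keys y \<subseteq> ?S" for x y
    using that(1)
  proof (induction x rule: frag_induction')
    case (one p)
    show ?case
      using that(2)
    proof (induction y rule: frag_induction')
      case (one p')
      then show ?case
        using \<open>p \<in> ?S\<close> by (cases p; cases p') (auto simp: free_pair_mult_of A.m_comm B.m_comm)
    qed (auto simp: free_pair_mult_zero free_pair_mult_diff)
  qed (auto simp: free_pair_mult_zero free_pair_mult_diff)
  have assoc: "x \<otimes>\<^bsub>?F\<^esub> y \<otimes>\<^bsub>?F\<^esub> z = x \<otimes>\<^bsub>?F\<^esub> (y \<otimes>\<^bsub>?F\<^esub> z)"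
    if "Poly_Mapping.keys x \<subseteq> ?S" "Poly_Mapping.keys y \<subseteq> ?S" "Poly_Mapping.keys z \<subseteq> ?S" for x y z
    using that(1)
  proof (induction x rule: frag_induction')
    case (one p)
    show ?case
      using that(2)
    proof (induction y rule: frag_induction')
      case (one p')
      show ?case
        using that(3)
      proof (induction z rule: frag_induction')
        case (one p'')
        then show ?case
          using \<open>p \<in> ?S\<close> \<open>p' \<in> ?S\<close>
          by (cases p; cases p'; cases p'') (auto simp: free_pair_mult_of A.m_assoc B.m_assoc)
      qed (auto simp: free_pair_mult_zero free_pair_mult_diff)
    qed (auto simp: free_pair_mult_zero free_pair_mult_diff)
  qed (auto simp: free_pair_mult_zero free_pair_mult_diff)
  have one: "\<one>\<^bsub>?F\<^esub> \<otimes>\<^bsub>?F\<^esub> x = x" if "Poly_Mapping.keys x \<subseteq> ?S" for x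
    using that
  proof (induction x rule: frag_induction')
    case (one p)
    then show ?case
      by (cases p) (auto simp: free_pair_mult_of free_pair_ring_sel(2))
  qed (auto simp: free_pair_mult_zero free_pair_mult_diff)
  \<comment> \<open>Additivity is the subtractive law applied to \<open>(x + y) - y\<close>.\<close>
  have distr: "(x + y) \<otimes>\<^bsub>?F\<^esub> z = x \<otimes>\<^bsub>?F\<^esub> z + y \<otimes>\<^bsub>?F\<^esub> z" for x y z
    using free_pair_mult_diff(1)[where x="x + y" and y=y and z=z and A=A and B=B] by (simp add: algebra_simps)
  show ?thesis
  proof (intro cringI abelian_groupI comm_monoidI)
    fix x y assume "x \<in> carrier ?F" "y \<in> carrier ?F"
    then show "x \<oplus>\<^bsub>?F\<^esub> y \<in> carrier ?F"
      using keys_add[of x y] by (auto simp: free_pair_ring_sel)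
  next
    fix x assume "x \<in> carrier ?F"
    then show "\<exists>y\<in>carrier ?F. y \<oplus>\<^bsub>?F\<^esub> x = \<zero>\<^bsub>?F\<^esub>"
      by (intro bexI[of _ "- x"]) (auto simp: free_pair_ring_sel)
  qed (use closed comm assoc one distr in \<open>auto simp: free_pair_ring_sel(1,3,4)\<close>,
       auto simp: free_pair_ring_sel)
qed

text \<open>Reconciles subtraction in the ring record with the subtraction of the type, in which the
  tensor relations are written.\<close>

lemma free_pair_a_minus:
  assumes "cring A" "cring B" and x: "x \<in> carrier (free_pair_ring A B)" and y: "y \<in> carrier (free_pair_ring A B)"
  shows "x \<ominus>\<^bsub>free_pair_ring A B\<^esub> y = x - y"
proof -
  interpret cring "free_pair_ring A B"
    by (rule cring_free_pair_ring) fact+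
  have xy: "x - y \<in> carrier (free_pair_ring A B)"
    using x y by (auto simp: free_pair_ring_sel dest: keys_diff[THEN subsetD])
  have "(x - y) \<oplus>\<^bsub>free_pair_ring A B\<^esub> y = x"
    by (simp add: free_pair_ring_sel)
  then show ?thesis
    using x y xy by (metis add.inv_solve_right minus_eq)
qed

section \<open>Homomorphisms out of a quotient ring\<close>

lemma quotient_lift:
  assumes I: "ideal I R" and h: "h \<in> ring_hom R C" and R: "ring R" and C: "ring C"
    and vanish: "\<And>x. x \<in> I \<Longrightarrow> h x = \<zero>\<^bsub>C\<^esub>"
  shows "\<exists>k\<in>ring_hom (R Quot I) C. \<forall>x\<in>carrier R. k (I +>\<^bsub>R\<^esub> x) = h x"
proof -
  interpret I: ideal I R by fact
  interpret C: ring C by fact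
  interpret h: ring_hom_ring R C h
    using h R C by (intro ring_hom_ringI2)
  \<comment> \<open>Representatives of a coset differ by an element of \<open>I\<close>, which
    \<open>h\<close> kills; so the choice made in \<open>k\<close> does not matter.\<close>
  have const: "h z = h x" if x: "x \<in> carrier R" and z: "z \<in> I +>\<^bsub>R\<^esub> x" for x z
  proof -
    obtain i where i: "i \<in> I" "z = i \<oplus>\<^bsub>R\<^esub> x"
      using z by (auto simp: a_r_coset_def')
    then show ?thesis
      using x I.a_subset vanish[of i] by (auto simp: subset_iff)
  qed
  define k where "k = (\<lambda>U. h (SOME x. x \<in> U))"
  have k: "k (I +>\<^bsub>R\<^esub> x) = h x" if x: "x \<in> carrier R" for x
  proof -
    have "x \<in> I +>\<^bsub>R\<^esub> x"
      using x by (rule I.a_rcos_self)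
    then have "(SOME z. z \<in> I +>\<^bsub>R\<^esub> x) \<in> I +>\<^bsub>R\<^esub> x"
      by (rule someI)
    then show ?thesis
      unfolding k_def using const[OF x] by blast
  qed
  have "k \<in> ring_hom (R Quot I) C"
  proof (rule ring_hom_memI)
    fix U V assume "U \<in> carrier (R Quot I)" "V \<in> carrier (R Quot I)"
    then obtain x y where xy: "x \<in> carrier R" "y \<in> carrier R" "U = I +>\<^bsub>R\<^esub> x" "V = I +>\<^bsub>R\<^esub> y"
      by (unfold FactRing_def A_RCOSETS_def', auto)
    show "k (U \<otimes>\<^bsub>R Quot I\<^esub> V) = k U \<otimes>\<^bsub>C\<^esub> k V"
      using xy by (simp add: FactRing_def I.rcoset_mult_add k)
    show "k (U \<oplus>\<^bsub>R Quot I\<^esub> V) = k U \<oplus>\<^bsub>C\<^esub> k V"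
      using xy by (simp add: FactRing_def I.a_rcos_sum k)
  next
    fix U assume "U \<in> carrier (R Quot I)"
    then obtain x where "x \<in> carrier R" "U = I +>\<^bsub>R\<^esub> x"
      by (unfold FactRing_def A_RCOSETS_def', auto)
    then show "k U \<in> carrier C"
      by (simp add: k)
  next
    show "k \<one>\<^bsub>R Quot I\<^esub> = \<one>\<^bsub>C\<^esub>"
      by (simp add: FactRing_def k)
  qed
  then show ?thesis
    using k by blast
qed

section \<open>The tensor product and its universal property\<close>

text \<open>Closure of the scalar actions places the relations inside the free ring, where they
  generate an ideal. The locale serves three times: for K(T) with the algebra of S, for the tensor
  square of K(T), and for Q.\<close>

locale tensor_algebra =
  fixes R :: "('r, 'c) ring_scheme" and A :: "('r, 'a) module" and B :: "('r, 'b) module"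
  assumes cring_A: "cring A" and cring_B: "cring B"
    and smult_A [simp]: "\<And>r a. r \<in> carrier R \<Longrightarrow> a \<in> carrier A \<Longrightarrow> r \<odot>\<^bsub>A\<^esub> a \<in> carrier A"
    and smult_B [simp]: "\<And>r b. r \<in> carrier R \<Longrightarrow> b \<in> carrier B \<Longrightarrow> r \<odot>\<^bsub>B\<^esub> b \<in> carrier B"
begin

sublocale A: cring A by (fact cring_A)
sublocale B: cring B by (fact cring_B)
interpretation F: cring "free_pair_ring A B"
  by (rule cring_free_pair_ring[OF cring_A cring_B])

abbreviation "F \<equiv> free_pair_ring A B"
abbreviation "T \<equiv> tensor_ring R A B"
abbreviation "I \<equiv> tensor_ideal R A B"
abbreviation "t \<equiv> tens R A B"

lemma frag_of_mem [simp]: "a \<in> carrier A \<Longrightarrow> b \<in> carrier B \<Longrightarrow> frag_of (a, b) \<in> carrier F"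
  by (simp add: free_pair_ring_sel)

lemma carrier_T: "carrier T = (\<lambda>x. I +>\<^bsub>F\<^esub> x) ` carrier F"
  unfolding tensor_ring_def FactRing_def A_RCOSETS_def' by auto

lemma diff_mem [simp]: "x \<in> carrier F \<Longrightarrow> y \<in> carrier F \<Longrightarrow> x - y \<in> carrier F"
  using keys_diff_subset[of x _ y] by (auto simp: free_pair_ring_sel)

lemma tensor_rels_subset: "tensor_rels R A B \<subseteq> carrier F"
  by (auto simp: tensor_rels_def)

lemma ideal_I: "ideal I F"
  unfolding tensor_ideal_def by (rule F.genideal_ideal[OF tensor_rels_subset])

interpretation I: ideal I F by (rule ideal_I)

lemma cring_T: "cring T"
  unfolding tensor_ring_def by (rule I.quotient_is_cring[OF F.cring_axioms])

sublocale T: cring T by (rule cring_T)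

lemma proj_hom: "(+>\<^bsub>F\<^esub>) I \<in> ring_hom F T"
  unfolding tensor_ring_def by (rule I.rcos_ring_hom)

interpretation proj: ring_hom_ring F T "(+>\<^bsub>F\<^esub>) I"
  by (intro ring_hom_ringI2 F.ring_axioms T.ring_axioms proj_hom)

lemma proj_diff:
  assumes "x \<in> carrier F" "y \<in> carrier F"
  shows "I +>\<^bsub>F\<^esub> (x - y) = (I +>\<^bsub>F\<^esub> x) \<ominus>\<^bsub>T\<^esub> (I +>\<^bsub>F\<^esub> y)"
proof -
  have "x - y = x \<ominus>\<^bsub>F\<^esub> y"
    by (rule free_pair_a_minus[OF cring_A cring_B assms, symmetric])
  also have "I +>\<^bsub>F\<^esub> \<dots> = (I +>\<^bsub>F\<^esub> x) \<ominus>\<^bsub>T\<^esub> (I +>\<^bsub>F\<^esub> y)"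
    by (rule ring_hom_minus[OF proj_hom F.ring_axioms T.ring_axioms assms])
  finally show ?thesis .
qed

lemma proj_zero: "x \<in> I \<Longrightarrow> I +>\<^bsub>F\<^esub> x = \<zero>\<^bsub>T\<^esub>"
  unfolding tensor_ring_def FactRing_def by (simp only: ring.simps I.a_rcos_const)

text \<open>Reads a three-term relation as additivity of classes; both additivity laws of
  \<open>t\<close> are instances.\<close>

lemma proj_rel:
  assumes "x - y - z \<in> tensor_rels R A B" "x \<in> carrier F" "y \<in> carrier F" "z \<in> carrier F"
  shows "I +>\<^bsub>F\<^esub> x = (I +>\<^bsub>F\<^esub> y) \<oplus>\<^bsub>T\<^esub> (I +>\<^bsub>F\<^esub> z)"
proof -
  have "x - y - z \<in> I"
    unfolding tensor_ideal_def using assms(1) F.genideal_self[OF tensor_rels_subset] by blast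
  then have "I +>\<^bsub>F\<^esub> (x - y - z) = \<zero>\<^bsub>T\<^esub>"
    by (rule proj_zero)
  moreover have "x = (x - y - z) \<oplus>\<^bsub>F\<^esub> (y \<oplus>\<^bsub>F\<^esub> z)"
    by (simp add: free_pair_ring_sel)
  then have "I +>\<^bsub>F\<^esub> x = (I +>\<^bsub>F\<^esub> (x - y - z)) \<oplus>\<^bsub>T\<^esub> ((I +>\<^bsub>F\<^esub> y) \<oplus>\<^bsub>T\<^esub> (I +>\<^bsub>F\<^esub> z))"
    using assms by (metis F.a_closed diff_mem proj.hom_add)
  ultimately show ?thesis
    using assms by (simp add: proj.hom_closed)
qed

lemma tens_closed [simp]: "a \<in> carrier A \<Longrightarrow> b \<in> carrier B \<Longrightarrow> t a b \<in> carrier T"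
  by (simp add: tens_def proj.hom_closed)

lemma tens_add_left:
  "\<lbrakk>a \<in> carrier A; a' \<in> carrier A; b \<in> carrier B\<rbrakk> \<Longrightarrow> t (a \<oplus>\<^bsub>A\<^esub> a') b = t a b \<oplus>\<^bsub>T\<^esub> t a' b"
  unfolding tens_def by (rule proj_rel) (auto simp: tensor_rels_def)

lemma tens_add_right:
  "\<lbrakk>a \<in> carrier A; b \<in> carrier B; b' \<in> carrier B\<rbrakk> \<Longrightarrow> t a (b \<oplus>\<^bsub>B\<^esub> b') = t a b \<oplus>\<^bsub>T\<^esub> t a b'"
  unfolding tens_def by (rule proj_rel) (auto simp: tensor_rels_def)

lemma tens_mult:
  "\<lbrakk>a \<in> carrier A; a' \<in> carrier A; b \<in> carrier B; b' \<in> carrier B\<rbrakk>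
    \<Longrightarrow> t a b \<otimes>\<^bsub>T\<^esub> t a' b' = t (a \<otimes>\<^bsub>A\<^esub> a') (b \<otimes>\<^bsub>B\<^esub> b')"
  unfolding tens_def by (subst proj.hom_mult[symmetric]) (auto simp: free_pair_mult_of)

lemma tens_one: "t \<one>\<^bsub>A\<^esub> \<one>\<^bsub>B\<^esub> = \<one>\<^bsub>T\<^esub>"
  using proj.hom_one by (simp add: tens_def free_pair_ring_sel)

lemma tens_smult:
  assumes "r \<in> carrier R" "a \<in> carrier A" "b \<in> carrier B"
  shows "t (r \<odot>\<^bsub>A\<^esub> a) b = t a (r \<odot>\<^bsub>B\<^esub> b)"
proof -
  have "frag_of (r \<odot>\<^bsub>A\<^esub> a, b) - frag_of (a, r \<odot>\<^bsub>B\<^esub> b) \<in> tensor_rels R A B"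
    using assms by (auto simp: tensor_rels_def)
  then have "frag_of (r \<odot>\<^bsub>A\<^esub> a, b) - frag_of (a, r \<odot>\<^bsub>B\<^esub> b) \<in> I"
    unfolding tensor_ideal_def using F.genideal_self[OF tensor_rels_subset] by blast
  then have "(I +>\<^bsub>F\<^esub> frag_of (r \<odot>\<^bsub>A\<^esub> a, b)) \<ominus>\<^bsub>T\<^esub> (I +>\<^bsub>F\<^esub> frag_of (a, r \<odot>\<^bsub>B\<^esub> b)) = \<zero>\<^bsub>T\<^esub>"
    using assms by (metis proj_diff proj_zero frag_of_mem smult_A smult_B)
  then show ?thesis
    using assms unfolding tens_def by (simp add: proj.hom_closed T.r_right_minus_eq)
qed

lemma tens_hom_left: "(\<lambda>a. t a \<one>\<^bsub>B\<^esub>) \<in> ring_hom A T"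
  by (rule ring_hom_memI) (auto simp: tens_add_left tens_mult tens_one)

lemma tens_hom_right: "(\<lambda>b. t \<one>\<^bsub>A\<^esub> b) \<in> ring_hom B T"
  by (rule ring_hom_memI) (auto simp: tens_add_right tens_mult tens_one)

lemma tens_factor:
  "a \<in> carrier A \<Longrightarrow> b \<in> carrier B \<Longrightarrow> t a b = t a \<one>\<^bsub>B\<^esub> \<otimes>\<^bsub>T\<^esub> t \<one>\<^bsub>A\<^esub> b"
  by (simp add: tens_mult)

text \<open>Every element is the class of an integer combination of pairs, so induction over the
  free group descends to the quotient.\<close>

lemma tensor_induct [consumes 1, case_names tens diff]:
  assumes "x \<in> carrier T"
    and tens: "\<And>a b. a \<in> carrier A \<Longrightarrow> b \<in> carrier B \<Longrightarrow> P (t a b)"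
    and diff: "\<And>x y. \<lbrakk>x \<in> carrier T; y \<in> carrier T; P x; P y\<rbrakk> \<Longrightarrow> P (x \<ominus>\<^bsub>T\<^esub> y)"
  shows "P x"
proof -
  have z: "I +>\<^bsub>F\<^esub> 0 = \<zero>\<^bsub>T\<^esub>"
    using proj.hom_zero by (simp add: free_pair_ring_sel)
  obtain c where c: "c \<in> carrier F" "x = I +>\<^bsub>F\<^esub> c"
    using assms(1) unfolding carrier_T by blast
  have "Poly_Mapping.keys c \<subseteq> carrier A \<times> carrier B"
    using c(1) by (simp add: free_pair_ring_sel)
  then have "P (I +>\<^bsub>F\<^esub> c)"
  proof (induction c rule: frag_induction')
    case zero
    \<comment> \<open>Zero arises as the difference of a pure tensor with itself, because the rule
      has no case for it.\<close>
    have "P (t \<one>\<^bsub>A\<^esub> \<one>\<^bsub>B\<^esub> \<ominus>\<^bsub>T\<^esub> t \<one>\<^bsub>A\<^esub> \<one>\<^bsub>B\<^esub>)"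
      by (intro diff tens) auto
    then show ?case
      by (simp add: z tens_one T.r_neg T.minus_eq)
  next
    case (one p)
    then show ?case
      using tens by (cases p) (auto simp: tens_def)
  next
    case (diff a b)
    then show ?case
      using assms(3) by (simp add: proj_diff proj.hom_closed free_pair_ring_sel(1))
  qed
  then show ?thesis
    using c by simp
qed

lemma tensor_hom_eqI:
  assumes h: "h \<in> ring_hom T C" and h': "h' \<in> ring_hom T C" and C: "ring C"
    and eq: "\<And>a b. a \<in> carrier A \<Longrightarrow> b \<in> carrier B \<Longrightarrow> h (t a b) = h' (t a b)"
    and x: "x \<in> carrier T"
  shows "h x = h' x"
  using x by (induction x rule: tensor_induct)
    (auto simp: eq ring_hom_minus[OF h T.ring_axioms C] ring_hom_minus[OF h' T.ring_axioms C])

text \<open>A pure tensor is the product of its two one-sided parts, so a ring homomorphism is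
  determined on each factor.\<close>

lemma tensor_hom_eqI':
  assumes h: "h \<in> ring_hom T C" and h': "h' \<in> ring_hom T C" and C: "ring C"
    and eq1: "\<And>a. a \<in> carrier A \<Longrightarrow> h (t a \<one>\<^bsub>B\<^esub>) = h' (t a \<one>\<^bsub>B\<^esub>)"
    and eq2: "\<And>b. b \<in> carrier B \<Longrightarrow> h (t \<one>\<^bsub>A\<^esub> b) = h' (t \<one>\<^bsub>A\<^esub> b)"
    and x: "x \<in> carrier T"
  shows "h x = h' x"
proof (rule tensor_hom_eqI[OF h h' C _ x])
  fix a b assume "a \<in> carrier A" "b \<in> carrier B"
  then show "h (t a b) = h' (t a b)"
    using ring_hom_mult[OF h, of "t a \<one>\<^bsub>B\<^esub>" "t \<one>\<^bsub>A\<^esub> b"] ring_hom_mult[OF h', of "t a \<one>\<^bsub>B\<^esub>" "t \<one>\<^bsub>A\<^esub> b"]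
    by (simp add: tens_factor[symmetric] eq1 eq2)
qed

text \<open>The free abelian group provides the additive map. Once it is multiplicative, its kernel
  is an ideal, and containing the relations it contains the ideal that they generate.\<close>

lemma tensor_lift_exists:
  assumes C: "cring C" and f: "f \<in> ring_hom A C" and g: "g \<in> ring_hom B C"
    and bal: "\<And>r a b. \<lbrakk>r \<in> carrier R; a \<in> carrier A; b \<in> carrier B\<rbrakk>
      \<Longrightarrow> f (r \<odot>\<^bsub>A\<^esub> a) \<otimes>\<^bsub>C\<^esub> g b = f a \<otimes>\<^bsub>C\<^esub> g (r \<odot>\<^bsub>B\<^esub> b)"
  shows "\<exists>h\<in>ring_hom T C. \<forall>a\<in>carrier A. \<forall>b\<in>carrier B. h (t a b) = f a \<otimes>\<^bsub>C\<^esub> g b"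
proof -
  interpret C: cring C by fact
  interpret f: ring_hom_ring A C f
    by (intro ring_hom_ringI2 A.ring_axioms C.ring_axioms f)
  interpret g: ring_hom_ring B C g
    by (intro ring_hom_ringI2 B.ring_axioms C.ring_axioms g)
  let ?S = "carrier A \<times> carrier B"
  have comm: "comm_group (add_monoid C)"
    by (rule C.a_comm_group)
  obtain u where u: "u \<in> hom (free_Abelian_group ?S) (add_monoid C)"
    "\<And>p. p \<in> ?S \<Longrightarrow> u (frag_of p) = f (fst p) \<otimes>\<^bsub>C\<^esub> g (snd p)"
    by (rule comm_group.free_Abelian_group_universal[OF comm, of "\<lambda>p. f (fst p) \<otimes>\<^bsub>C\<^esub> g (snd p)" ?S]) auto
  have u_closed: "u x \<in> carrier C" if "x \<in> carrier F" for x
    using that hom_in_carrier[OF u(1), of x] by (simp add: free_pair_ring_sel)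
  have u_add: "u (x + y) = u x \<oplus>\<^bsub>C\<^esub> u y" if "x \<in> carrier F" "y \<in> carrier F" for x y
    using that hom_mult[OF u(1), of x y] by (simp add: free_pair_ring_sel)
  have u_diff: "u (x - y) = u x \<ominus>\<^bsub>C\<^esub> u y" if "x \<in> carrier F" "y \<in> carrier F" for x y
  proof -
    have "u x = u (x - y) \<oplus>\<^bsub>C\<^esub> u y"
      using u_add[of "x - y" y] that by simp
    then show ?thesis
      using that u_closed by (simp add: C.minus_eq C.add.m_assoc C.r_neg)
  qed
  have u_zero: "u 0 = \<zero>\<^bsub>C\<^esub>"
    using u_diff[of 0 0] u_closed[of 0] by (simp add: free_pair_ring_sel C.minus_eq C.r_neg)
  \<comment> \<open>On pairs this is commutativity of \<open>C\<close>, which moves the value of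
    \<open>g\<close> past that of \<open>f\<close>.\<close>
  have u_mult: "u (x \<otimes>\<^bsub>F\<^esub> y) = u x \<otimes>\<^bsub>C\<^esub> u y" if "x \<in> carrier F" "y \<in> carrier F" for x y
  proof -
    have "Poly_Mapping.keys x \<subseteq> ?S"
      using that by (simp add: free_pair_ring_sel)
    then show ?thesis
    proof (induction x rule: frag_induction')
      case (one p)
      obtain a b where p: "p = (a, b)" "a \<in> carrier A" "b \<in> carrier B"
        using one by auto
      have "Poly_Mapping.keys y \<subseteq> ?S"
        using that by (simp add: free_pair_ring_sel)
      then show ?case
      proof (induction y rule: frag_induction')
        case (one p')
        then obtain a' b' where p': "p' = (a', b')" "a' \<in> carrier A" "b' \<in> carrier B"
          by auto
        show ?case
          using p p' by (simp add: free_pair_mult_of u(2) C.m_ac)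
      next
        case (diff c d)
        then have cd: "c \<in> carrier F" "d \<in> carrier F"
          by (simp_all add: free_pair_ring_sel)
        then have *: "frag_of p \<otimes>\<^bsub>F\<^esub> c \<in> carrier F" "frag_of p \<otimes>\<^bsub>F\<^esub> d \<in> carrier F"
          using p by (simp_all add: F.m_closed)
        show ?case
          using diff cd * p by (simp add: free_pair_mult_diff u_diff u_closed C.ring_simprules)
      qed (use p in \<open>auto simp: free_pair_mult_zero u_zero u_closed\<close>)
    next
      case (diff c d)
      then have cd: "c \<in> carrier F" "d \<in> carrier F"
        by (simp_all add: free_pair_ring_sel)
      then have *: "c \<otimes>\<^bsub>F\<^esub> y \<in> carrier F" "d \<otimes>\<^bsub>F\<^esub> y \<in> carrier F"
        using that by (simp_all add: F.m_closed)
      show ?case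
        using diff cd * that by (simp add: free_pair_mult_diff u_diff u_closed C.ring_simprules)
    qed (use that in \<open>auto simp: free_pair_mult_zero u_zero u_closed\<close>)
  qed
  have u_hom: "u \<in> ring_hom F C"
    by (rule ring_hom_memI)
      (auto simp: u_closed u_mult free_pair_ring_sel(4) u_add, auto simp: free_pair_ring_sel u(2))
  interpret u: ring_hom_ring F C u
    by (intro ring_hom_ringI2 F.ring_axioms C.ring_axioms u_hom)
  have cancel: "x \<oplus>\<^bsub>C\<^esub> y \<ominus>\<^bsub>C\<^esub> x \<ominus>\<^bsub>C\<^esub> y = \<zero>\<^bsub>C\<^esub>" if "x \<in> carrier C" "y \<in> carrier C" for x y
    using that by algebra
  have "tensor_rels R A B \<subseteq> a_kernel F C u"
  proof
    fix x assume x: "x \<in> tensor_rels R A B"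
    then have "u x = \<zero>\<^bsub>C\<^esub>"
      unfolding tensor_rels_def
    proof (elim UnE CollectE exE conjE)
      fix a a' b
      assume "x = frag_of (a \<oplus>\<^bsub>A\<^esub> a', b) - frag_of (a, b) - frag_of (a', b)"
        and "a \<in> carrier A" "a' \<in> carrier A" "b \<in> carrier B"
      then show ?thesis
        by (simp add: u_diff u(2) C.l_distr cancel)
    next
      fix a b b'
      assume "x = frag_of (a, b \<oplus>\<^bsub>B\<^esub> b') - frag_of (a, b) - frag_of (a, b')"
        and "a \<in> carrier A" "b \<in> carrier B" "b' \<in> carrier B"
      then show ?thesis
        by (simp add: u_diff u(2) C.r_distr cancel)
    next
      fix r a b
      assume "x = frag_of (r \<odot>\<^bsub>A\<^esub> a, b) - frag_of (a, r \<odot>\<^bsub>B\<^esub> b)"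
        and "r \<in> carrier R" "a \<in> carrier A" "b \<in> carrier B"
      then show ?thesis
        by (simp add: u_diff u(2) bal C.minus_eq C.r_neg)
    qed
    then show "x \<in> a_kernel F C u"
      using x tensor_rels_subset unfolding a_kernel_def' by blast
  qed
  then have "I \<subseteq> a_kernel F C u"
    unfolding tensor_ideal_def by (rule F.genideal_minimal[OF u.kernel_is_ideal])
  then have vanish: "u x = \<zero>\<^bsub>C\<^esub>" if "x \<in> I" for x
    using that unfolding a_kernel_def' by blast
  from quotient_lift[OF ideal_I u_hom F.ring_axioms C.ring_axioms vanish]
  obtain h where h: "h \<in> ring_hom (F Quot I) C" "\<And>x. x \<in> carrier F \<Longrightarrow> h (I +>\<^bsub>F\<^esub> x) = u x"
    by blast
  show ?thesis
  proof (intro bexI[of _ h] ballI)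
    show "h \<in> ring_hom T C"
      using h(1) by (simp add: tensor_ring_def)
    show "h (t a b) = f a \<otimes>\<^bsub>C\<^esub> g b" if "a \<in> carrier A" "b \<in> carrier B" for a b
      using that by (simp add: tens_def h(2) u(2))
  qed
qed

text \<open>Unpacks the definite description. Pure tensors give uniqueness on the carrier, and
  extensionality turns agreement there into equality of functions.\<close>

lemma tensor_lift:
  assumes C: "cring C" and f: "f \<in> ring_hom A C" and g: "g \<in> ring_hom B C"
    and bal: "\<And>r a b. \<lbrakk>r \<in> carrier R; a \<in> carrier A; b \<in> carrier B\<rbrakk>
      \<Longrightarrow> f (r \<odot>\<^bsub>A\<^esub> a) \<otimes>\<^bsub>C\<^esub> g b = f a \<otimes>\<^bsub>C\<^esub> g (r \<odot>\<^bsub>B\<^esub> b)"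
  shows "tensor_lift R A B C f g \<in> ring_hom T C"
    and "\<And>a b. a \<in> carrier A \<Longrightarrow> b \<in> carrier B \<Longrightarrow> tensor_lift R A B C f g (t a b) = f a \<otimes>\<^bsub>C\<^esub> g b"
    and "tensor_lift R A B C f g \<in> extensional (carrier T)"
proof -
  have C': "ring C"
    using C by (rule cring.axioms)
  let ?P = "\<lambda>h. h \<in> ring_hom T C \<and> h \<in> extensional (carrier T) \<and>
     (\<forall>a\<in>carrier A. \<forall>b\<in>carrier B. h (t a b) = f a \<otimes>\<^bsub>C\<^esub> g b)"
  obtain h where h: "h \<in> ring_hom T C"
    "\<And>a b. a \<in> carrier A \<Longrightarrow> b \<in> carrier B \<Longrightarrow> h (t a b) = f a \<otimes>\<^bsub>C\<^esub> g b"
    using tensor_lift_exists[OF assms] by blast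
  have ex: "?P (restrict h (carrier T))"
    using h restrict_ring_hom[OF h(1) T.ring_axioms] by simp
  have uniq: "h1 = h2" if h1: "?P h1" and h2: "?P h2" for h1 h2
  proof (rule extensionalityI[of _ "carrier T"])
    show "h1 \<in> extensional (carrier T)" "h2 \<in> extensional (carrier T)"
      using h1 h2 by blast+
    show "h1 x = h2 x" if x: "x \<in> carrier T" for x
    proof (rule tensor_hom_eqI[OF conjunct1[OF h1] conjunct1[OF h2] C' _ x])
      fix a b assume "a \<in> carrier A" "b \<in> carrier B"
      then show "h1 (t a b) = h2 (t a b)"
        using h1 h2 by metis
    qed
  qed
  have "\<exists>!h. ?P h"
    by (rule ex1I[of ?P, OF ex]) (rule uniq[OF _ ex])
  from theI'[OF this] have "?P (tensor_lift R A B C f g)"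
    unfolding tensor_lift_def .
  then show "tensor_lift R A B C f g \<in> ring_hom T C"
    "\<And>a b. a \<in> carrier A \<Longrightarrow> b \<in> carrier B \<Longrightarrow> tensor_lift R A B C f g (t a b) = f a \<otimes>\<^bsub>C\<^esub> g b"
    "tensor_lift R A B C f g \<in> extensional (carrier T)"
    by blast+
qed

end

section \<open>Rational functions\<close>

lemma ring_of_type_algebra_sel [simp]:
  "carrier ring_of_type_algebra = UNIV"
  "monoid.mult ring_of_type_algebra = (*)"
  "one ring_of_type_algebra = 1"
  "ring.zero ring_of_type_algebra = 0"
  "add ring_of_type_algebra = (+)"
  by (auto simp: ring_of_type_algebra_def)

lemma ring_of_type_algebra_minus [simp]:
  fixes x y :: "'a::comm_ring_1"
  shows "x \<ominus>\<^bsub>ring_of_type_algebra\<^esub> y = x - y"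
proof -
  interpret cring "ring_of_type_algebra :: 'a ring" ..
  have "x = (x - y) \<oplus>\<^bsub>ring_of_type_algebra\<^esub> y"
    by simp
  then show ?thesis
    by (metis add.inv_solve_right minus_eq ring_of_type_algebra_sel(1) UNIV_I)
qed

lemma ring_of_type_algebra_pow [simp]:
  fixes x :: "'a::comm_ring_1"
  shows "x [^]\<^bsub>ring_of_type_algebra\<^esub> (n::nat) = x ^ n"
proof -
  interpret cring "ring_of_type_algebra :: 'a ring" ..
  show ?thesis
    by (induction n) (simp_all add: mult.commute)
qed

lemma mem_ring_hom_of_type_iff:
  "h \<in> ring_hom ring_of_type_algebra S \<longleftrightarrow> (\<forall>x. h x \<in> carrier S) \<and>
     (\<forall>x y. h (x * y) = h x \<otimes>\<^bsub>S\<^esub> h y) \<and> (\<forall>x y. h (x + y) = h x \<oplus>\<^bsub>S\<^esub> h y) \<and> h 1 = \<one>\<^bsub>S\<^esub>"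
  by (auto simp: ring_hom_def)

lemma ratfun_const_simps [simp]:
  "ratfun_const 0 = 0" "ratfun_const 1 = 1"
  by (auto simp: ratfun_const_def Zero_fract_def One_fract_def one_pCons)

lemma ratfun_const_add: "ratfun_const (a + b) = ratfun_const a + ratfun_const b"
  by (simp add: ratfun_const_def mult.commute)

lemma ratfun_const_mult: "ratfun_const (a * b) = ratfun_const a * ratfun_const b"
  by (simp add: ratfun_const_def mult.commute)

text \<open>Horner's rule, the step of the inductions over polynomials inside K(T).\<close>

lemma ratfun_pCons:
  "Fraction_Field.Fract (pCons a p) 1 = ratfun_const a + ratfun_var * Fraction_Field.Fract p 1"
  by (simp add: ratfun_const_def ratfun_var_def)

section \<open>The derivative of a rational function\<close>

lemma ratfun_deriv_add: "ratfun_deriv (F + G) = ratfun_deriv F + ratfun_deriv G"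
proof (cases F; cases G)
  fix p q r s :: "'a poly"
  assume FG: "F = Fraction_Field.Fract p q" "q \<noteq> 0" "G = Fraction_Field.Fract r s" "s \<noteq> 0"
  show ?thesis
    using FG(2,4) unfolding FG(1,3)
    by (simp add: ratfun_deriv_Fract eq_fract pderiv_add pderiv_mult) (simp add: algebra_simps)
qed

lemma ratfun_deriv_mult: "ratfun_deriv (F * G) = ratfun_deriv F * G + F * ratfun_deriv G"
proof (cases F; cases G)
  fix p q r s :: "'a poly"
  assume FG: "F = Fraction_Field.Fract p q" "q \<noteq> 0" "G = Fraction_Field.Fract r s" "s \<noteq> 0"
  show ?thesis
    using FG(2,4) unfolding FG(1,3)
    by (simp add: ratfun_deriv_Fract eq_fract pderiv_add pderiv_mult) (simp add: algebra_simps)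
qed

lemma ratfun_deriv_const [simp]: "ratfun_deriv (ratfun_const c) = 0"
  by (simp add: ratfun_const_def ratfun_deriv_Fract Zero_fract_def pderiv_pCons)

lemma ratfun_deriv_var [simp]: "ratfun_deriv ratfun_var = 1"
  by (simp add: ratfun_var_def ratfun_deriv_Fract One_fract_def pderiv_pCons one_pCons)

lemma ratfun_deriv_0_1 [simp]: "ratfun_deriv 0 = 0" "ratfun_deriv 1 = 0"
  using ratfun_deriv_const[of 0] ratfun_deriv_const[of 1] by simp_all

section \<open>Ring homomorphisms from K(T)\<close>

lemma ratfun_Fract_eq_divide:
  assumes "q \<noteq> 0"
  shows "Fraction_Field.Fract p q = Fraction_Field.Fract p 1 / Fraction_Field.Fract q 1"
  using assms by (simp add: divide_fract)

text \<open>Horner's rule settles polynomials. The target is just a commutative ring, but inverses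
  in it are unique, and this settles fractions.\<close>

lemma ratfun_hom_eq:
  fixes h h' :: "'k::field poly fract \<Rightarrow> 's"
  assumes h: "h \<in> ring_hom ring_of_type_algebra S" and h': "h' \<in> ring_hom ring_of_type_algebra S"
    and S: "cring S" and const: "\<And>c. h (ratfun_const c) = h' (ratfun_const c)"
    and var: "h ratfun_var = h' ratfun_var"
  shows "h = h'"
proof
  fix F
  interpret S: cring S by fact
  note hs = h[unfolded mem_ring_hom_of_type_iff] h'[unfolded mem_ring_hom_of_type_iff]
  have poly: "h (Fraction_Field.Fract p 1) = h' (Fraction_Field.Fract p 1)" for p
  proof (induction p)
    case 0
    then show ?case
      using const[of 0] by (simp add: Zero_fract_def[symmetric])
  next
    case (pCons a p)
    then show ?case
      using hs const var by (simp add: ratfun_pCons)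
  qed
  obtain p q :: "'k poly" where F: "F = Fraction_Field.Fract p q" "q \<noteq> 0"
    by (cases F)
  define P Q where "P = Fraction_Field.Fract p 1" and "Q = Fraction_Field.Fract q 1"
  have Q: "Q \<noteq> 0"
    using F(2) by (simp add: Q_def Zero_fract_def eq_fract)
  have FPQ: "F = P * inverse Q"
    using ratfun_Fract_eq_divide[OF F(2), of p] unfolding F(1) P_def Q_def by (simp only: divide_inverse)
  \<comment> \<open>A left and a right inverse of the same element, as \<open>h Q = h' Q\<close> is
    already known.\<close>
  have "h (inverse Q) \<otimes>\<^bsub>S\<^esub> h Q = h 1" "h Q \<otimes>\<^bsub>S\<^esub> h' (inverse Q) = h' 1"
    using hs Q poly[of q, folded Q_def] by (metis left_inverse, metis right_inverse)
  then have "h (inverse Q) = h' (inverse Q)"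
    using hs S.inv_unique[of "h (inverse Q)" "h Q" "h' (inverse Q)"] by simp
  then show "h F = h' F"
    using hs poly[of p] by (simp add: FPQ P_def)
qed

section \<open>Quadratic forms on the plane\<close>

text \<open>Applying \<open>sq\<close> to \<open>x = T\<close> and \<open>x = T + 1\<close> shows that multiplication by \<open>T\<close> in the first
  argument has the characteristic polynomial \<open>(x - T)^2\<close>, so such a form is determined by its values
  at \<open>(1, 1)\<close> and \<open>(T, 1)\<close>.\<close>

locale sq_bilinear =
  fixes \<beta> :: "'k::field poly fract \<Rightarrow> 'k poly fract \<Rightarrow> 'k poly fract"
  assumes add_left: "\<beta> (F + F') G = \<beta> F G + \<beta> F' G"
    and add_right: "\<beta> F (G + G') = \<beta> F G + \<beta> F G'"
    and const_left: "\<beta> (ratfun_const c * F) G = ratfun_const c * \<beta> F G"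
    and const_right: "\<beta> F (ratfun_const c * G) = ratfun_const c * \<beta> F G"
    and sq: "\<beta> (H * F) (H * G) = H\<^sup>2 * \<beta> F G"
begin

lemma zero_left [simp]: "\<beta> 0 G = 0"
  using const_left[of 0 0 G] by simp

text \<open>Lets facts about the first argument be reused for the second.\<close>

lemma swap: "sq_bilinear (\<lambda>F G. \<beta> G F)"
  by unfold_locales (auto simp: add_left add_right const_left const_right sq)

text \<open>Polarization: these are the cross terms of \<open>sq\<close> at T + 1, after the
  contributions of T and 1 are removed.\<close>

lemma var_left_right:
  "\<beta> (ratfun_var * F) G + \<beta> F (ratfun_var * G) = 2 * ratfun_var * \<beta> F G"
  using sq[of "ratfun_var + 1" F G] sq[of ratfun_var F G]
  by (simp add: add_left add_right distrib_right power2_eq_square) (simp add: algebra_simps)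

text \<open>The preceding identity at \<open>ratfun_var * F\<close>, where \<open>sq\<close>
  evaluates the other summand. It is a linear recursion of order two in the powers of T.\<close>

lemma var_square_left:
  "\<beta> (ratfun_var * (ratfun_var * F)) G = 2 * ratfun_var * \<beta> (ratfun_var * F) G - ratfun_var\<^sup>2 * \<beta> F G"
  using var_left_right[of "ratfun_var * F" G] by (simp add: sq algebra_simps)

lemma poly_left_eq_0:
  assumes "\<beta> 1 G = 0" "\<beta> ratfun_var G = 0"
  shows "\<beta> (Fraction_Field.Fract p 1) G = 0"
proof -
  \<comment> \<open>The recursion has order two, so the induction carries the values at p and at T p
    together.\<close>
  have "\<beta> (Fraction_Field.Fract p 1) G = 0 \<and> \<beta> (ratfun_var * Fraction_Field.Fract p 1) G = 0"
  proof (induction p)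
    case 0
    then show ?case
      by (simp add: Zero_fract_def[symmetric])
  next
    case (pCons a p)
    have "\<beta> (ratfun_const a) G = 0" "\<beta> (ratfun_var * ratfun_const a) G = 0"
      using const_left[of a 1 G] const_left[of a ratfun_var G] assms
      by (simp_all add: mult.commute)
    with pCons show ?case
      by (simp add: ratfun_pCons add_left distrib_left var_square_left)
  qed
  then show ?thesis ..
qed

text \<open>Vanishing at the four pairs formed from 1 and T spreads to polynomials in one argument,
  then in the other, and at last to fractions.\<close>

lemma eq_0:
  assumes "\<beta> 1 1 = 0" "\<beta> ratfun_var 1 = 0"
  shows "\<beta> F G = 0"
proof -
  interpret swap: sq_bilinear "\<lambda>F G. \<beta> G F"
    by (rule swap)
  have "\<beta> 1 ratfun_var = 0"
    using var_left_right[of 1 1] assms by simp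
  moreover have "\<beta> ratfun_var ratfun_var = 0"
    using sq[of ratfun_var 1 1] assms by simp
  ultimately have poly: "\<beta> (Fraction_Field.Fract p 1) (Fraction_Field.Fract q 1) = 0" for p q
    using swap.poly_left_eq_0[of "Fraction_Field.Fract p 1" q] poly_left_eq_0[of 1 p]
      poly_left_eq_0[of ratfun_var p] assms by simp
  obtain p r where F: "F = Fraction_Field.Fract p r" "r \<noteq> 0"
    by (cases F)
  obtain q s where G: "G = Fraction_Field.Fract q s" "s \<noteq> 0"
    by (cases G)
  \<comment> \<open>One multiplier has to clear both denominators, because \<open>sq\<close> scales
    the two arguments together.\<close>
  let ?H = "Fraction_Field.Fract (r * s) 1"
  have "?H * F = Fraction_Field.Fract (p * s) 1" "?H * G = Fraction_Field.Fract (q * r) 1" "?H \<noteq> 0"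
    using F G by (auto simp: eq_fract Zero_fract_def algebra_simps)
  then show ?thesis
    using sq[of ?H F G] poly by simp
qed

text \<open>Subtracting the right-hand side leaves a form of the same kind that vanishes at (1, 1)
  and (T, 1). At (T, 1) the product is T and the Wronskian F'G - FG' is 1, which dictates the last
  coefficient.\<close>

lemma eq_deriv_form:
  "\<beta> F G = F * G * \<beta> 1 1 + (ratfun_deriv F * G - F * ratfun_deriv G) * (\<beta> ratfun_var 1 - ratfun_var * \<beta> 1 1)"
proof -
  let ?\<gamma> = "\<lambda>F G. \<beta> F G - (F * G * \<beta> 1 1 +
    (ratfun_deriv F * G - F * ratfun_deriv G) * (\<beta> ratfun_var 1 - ratfun_var * \<beta> 1 1))"
  interpret \<gamma>: sq_bilinear ?\<gamma>
    by unfold_locales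
      (simp_all add: add_left add_right const_left const_right sq ratfun_deriv_add ratfun_deriv_mult,
       simp_all add: algebra_simps power2_eq_square)
  show ?thesis
    using \<gamma>.eq_0[of F G] by simp
qed

end

section \<open>Classification of the forms on the plane\<close>

text \<open>\<open>a\<close> and \<open>b\<close> belong to the two axes, \<open>c\<close> and
  \<open>d\<close> are the coordinates of the cross form; \<open>d\<close> multiplies the Wronskian
  of F and G.\<close>

definition plane_form ::
  "'k::field poly fract \<Rightarrow> 'k poly fract \<Rightarrow> 'k poly fract \<Rightarrow> 'k poly fract \<Rightarrow>
   'k poly fract \<times> 'k poly fract \<Rightarrow> 'k poly fract" where
  "plane_form a b c d = (\<lambda>(F, G). a * F\<^sup>2 + b * G\<^sup>2 + c * (F * G) + d * (ratfun_deriv F * G - F * ratfun_deriv G))"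

text \<open>The first two points isolate \<open>a\<close> and \<open>b\<close>, the third then gives
  \<open>c\<close>, and (T, 1) detects \<open>d\<close> because T has derivative 1.\<close>

lemma plane_form_eq_iff:
  "plane_form a b c d = plane_form a' b' c' d' \<longleftrightarrow> a = a' \<and> b = b' \<and> c = c' \<and> d = d'"
proof
  assume eq: "plane_form a b c d = plane_form a' b' c' d'"
  show "a = a' \<and> b = b' \<and> c = c' \<and> d = d'"
    using fun_cong[OF eq, of "(1, 0)"] fun_cong[OF eq, of "(0, 1)"]
      fun_cong[OF eq, of "(1, 1)"] fun_cong[OF eq, of "(ratfun_var, 1)"]
    by (simp add: plane_form_def)
qed auto

lemma prod_mod_sel [simp]:
  "carrier (prod_mod M N) = carrier M \<times> carrier N"
  "ring.zero (prod_mod M N) = (\<zero>\<^bsub>M\<^esub>, \<zero>\<^bsub>N\<^esub>)"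
  "add (prod_mod M N) (x, y) (x', y') = (x \<oplus>\<^bsub>M\<^esub> x', y \<oplus>\<^bsub>N\<^esub> y')"
  "module.smult (prod_mod M N) r (x, y) = (r \<odot>\<^bsub>M\<^esub> x, r \<odot>\<^bsub>N\<^esub> y)"
  by (auto simp: prod_mod_def)

lemma fun_mod_sel [simp]:
  "carrier (fun_mod M N H) = H"
  "ring.zero (fun_mod M N H) = (\<lambda>x\<in>carrier M. \<zero>\<^bsub>N\<^esub>)"
  "add (fun_mod M N H) f g = (\<lambda>x\<in>carrier M. f x \<oplus>\<^bsub>N\<^esub> g x)"
  "module.smult (fun_mod M N H) r f = (\<lambda>x\<in>carrier M. r \<odot>\<^bsub>N\<^esub> f x)"
  by (auto simp: fun_mod_def)

lemma Quad_sel [simp]: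
  "ring.zero (Quad R A \<phi> M N) = (\<lambda>x\<in>carrier M. \<zero>\<^bsub>N\<^esub>)"
  "add (Quad R A \<phi> M N) f g = (\<lambda>x\<in>carrier M. f x \<oplus>\<^bsub>N\<^esub> g x)"
  "module.smult (Quad R A \<phi> M N) r f = (\<lambda>x\<in>carrier M. r \<odot>\<^bsub>N\<^esub> f x)"
  by (auto simp: Quad_def)

abbreviation scalar_ring :: "'k::field ring" where
  "scalar_ring \<equiv> ring_of_type_algebra"

abbreviation ratfun_ring :: "'k::field poly fract ring" where
  "ratfun_ring \<equiv> ring_of_type_algebra"

abbreviation ratfun_line :: "('k::field poly fract, 'k poly fract) module" where
  "ratfun_line \<equiv> alg_along ratfun_ring id"

abbreviation ratfun_plane :: "('k::field poly fract, 'k poly fract \<times> 'k poly fract) module" where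
  "ratfun_plane \<equiv> prod_mod ratfun_line ratfun_line"

lemma mem_Quad_plane_iff:
  "q \<in> carrier (Quad R ratfun_ring \<phi> ratfun_plane ratfun_line) \<longleftrightarrow>
    (\<forall>a F G. q (a * F, a * G) = a\<^sup>2 * q (F, G)) \<and>
    bilinear_along R \<phi> ratfun_plane ratfun_line (pol ratfun_plane ratfun_line q)"
  by (auto simp: Quad_def)

lemma pol_plane:
  "pol ratfun_plane ratfun_line q (F, G) (F', G') = q (F + F', G + G') - q (F, G) - q (F', G')"
  by (simp add: pol_def)

lemma pol_plane_form:
  "pol ratfun_plane ratfun_line (plane_form a b c d) (F, G) (F', G') =
    2 * a * F * F' + 2 * b * G * G' + c * (F * G' + F' * G) +
    d * (ratfun_deriv F * G' - F * ratfun_deriv G' + ratfun_deriv F' * G - F' * ratfun_deriv G)"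
  by (simp add: pol_plane plane_form_def ratfun_deriv_add) (simp add: algebra_simps power2_eq_square)

text \<open>When F and G are scaled by H, the terms of the Wronskian with H' cancel, so it is
  homogeneous of degree two. Its bilinearity is over K, whose elements have derivative 0.\<close>

lemma plane_form_mem_Quad:
  "plane_form a b c d \<in> carrier (Quad scalar_ring ratfun_ring ratfun_const ratfun_plane ratfun_line)"
proof -
  have "plane_form a b c d (H * F, H * G) = H\<^sup>2 * plane_form a b c d (F, G)" for H F G
    by (simp add: plane_form_def ratfun_deriv_mult) (simp add: algebra_simps power2_eq_square)
  moreover have "bilinear_along scalar_ring ratfun_const ratfun_plane ratfun_line
      (pol ratfun_plane ratfun_line (plane_form a b c d))"
    unfolding bilinear_along_def
    by (simp add: pol_plane_form ratfun_deriv_add ratfun_deriv_mult) (simp add: algebra_simps)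
  ultimately show ?thesis
    by (simp add: mem_Quad_plane_iff)
qed

text \<open>A form is the sum of its axis parts and of its polar form taken between the axes, and to
  the latter \<open>eq_deriv_form\<close> applies.\<close>

lemma Quad_plane_obtain:
  assumes "q \<in> carrier (Quad scalar_ring ratfun_ring ratfun_const ratfun_plane ratfun_line)"
  obtains a b c d where "q = plane_form a b c d"
proof -
  let ?b = "pol ratfun_plane ratfun_line q"
  have hom: "\<And>a F G. q (a * F, a * G) = a\<^sup>2 * q (F, G)"
    and bil: "bilinear_along scalar_ring ratfun_const ratfun_plane ratfun_line ?b"
    using assms by (auto simp: mem_Quad_plane_iff)
  have bil_add: "?b (F1 + F1', F2 + F2') (G1, G2) = ?b (F1, F2) (G1, G2) + ?b (F1', F2') (G1, G2)"
      "?b (G1, G2) (F1 + F1', F2 + F2') = ?b (G1, G2) (F1, F2) + ?b (G1, G2) (F1', F2')"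
    and bil_const: "?b (ratfun_const r * F1, ratfun_const r * F2) (G1, G2) = ratfun_const r * ?b (F1, F2) (G1, G2)"
      "?b (F1, F2) (ratfun_const r * G1, ratfun_const r * G2) = ratfun_const r * ?b (F1, F2) (G1, G2)"
    for F1 F2 F1' F2' G1 G2 r
    using bil by (auto simp: bilinear_along_def)
  define \<beta> where "\<beta> = (\<lambda>F G. ?b (F, 0) (0, G))"
  interpret sq_bilinear \<beta>
  proof
    fix F F' G G' H c
    show "\<beta> (F + F') G = \<beta> F G + \<beta> F' G" "\<beta> F (G + G') = \<beta> F G + \<beta> F G'"
      using bil_add(1)[of F F' 0 0 0 G] bil_add(2)[of F 0 0 0 G G'] by (simp_all add: \<beta>_def)
    show "\<beta> (ratfun_const c * F) G = ratfun_const c * \<beta> F G"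
      "\<beta> F (ratfun_const c * G) = ratfun_const c * \<beta> F G"
      using bil_const(1)[of c F 0 0 G] bil_const(2)[of F 0 c 0 G] by (simp_all add: \<beta>_def)
    \<comment> \<open>The polar form consists of three values of \<open>q\<close>, each of which
      scales by the square of H.\<close>
    show "\<beta> (H * F) (H * G) = H\<^sup>2 * \<beta> F G"
      using hom[of H F G] hom[of H F 0] hom[of H 0 G] by (simp add: \<beta>_def pol_plane algebra_simps)
  qed
  have eq: "q (F, G) = plane_form (q (1, 0)) (q (0, 1)) (\<beta> 1 1) (\<beta> ratfun_var 1 - ratfun_var * \<beta> 1 1) (F, G)" for F G
  proof -
    have "q (F, G) = q (F, 0) + q (0, G) + \<beta> F G"
      by (simp add: \<beta>_def pol_plane)
    also have "\<beta> F G = F * G * \<beta> 1 1 +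
        (ratfun_deriv F * G - F * ratfun_deriv G) * (\<beta> ratfun_var 1 - ratfun_var * \<beta> 1 1)"
      by (rule eq_deriv_form)
    finally show ?thesis
      using hom[of F 1 0] hom[of G 0 1] by (simp add: plane_form_def algebra_simps)
  qed
  have "q = plane_form (q (1, 0)) (q (0, 1)) (\<beta> 1 1) (\<beta> ratfun_var 1 - ratfun_var * \<beta> 1 1)"
    by (rule ext, rule prod.exhaust, erule ssubst, rule eq)
  then show ?thesis
    by (rule that)
qed

lemma carrier_Quad_plane:
  "carrier (Quad scalar_ring ratfun_ring ratfun_const ratfun_plane ratfun_line) =
    {plane_form a b c d | a b c d. True}"
proof (intro equalityI subsetI)
  fix q :: "'a poly fract \<times> 'a poly fract \<Rightarrow> 'a poly fract"
  assume "q \<in> carrier (Quad scalar_ring ratfun_ring ratfun_const ratfun_plane ratfun_line)"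
  then obtain a b c d where "q = plane_form a b c d"
    by (rule Quad_plane_obtain)
  then show "q \<in> {plane_form a b c d | a b c d. True}"
    by blast
qed (use plane_form_mem_Quad in auto)

text \<open>A form over K(T) is also one over K and so has four coefficients; linearity in T
  excludes the Wronskian.\<close>

lemma carrier_Quad_plane_id:
  "carrier (Quad ratfun_ring ratfun_ring id ratfun_plane ratfun_line) = {plane_form a b c 0 | a b c. True}"
proof (intro equalityI subsetI)
  fix q assume q: "q \<in> carrier (Quad ratfun_ring ratfun_ring id ratfun_plane ratfun_line)"
  then have "q \<in> carrier (Quad scalar_ring ratfun_ring ratfun_const ratfun_plane ratfun_line)"
    by (simp add: mem_Quad_plane_iff bilinear_along_def)
  then obtain a b c d where eq: "q = plane_form a b c d"
    by (rule Quad_plane_obtain)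
  let ?b = "pol ratfun_plane ratfun_line q"
  have "bilinear_along ratfun_ring id ratfun_plane ratfun_line ?b"
    using q by (simp add: mem_Quad_plane_iff)
  then have "\<forall>r\<in>carrier ratfun_ring. \<forall>x\<in>carrier ratfun_plane. \<forall>y\<in>carrier ratfun_plane.
      ?b (id r \<odot>\<^bsub>ratfun_plane\<^esub> x) y = id r \<odot>\<^bsub>ratfun_line\<^esub> ?b x y"
    unfolding bilinear_along_def by blast
  \<comment> \<open>In coefficients this equation reads c T + d = T c.\<close>
  from this[rule_format, of ratfun_var "(1, 0)" "(0, 1)"]
  have "?b (id ratfun_var \<odot>\<^bsub>ratfun_plane\<^esub> (1, 0)) (0, 1) = id ratfun_var \<odot>\<^bsub>ratfun_line\<^esub> ?b (1, 0) (0, 1)"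
    by simp
  then have "?b (ratfun_var, 0) (0, 1) = ratfun_var * ?b (1, 0) (0, 1)"
    by simp
  then have "d = 0"
    by (simp add: eq pol_plane_form)
  then show "q \<in> {plane_form a b c 0 | a b c. True}"
    using eq by blast
next
  fix q :: "'a poly fract \<times> 'a poly fract \<Rightarrow> 'a poly fract"
  assume "q \<in> {plane_form a b c 0 | a b c. True}"
  then obtain a b c where eq: "q = plane_form a b c 0"
    by blast
  have "bilinear_along ratfun_ring id ratfun_plane ratfun_line (pol ratfun_plane ratfun_line (plane_form a b c 0))"
    unfolding bilinear_along_def
    by (simp add: pol_plane_form) (simp add: algebra_simps)
  then show "q \<in> carrier (Quad ratfun_ring ratfun_ring id ratfun_plane ratfun_line)"
    using plane_form_mem_Quad[of a b c 0] eq by (simp add: mem_Quad_plane_iff)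
qed

lemma plane_form_add:
  "(\<lambda>x. plane_form a b c d x + plane_form a' b' c' d' x) = plane_form (a + a') (b + b') (c + c') (d + d')"
  by (rule ext) (auto simp: plane_form_def algebra_simps)

lemma plane_form_smult:
  "(\<lambda>x. H * plane_form a b c d x) = plane_form (H * a) (H * b) (H * c) (H * d)"
  by (rule ext) (auto simp: plane_form_def algebra_simps)

text \<open>The extra copy of K(T) records the Wronskian coefficient; what remains is the general
  K(T)-quadratic form.\<close>

lemma Quad_plane_iso:
  "\<exists>h. h \<in> mod_isos ratfun_ring (Quad (scalar_ring :: 'k::field ring) ratfun_ring ratfun_const ratfun_plane ratfun_line)
    (prod_mod (Quad ratfun_ring ratfun_ring id ratfun_plane ratfun_line) ratfun_line)"
proof -
  let ?M = "Quad (scalar_ring :: 'k ring) ratfun_ring ratfun_const ratfun_plane ratfun_line"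
  let ?N = "prod_mod (Quad ratfun_ring ratfun_ring id ratfun_plane ratfun_line) (ratfun_line :: ('k poly fract, _) module)"
  \<comment> \<open>This extracts \<open>d\<close>: the value at (T, 1) is a T^2 + b + c T + d, and
    a, b, c are found from the values at (1, 0), (0, 1) and (1, 1).\<close>
  define e where "e = (\<lambda>q :: 'k poly fract \<times> 'k poly fract \<Rightarrow> 'k poly fract.
    q (ratfun_var, 1) - ratfun_var\<^sup>2 * q (1, 0) - q (0, 1) - ratfun_var * (q (1, 1) - q (1, 0) - q (0, 1)))"
  define h where "h = (\<lambda>q\<in>carrier ?M.
    (\<lambda>(F, G). q (F, G) - e q * (ratfun_deriv F * G - F * ratfun_deriv G), e q))"
  have e: "e (plane_form a b c d) = d" for a b c d
    by (simp add: e_def plane_form_def algebra_simps)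
  have h: "h (plane_form a b c d) = (plane_form a b c 0, d)" for a b c d
    unfolding h_def using plane_form_mem_Quad[of a b c d]
    by (simp add: e fun_eq_iff) (simp add: plane_form_def)
  have "h \<in> carrier ?M \<rightarrow>\<^sub>E carrier ?N"
  proof (rule PiE_I)
    fix q assume "q \<in> carrier ?M"
    then obtain a b c d where "q = plane_form a b c d"
      by (rule Quad_plane_obtain)
    then show "h q \<in> carrier ?N"
      by (auto simp: h carrier_Quad_plane_id)
  qed (simp add: h_def)
  moreover have "h (q \<oplus>\<^bsub>?M\<^esub> r) = h q \<oplus>\<^bsub>?N\<^esub> h r"
    if q: "q \<in> carrier ?M" and r: "r \<in> carrier ?M" for q r
  proof -
    obtain a b c d where "q = plane_form a b c d"
      using q by (rule Quad_plane_obtain)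
    moreover obtain a' b' c' d' where "r = plane_form a' b' c' d'"
      using r by (rule Quad_plane_obtain)
    ultimately show ?thesis
      by (simp add: h plane_form_add restrict_UNIV)
  qed
  moreover have "h (H \<odot>\<^bsub>?M\<^esub> q) = H \<odot>\<^bsub>?N\<^esub> h q" if q: "q \<in> carrier ?M" for H q
  proof -
    obtain a b c d where "q = plane_form a b c d"
      using q by (rule Quad_plane_obtain)
    then show ?thesis
      by (simp add: h plane_form_smult restrict_UNIV)
  qed
  ultimately have "h \<in> mod_homs ratfun_ring ?M ?N"
    unfolding mod_homs_def by blast
  moreover have "bij_betw h (carrier ?M) (carrier ?N)"
    by (rule bij_betw_byWitness[where f' = "\<lambda>(q, d). \<lambda>x. q x + plane_form 0 0 0 d x"])
      (auto simp: carrier_Quad_plane carrier_Quad_plane_id h plane_form_add plane_form_eq_iff)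
  ultimately show ?thesis
    unfolding mod_isos_def by blast
qed

section \<open>Restriction to the axes and its kernel\<close>

lemma restrict_summands_plane_form:
  "restrict_summands ratfun_line ratfun_line (plane_form a b c d) = (\<lambda>F. a * F\<^sup>2, \<lambda>F. b * F\<^sup>2)"
  by (auto simp: restrict_summands_def plane_form_def)

lemma square_mem_Quad:
  "(\<lambda>F. a * F\<^sup>2) \<in> carrier (Quad ratfun_ring ratfun_ring id ratfun_line ratfun_line)"
  by (auto simp: Quad_def bilinear_along_def pol_def) (auto simp: algebra_simps power2_eq_square)

text \<open>On an axis the product and the Wronskian vanish. The restrictions are therefore
  multiples of the square, which is quadratic over K(T) and not merely over K.\<close>

lemma restrict_summands_hom:
  "(\<lambda>f\<in>carrier (Quad scalar_ring ratfun_ring ratfun_const ratfun_plane ratfun_line).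
      restrict_summands ratfun_line ratfun_line f)
    \<in> mod_homs ratfun_ring (Quad (scalar_ring :: 'k::field ring) ratfun_ring ratfun_const ratfun_plane ratfun_line)
      (prod_mod (Quad ratfun_ring ratfun_ring id ratfun_line ratfun_line)
        (Quad ratfun_ring ratfun_ring id ratfun_line ratfun_line))"
proof -
  let ?M = "Quad (scalar_ring :: 'k ring) ratfun_ring ratfun_const ratfun_plane ratfun_line"
  let ?N = "Quad ratfun_ring ratfun_ring id ratfun_line ratfun_line"
  define h where "h = (\<lambda>f\<in>carrier ?M. restrict_summands ratfun_line ratfun_line f)"
  have h: "h (plane_form a b c d) = (\<lambda>F. a * F\<^sup>2, \<lambda>F. b * F\<^sup>2)" for a b c d
    unfolding h_def using plane_form_mem_Quad[of a b c d] by (simp add: restrict_summands_plane_form)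
  have "h \<in> carrier ?M \<rightarrow>\<^sub>E carrier (prod_mod ?N ?N)"
  proof (rule PiE_I)
    fix q assume "q \<in> carrier ?M"
    then obtain a b c d where "q = plane_form a b c d"
      by (rule Quad_plane_obtain)
    then show "h q \<in> carrier (prod_mod ?N ?N)"
      by (simp add: h square_mem_Quad)
  qed (simp add: h_def)
  moreover have "h (q \<oplus>\<^bsub>?M\<^esub> r) = h q \<oplus>\<^bsub>prod_mod ?N ?N\<^esub> h r"
    if q: "q \<in> carrier ?M" and r: "r \<in> carrier ?M" for q r
  proof -
    obtain a b c d where "q = plane_form a b c d"
      using q by (rule Quad_plane_obtain)
    moreover obtain a' b' c' d' where "r = plane_form a' b' c' d'"
      using r by (rule Quad_plane_obtain)
    ultimately show ?thesis
      by (simp add: h plane_form_add restrict_UNIV distrib_right)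
  qed
  moreover have "h (H \<odot>\<^bsub>?M\<^esub> q) = H \<odot>\<^bsub>prod_mod ?N ?N\<^esub> h q" if q: "q \<in> carrier ?M" for H q
  proof -
    obtain a b c d where "q = plane_form a b c d"
      using q by (rule Quad_plane_obtain)
    then show ?thesis
      by (simp add: h plane_form_smult restrict_UNIV mult.assoc)
  qed
  ultimately show ?thesis
    unfolding mod_homs_def h_def[symmetric] by blast
qed

text \<open>The restrictions see exactly \<open>a\<close> and \<open>b\<close>, so \<open>c\<close>
  and \<open>d\<close> stay free.\<close>

lemma carrier_Ker:
  "carrier (ker_mod (Quad (scalar_ring :: 'k::field ring) ratfun_ring ratfun_const ratfun_plane ratfun_line)
      (prod_mod (Quad ratfun_ring ratfun_ring id ratfun_line ratfun_line)
        (Quad ratfun_ring ratfun_ring id ratfun_line ratfun_line))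
      (restrict_summands ratfun_line ratfun_line)) = {plane_form 0 0 c d | c d. True}"
proof -
  have "(\<lambda>F. a * F\<^sup>2) = (\<lambda>F. 0) \<longleftrightarrow> a = 0" for a :: "'k poly fract"
    by (auto simp: fun_eq_iff dest: spec[of _ 1])
  then show ?thesis
    by (auto simp: ker_mod_def a_kernel_def' carrier_Quad_plane restrict_summands_plane_form restrict_UNIV
        plane_form_eq_iff)
qed

section \<open>Dual numbers over the rational functions\<close>

definition dual_numbers :: "('k::field poly fract \<times> 'k poly fract) ring" where
  "dual_numbers = \<lparr>carrier = UNIV, monoid.mult = (\<lambda>(a, b) (c, d). (a * c, a * d + b * c)),
     one = (1, 0), ring.zero = (0, 0), add = (\<lambda>(a, b) (c, d). (a + c, b + d))\<rparr>"

lemma dual_numbers_sel [simp]: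
  "carrier dual_numbers = UNIV"
  "(a, b) \<otimes>\<^bsub>dual_numbers\<^esub> (c, d) = (a * c, a * d + b * c)"
  "(a, b) \<oplus>\<^bsub>dual_numbers\<^esub> (c, d) = (a + c, b + d)"
  "\<one>\<^bsub>dual_numbers\<^esub> = (1, 0)"
  "\<zero>\<^bsub>dual_numbers\<^esub> = (0, 0)"
  by (auto simp: dual_numbers_def)

lemma cring_dual_numbers: "cring (dual_numbers :: ('k::field poly fract \<times> 'k poly fract) ring)"
proof (intro cringI abelian_groupI comm_monoidI)
  fix x :: "'k poly fract \<times> 'k poly fract"
  show "\<exists>y\<in>carrier dual_numbers. y \<oplus>\<^bsub>dual_numbers\<^esub> x = \<zero>\<^bsub>dual_numbers\<^esub>"
    by (cases x, rule bexI[of _ "(- fst x, - snd x)"]) auto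
qed (auto simp: algebra_simps)

lemma ring_dual_numbers: "ring (dual_numbers :: ('k::field poly fract \<times> 'k poly fract) ring)"
  using cring_dual_numbers by (rule cring.axioms)

lemma cring_poly: "cring (ring_of_type_algebra :: 'k::field poly ring)"
  ..

section \<open>The algebra of S over K\<close>

text \<open>Replaces divisibility by a condition on coefficients, so that comparing classes becomes
  a computation.\<close>

lemma mem_dual_ideal_iff:
  "p \<in> (dual_ideal :: 'k::field poly set) \<longleftrightarrow> coeff p 0 = 0 \<and> coeff p 1 = 0"
proof -
  have "p \<in> dual_ideal \<longleftrightarrow> (\<exists>r. p = r * [:0, 1:] ^ 2)"
    by (auto simp: dual_ideal_def cgenideal_def)
  also have "\<dots> \<longleftrightarrow> (\<exists>r. p = pCons 0 (pCons 0 r))"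
    by (simp add: power2_eq_square)
  also have "\<dots> \<longleftrightarrow> coeff p 0 = 0 \<and> coeff p 1 = 0"
    by (cases p, rename_tac a r, case_tac r) auto
  finally show ?thesis .
qed

lemma ideal_dual_ideal: "ideal (dual_ideal :: 'k::field poly set) ring_of_type_algebra"
  unfolding dual_ideal_def by (rule cring.cgenideal_ideal[OF cring_poly]) simp

lemma dual_class_eq: "dual_class p = {r. coeff r 0 = coeff p 0 \<and> coeff r 1 = coeff p 1}"
proof (intro equalityI subsetI)
  fix r assume "r \<in> dual_class p"
  then show "r \<in> {r. coeff r 0 = coeff p 0 \<and> coeff r 1 = coeff p 1}"
    by (auto simp: dual_class_def a_r_coset_def' mem_dual_ideal_iff)
next
  fix r assume "r \<in> {r. coeff r 0 = coeff p 0 \<and> coeff r 1 = coeff p 1}"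
  then have "r - p \<in> dual_ideal"
    by (simp add: mem_dual_ideal_iff)
  then show "r \<in> dual_class p"
    unfolding dual_class_def a_r_coset_def' by force
qed

lemma dual_class_eq_iff:
  "dual_class p = dual_class r \<longleftrightarrow> coeff p 0 = coeff r 0 \<and> coeff p 1 = coeff r 1"
  by (auto simp: dual_class_eq set_eq_iff)

lemma dual_class_hom: "dual_class \<in> ring_hom ring_of_type_algebra (dual_ring :: 'k::field poly set ring)"
  using ideal.rcos_ring_hom[OF ideal_dual_ideal]
  by (simp add: dual_class_def[abs_def] dual_ring_def)

lemma cring_dual_ring: "cring (dual_ring :: 'k::field poly set ring)"
  unfolding dual_ring_def by (rule ideal.quotient_is_cring[OF ideal_dual_ideal cring_poly])

lemma carrier_dual_ring: "carrier dual_ring = range dual_class"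
  unfolding dual_ring_def FactRing_def A_RCOSETS_def' dual_class_def by auto

lemma dual_class_mult: "dual_class p \<otimes>\<^bsub>dual_ring\<^esub> dual_class r = dual_class (p * r)"
  and dual_class_add: "dual_class p \<oplus>\<^bsub>dual_ring\<^esub> dual_class r = dual_class (p + r)"
  and dual_class_one: "\<one>\<^bsub>dual_ring\<^esub> = dual_class 1"
  using dual_class_hom unfolding mem_ring_hom_of_type_iff by (metis, metis, metis)

text \<open>The coefficient of a chosen representative is an invariant of the class for the indices
  0 and 1 only.\<close>

definition dual_coeff :: "nat \<Rightarrow> 'k::field poly set \<Rightarrow> 'k" where
  "dual_coeff i l = coeff (SOME p. p \<in> l) i"

lemma dual_coeff_class [simp]:
  "dual_coeff 0 (dual_class p) = coeff p 0"
  "dual_coeff (Suc 0) (dual_class p) = coeff p (Suc 0)"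
proof -
  have "p \<in> dual_class p"
    by (simp add: dual_class_eq)
  then have "(SOME r. r \<in> dual_class p) \<in> dual_class p"
    by (rule someI)
  then have "coeff (SOME r. r \<in> dual_class p) 0 = coeff p 0 \<and> coeff (SOME r. r \<in> dual_class p) 1 = coeff p 1"
    by (subst (asm) (2) dual_class_eq) simp
  then show "dual_coeff 0 (dual_class p) = coeff p 0" "dual_coeff (Suc 0) (dual_class p) = coeff p (Suc 0)"
    unfolding dual_coeff_def by auto
qed

lemma dual_alg_sel [simp]:
  "carrier dual_alg = range dual_class"
  "monoid.mult dual_alg = monoid.mult dual_ring"
  "one dual_alg = dual_class 1"
  "add dual_alg = add dual_ring"
  "module.smult dual_alg c (dual_class p) = dual_class (smult c p)"
  by (simp_all add: dual_alg_def carrier_dual_ring dual_class_one dual_class_mult)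

lemma cring_dual_alg: "cring (dual_alg :: ('k::field, 'k poly set) module)"
  unfolding dual_alg_def by (intro cring_alg_along cring_dual_ring)

text \<open>The map that sends S to e. The two lowest coefficients of a product involve only the two
  lowest of each factor.\<close>

lemma dual_coeffs_hom:
  "(\<lambda>l. (ratfun_const (dual_coeff 0 l), ratfun_const (dual_coeff 1 l))) \<in> ring_hom dual_alg dual_numbers"
  by (rule ring_hom_memI)
    (auto simp: dual_class_mult dual_class_add ratfun_const_add ratfun_const_mult coeff_mult)

section \<open>Comparison of the tensor product with the dual numbers\<close>

abbreviation ratfun_alg :: "('k::field, 'k poly fract) module" where
  "ratfun_alg \<equiv> alg_along ratfun_ring ratfun_const"

interpretation B: tensor_algebra "scalar_ring :: 'k::field ring" ratfun_alg dual_alg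
proof (rule tensor_algebra.intro)
  show "cring (ratfun_alg :: ('k, _) module)" "cring (dual_alg :: ('k, _) module)"
    by (auto intro: cring_dual_alg)
qed auto

abbreviation ratfun_dual :: "('k::field poly fract \<times> 'k poly set \<Rightarrow>\<^sub>0 int) set ring" where
  "ratfun_dual \<equiv> tensor_ring (scalar_ring :: 'k ring) ratfun_alg dual_alg"

abbreviation dual_tens :: "'k::field poly fract \<Rightarrow> 'k poly set \<Rightarrow> ('k poly fract \<times> 'k poly set \<Rightarrow>\<^sub>0 int) set" where
  "dual_tens \<equiv> tens (scalar_ring :: 'k ring) ratfun_alg dual_alg"

abbreviation dual_var :: "'k::field poly set" where
  "dual_var \<equiv> dual_class [:0, 1:]"

definition to_dual :: "('k::field poly fract \<times> 'k poly set \<Rightarrow>\<^sub>0 int) set \<Rightarrow> 'k poly fract \<times> 'k poly fract" where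
  "to_dual = tensor_lift (scalar_ring :: 'k ring) ratfun_alg dual_alg dual_numbers
     (\<lambda>F. (F, 0)) (\<lambda>l. (ratfun_const (dual_coeff 0 l), ratfun_const (dual_coeff 1 l)))"

definition of_dual :: "'k::field poly fract \<times> 'k poly fract \<Rightarrow> ('k poly fract \<times> 'k poly set \<Rightarrow>\<^sub>0 int) set" where
  "of_dual = (\<lambda>(F, G). dual_tens F (dual_class 1) \<oplus>\<^bsub>ratfun_dual\<^esub> dual_tens G dual_var)"

lemma dual_embed_hom: "(\<lambda>F. (F, 0)) \<in> ring_hom ratfun_ring dual_numbers"
  by (simp add: mem_ring_hom_of_type_iff)

lemma
  fixes F :: "'k::field poly fract" and p :: "'k poly"
  shows to_dual_hom: "to_dual \<in> ring_hom ratfun_dual (dual_numbers :: ('k::field poly fract \<times> 'k poly fract) ring)"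
    and to_dual_tens: "to_dual (dual_tens F (dual_class p)) = (F * ratfun_const (coeff p 0), F * ratfun_const (coeff p 1))"
proof -
  have f: "(\<lambda>F. (F, 0)) \<in> ring_hom ratfun_alg (dual_numbers :: ('k poly fract \<times> 'k poly fract) ring)"
    using dual_embed_hom by simp
  have bal: "(r \<odot>\<^bsub>ratfun_alg\<^esub> a, 0) \<otimes>\<^bsub>dual_numbers\<^esub> (ratfun_const (dual_coeff 0 l), ratfun_const (dual_coeff 1 l)) =
      (a, 0) \<otimes>\<^bsub>dual_numbers\<^esub>
        (ratfun_const (dual_coeff 0 (r \<odot>\<^bsub>dual_alg\<^esub> l)), ratfun_const (dual_coeff 1 (r \<odot>\<^bsub>dual_alg\<^esub> l)))"
    if "l \<in> carrier dual_alg" for r :: 'k and a l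
    using that by (auto simp: ratfun_const_mult)
  note lift = B.tensor_lift[OF cring_dual_numbers f dual_coeffs_hom bal, folded to_dual_def]
  show "to_dual \<in> ring_hom ratfun_dual (dual_numbers :: ('k poly fract \<times> 'k poly fract) ring)"
    by (rule lift(1))
  show "to_dual (dual_tens F (dual_class p)) = (F * ratfun_const (coeff p 0), F * ratfun_const (coeff p 1))"
    by (subst lift(2)) auto
qed

lemma dual_tens_smult:
  "dual_tens (ratfun_const c * F) (dual_class p) = dual_tens F (dual_class (smult c p))"
  using B.tens_smult[of c F "dual_class p"] by simp

lemma of_dual_closed [simp]: "of_dual x \<in> carrier ratfun_dual"
  by (cases x) (simp add: of_dual_def)

lemma to_of_dual [simp]: "to_dual (of_dual x) = x"
  by (cases x) (simp add: of_dual_def ring_hom_add[OF to_dual_hom] to_dual_tens)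

lemma dual_tens_zero: "dual_tens F (dual_class 0) = \<zero>\<^bsub>ratfun_dual\<^esub>"
proof -
  have "dual_tens F (dual_class 0) = dual_tens F (dual_class 0) \<oplus>\<^bsub>ratfun_dual\<^esub> dual_tens F (dual_class 0)"
    by (subst B.tens_add_right[symmetric]) (auto simp: dual_class_add)
  then show ?thesis
    by (metis B.T.add.r_cancel_one' B.tens_closed UNIV_I alg_along_simps(1) dual_alg_sel(1) rangeI ring_of_type_algebra_sel(1))
qed

lemma of_dual_hom: "of_dual \<in> ring_hom (dual_numbers :: ('k::field poly fract \<times> 'k poly fract) ring) ratfun_dual"
proof (rule ring_hom_memI)
  let ?z = "dual_tens (0 :: 'k poly fract) dual_var"
  \<comment> \<open>A pure tensor with a zero entry equals its own double, hence is zero.\<close>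
  have "?z = ?z \<oplus>\<^bsub>ratfun_dual\<^esub> ?z" "?z \<in> carrier ratfun_dual"
    using B.tens_add_left[of 0 0 "dual_var :: 'k poly set"] by simp_all
  then have z: "?z = \<zero>\<^bsub>ratfun_dual\<^esub>"
    by (metis B.T.add.r_cancel_one')
  have one: "dual_tens (1 :: 'k poly fract) (dual_class 1) = \<one>\<^bsub>ratfun_dual\<^esub>"
    using B.tens_one by simp
  show "of_dual \<one>\<^bsub>dual_numbers\<^esub> = \<one>\<^bsub>(ratfun_dual :: ('k poly fract \<times> 'k poly set \<Rightarrow>\<^sub>0 int) set ring)\<^esub>"
    by (simp add: of_dual_def z one)
next
  fix x y :: "'k poly fract \<times> 'k poly fract"
  obtain F G F' G' where xy: "x = (F, G)" "y = (F', G')"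
    by (cases x; cases y)
  let ?a = "dual_tens F (dual_class 1)" and ?b = "dual_tens G dual_var"
    and ?c = "dual_tens F' (dual_class 1)" and ?d = "dual_tens G' dual_var"
  have mem: "?a \<in> carrier ratfun_dual" "?b \<in> carrier ratfun_dual" "?c \<in> carrier ratfun_dual" "?d \<in> carrier ratfun_dual"
    by auto
  have add: "dual_tens (H + H') (dual_class p) = dual_tens H (dual_class p) \<oplus>\<^bsub>ratfun_dual\<^esub> dual_tens H' (dual_class p)"
    for H H' and p :: "'k poly"
    using B.tens_add_left[of H H' "dual_class p"] by simp
  have mult: "dual_tens H (dual_class p) \<otimes>\<^bsub>ratfun_dual\<^esub> dual_tens H' (dual_class r) = dual_tens (H * H') (dual_class (p * r))"
    for H H' and p r :: "'k poly"
    using B.tens_mult[of H H' "dual_class p" "dual_class r"] by (simp add: dual_class_mult)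
  have "of_dual (x \<oplus>\<^bsub>dual_numbers\<^esub> y) = (?a \<oplus>\<^bsub>ratfun_dual\<^esub> ?c) \<oplus>\<^bsub>ratfun_dual\<^esub> (?b \<oplus>\<^bsub>ratfun_dual\<^esub> ?d)"
    by (simp add: xy of_dual_def add)
  also have "\<dots> = of_dual x \<oplus>\<^bsub>ratfun_dual\<^esub> of_dual y"
    using mem by (simp add: xy of_dual_def B.T.add.m_ac)
  finally show "of_dual (x \<oplus>\<^bsub>dual_numbers\<^esub> y) = of_dual x \<oplus>\<^bsub>ratfun_dual\<^esub> of_dual y" .
  \<comment> \<open>The square of S is the zero class; this removes the one product of terms that
    has no counterpart in \<open>dual_numbers\<close>.\<close>
  have bd: "dual_class ([:0, 1:] * [:0, 1 :: 'k:]) = dual_class 0"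
    by (simp add: dual_class_eq_iff)
  have "of_dual x \<otimes>\<^bsub>ratfun_dual\<^esub> of_dual y =
      (?a \<otimes>\<^bsub>ratfun_dual\<^esub> ?c \<oplus>\<^bsub>ratfun_dual\<^esub> ?b \<otimes>\<^bsub>ratfun_dual\<^esub> ?c) \<oplus>\<^bsub>ratfun_dual\<^esub>
      (?a \<otimes>\<^bsub>ratfun_dual\<^esub> ?d \<oplus>\<^bsub>ratfun_dual\<^esub> ?b \<otimes>\<^bsub>ratfun_dual\<^esub> ?d)"
    using mem by (simp add: xy of_dual_def B.T.l_distr B.T.r_distr)
  also have "?b \<otimes>\<^bsub>ratfun_dual\<^esub> ?d = \<zero>\<^bsub>ratfun_dual\<^esub>"
    by (simp only: mult bd dual_tens_zero)
  also have "(?a \<otimes>\<^bsub>ratfun_dual\<^esub> ?c \<oplus>\<^bsub>ratfun_dual\<^esub> ?b \<otimes>\<^bsub>ratfun_dual\<^esub> ?c) \<oplus>\<^bsub>ratfun_dual\<^esub>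
      (?a \<otimes>\<^bsub>ratfun_dual\<^esub> ?d \<oplus>\<^bsub>ratfun_dual\<^esub> \<zero>\<^bsub>ratfun_dual\<^esub>) =
      ?a \<otimes>\<^bsub>ratfun_dual\<^esub> ?c \<oplus>\<^bsub>ratfun_dual\<^esub> (?a \<otimes>\<^bsub>ratfun_dual\<^esub> ?d \<oplus>\<^bsub>ratfun_dual\<^esub> ?b \<otimes>\<^bsub>ratfun_dual\<^esub> ?c)"
    using mem by (simp add: B.T.add.m_ac)
  also have "\<dots> = of_dual (x \<otimes>\<^bsub>dual_numbers\<^esub> y)"
    by (simp add: xy of_dual_def mult add)
  finally show "of_dual (x \<otimes>\<^bsub>dual_numbers\<^esub> y) = of_dual x \<otimes>\<^bsub>ratfun_dual\<^esub> of_dual y" ..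
qed simp

text \<open>Modulo S^2 a class is a K-combination of 1 and S, and its coefficients move across the
  tensor sign.\<close>

lemma dual_tens_eq_of_dual:
  "dual_tens F (dual_class p) = of_dual (F * ratfun_const (coeff p 0), F * ratfun_const (coeff p 1))"
proof -
  have "dual_class p = dual_class (smult (coeff p 0) 1 + smult (coeff p 1) [:0, 1:])"
    by (simp add: dual_class_eq_iff)
  also have "\<dots> = dual_class (smult (coeff p 0) 1) \<oplus>\<^bsub>dual_ring\<^esub> dual_class (smult (coeff p 1) [:0, 1:])"
    by (simp only: dual_class_add)
  finally have "dual_tens F (dual_class p) =
      dual_tens F (dual_class (smult (coeff p 0) 1)) \<oplus>\<^bsub>ratfun_dual\<^esub> dual_tens F (dual_class (smult (coeff p 1) [:0, 1:]))"
    using B.tens_add_right[of F "dual_class (smult (coeff p 0) 1)" "dual_class (smult (coeff p 1) [:0, 1:])"]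
    by simp
  then show ?thesis
    by (simp only: dual_tens_smult[symmetric] of_dual_def prod.case mult.commute)
qed

lemma of_to_dual:
  assumes "x \<in> carrier ratfun_dual"
  shows "of_dual (to_dual x) = x"
proof -
  have "(\<lambda>x. of_dual (to_dual x)) \<in> ring_hom ratfun_dual ratfun_dual"
    using ring_hom_trans[OF to_dual_hom of_dual_hom] by (simp add: comp_def)
  moreover have "of_dual (to_dual (dual_tens a l)) = id (dual_tens a l)"
    if "l \<in> carrier dual_alg" for a :: "'a poly fract" and l
    using that by (auto simp: to_dual_tens dual_tens_eq_of_dual)
  ultimately show ?thesis
    using B.tensor_hom_eqI[OF _ id_ring_hom B.T.ring_axioms _ assms] by (metis id_apply)
qed

section \<open>The algebra Q of the rational function field\<close>

text \<open>The universal property of the dual numbers: any square-zero element may be taken as the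
  image of e.\<close>

lemma ring_hom_dual_lift:
  fixes u :: "'k::field poly fract \<Rightarrow> 'c"
  assumes C: "cring C" and u: "u \<in> ring_hom ratfun_ring C" and s: "s \<in> carrier C" "s \<otimes>\<^bsub>C\<^esub> s = \<zero>\<^bsub>C\<^esub>"
  shows "(\<lambda>(F, G). u F \<oplus>\<^bsub>C\<^esub> u G \<otimes>\<^bsub>C\<^esub> s) \<in> ring_hom dual_numbers C"
proof -
  interpret C: cring C by fact
  have uc [simp]: "u F \<in> carrier C" for F
    using u by (simp add: mem_ring_hom_of_type_iff)
  have u0: "u 0 = \<zero>\<^bsub>C\<^esub>"
    using ring_hom_zero[OF u _ C.ring_axioms] ring_from_type_algebra by force
  have uadd: "u (F + G) = u F \<oplus>\<^bsub>C\<^esub> u G" and umult: "u (F * G) = u F \<otimes>\<^bsub>C\<^esub> u G" and u1: "u 1 = \<one>\<^bsub>C\<^esub>" for F G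
    using u unfolding mem_ring_hom_of_type_iff by (metis, metis, metis)
  \<comment> \<open>The factor \<open>s\<close> times \<open>s\<close> is kept, so that this is an
    identity of commutative rings; \<open>s(2)\<close> removes the last term afterwards.\<close>
  have distr: "(a \<oplus>\<^bsub>C\<^esub> b \<otimes>\<^bsub>C\<^esub> s) \<otimes>\<^bsub>C\<^esub> (c \<oplus>\<^bsub>C\<^esub> d \<otimes>\<^bsub>C\<^esub> s) =
      a \<otimes>\<^bsub>C\<^esub> c \<oplus>\<^bsub>C\<^esub> (a \<otimes>\<^bsub>C\<^esub> d \<oplus>\<^bsub>C\<^esub> b \<otimes>\<^bsub>C\<^esub> c) \<otimes>\<^bsub>C\<^esub> s \<oplus>\<^bsub>C\<^esub> b \<otimes>\<^bsub>C\<^esub> d \<otimes>\<^bsub>C\<^esub> (s \<otimes>\<^bsub>C\<^esub> s)"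
    if "a \<in> carrier C" "b \<in> carrier C" "c \<in> carrier C" "d \<in> carrier C" for a b c d
    using that s(1) by algebra
  have sum: "(a \<oplus>\<^bsub>C\<^esub> c) \<oplus>\<^bsub>C\<^esub> (b \<oplus>\<^bsub>C\<^esub> d) \<otimes>\<^bsub>C\<^esub> s = (a \<oplus>\<^bsub>C\<^esub> b \<otimes>\<^bsub>C\<^esub> s) \<oplus>\<^bsub>C\<^esub> (c \<oplus>\<^bsub>C\<^esub> d \<otimes>\<^bsub>C\<^esub> s)"
    if "a \<in> carrier C" "b \<in> carrier C" "c \<in> carrier C" "d \<in> carrier C" for a b c d
    using that s(1) by algebra
  show ?thesis
  proof (rule ring_hom_memI)
    fix x y :: "'k poly fract \<times> 'k poly fract"
    obtain F G F' G' where xy: "x = (F, G)" "y = (F', G')"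
      by (cases x; cases y)
    show "(case x \<otimes>\<^bsub>dual_numbers\<^esub> y of (F, G) \<Rightarrow> u F \<oplus>\<^bsub>C\<^esub> u G \<otimes>\<^bsub>C\<^esub> s) =
        (case x of (F, G) \<Rightarrow> u F \<oplus>\<^bsub>C\<^esub> u G \<otimes>\<^bsub>C\<^esub> s) \<otimes>\<^bsub>C\<^esub> (case y of (F, G) \<Rightarrow> u F \<oplus>\<^bsub>C\<^esub> u G \<otimes>\<^bsub>C\<^esub> s)"
      using distr[of "u F" "u G" "u F'" "u G'"] s by (simp add: xy uadd umult)
    show "(case x \<oplus>\<^bsub>dual_numbers\<^esub> y of (F, G) \<Rightarrow> u F \<oplus>\<^bsub>C\<^esub> u G \<otimes>\<^bsub>C\<^esub> s) =
        (case x of (F, G) \<Rightarrow> u F \<oplus>\<^bsub>C\<^esub> u G \<otimes>\<^bsub>C\<^esub> s) \<oplus>\<^bsub>C\<^esub> (case y of (F, G) \<Rightarrow> u F \<oplus>\<^bsub>C\<^esub> u G \<otimes>\<^bsub>C\<^esub> s)"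
      using sum[of "u F" "u G" "u F'" "u G'"] by (simp add: xy uadd)
  qed (use s in \<open>auto simp: u0 u1\<close>)
qed

text \<open>Leibniz's rule is multiplicativity modulo e^2. These maps substitute T + e and T - e for
  T.\<close>

lemma deriv_hom:
  "(\<lambda>F. (F, ratfun_deriv F)) \<in> ring_hom ratfun_ring dual_numbers"
  "(\<lambda>F. (F, - ratfun_deriv F)) \<in> ring_hom ratfun_ring dual_numbers"
  by (simp_all add: mem_ring_hom_of_type_iff ratfun_deriv_add ratfun_deriv_mult algebra_simps)

lemma fst_hom: "fst \<in> ring_hom dual_numbers ratfun_ring"
  by (rule ring_hom_memI) auto

section \<open>The tensor square and its diagonal subring\<close>

interpretation S: tensor_algebra "scalar_ring :: 'k::field ring" ratfun_alg ratfun_alg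
  by (rule tensor_algebra.intro) auto

abbreviation ratfun_sq :: "'k::field poly fract sq ring" where
  "ratfun_sq \<equiv> sq_ring scalar_ring ratfun_ring ratfun_const"

abbreviation ratfun_sq_tens :: "'k::field poly fract \<Rightarrow> 'k poly fract \<Rightarrow> 'k poly fract sq" where
  "ratfun_sq_tens \<equiv> sq_tens scalar_ring ratfun_ring ratfun_const"

abbreviation ratfun_sq_mult :: "'k::field poly fract sq \<Rightarrow> 'k poly fract" where
  "ratfun_sq_mult \<equiv> sq_mult scalar_ring ratfun_ring ratfun_const"

abbreviation ratfun_Delta :: "'k::field poly fract sq ring" where
  "ratfun_Delta \<equiv> Delta_ring scalar_ring ratfun_ring ratfun_const"

abbreviation ratfun_Q :: "'k::field poly fract qalg ring" where
  "ratfun_Q \<equiv> Q_ring scalar_ring ratfun_ring ratfun_const"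

abbreviation ratfun_Q_tens :: "'k::field poly fract \<Rightarrow> 'k poly fract \<Rightarrow> 'k poly fract \<Rightarrow> 'k poly fract qalg" where
  "ratfun_Q_tens \<equiv> Q_tens scalar_ring ratfun_ring ratfun_const"

lemma cring_sq: "cring (ratfun_sq :: 'k::field poly fract sq ring)"
  unfolding sq_ring_def by (rule S.cring_T)

lemma ring_sq: "ring (ratfun_sq :: 'k::field poly fract sq ring)"
  using cring_sq by (rule cring.axioms)

lemma sq_tens_closed [simp]: "ratfun_sq_tens F G \<in> carrier ratfun_sq"
  unfolding sq_tens_def sq_ring_def by simp

lemma sq_tens_mult:
  "ratfun_sq_tens F G \<otimes>\<^bsub>ratfun_sq\<^esub> ratfun_sq_tens F' G' = ratfun_sq_tens (F * F') (G * G')"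
  unfolding sq_tens_def sq_ring_def by (simp add: S.tens_mult)

lemma sq_tens_one: "ratfun_sq_tens 1 1 = \<one>\<^bsub>ratfun_sq\<^esub>"
  unfolding sq_tens_def sq_ring_def using S.tens_one by simp

lemma sq_tens_hom:
  "(\<lambda>F. ratfun_sq_tens F 1) \<in> ring_hom ratfun_ring ratfun_sq"
  "(\<lambda>F. ratfun_sq_tens 1 F) \<in> ring_hom ratfun_ring ratfun_sq"
  unfolding sq_tens_def sq_ring_def using S.tens_hom_left S.tens_hom_right by simp_all

lemma sq_hom_eqI:
  assumes "h \<in> ring_hom ratfun_sq C" "h' \<in> ring_hom ratfun_sq C" "ring C"
    and "\<And>F. h (ratfun_sq_tens F 1) = h' (ratfun_sq_tens F 1)"
    and "\<And>F. h (ratfun_sq_tens 1 F) = h' (ratfun_sq_tens 1 F)"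
    and "x \<in> carrier ratfun_sq"
  shows "h x = h' x"
  using S.tensor_hom_eqI'[of h C h' x] assms unfolding sq_tens_def sq_ring_def by simp

lemma
  fixes F G :: "'k::field poly fract"
  shows sq_mult_hom: "ratfun_sq_mult \<in> ring_hom ratfun_sq (ratfun_ring :: 'k poly fract ring)"
    and sq_mult_tens: "ratfun_sq_mult (ratfun_sq_tens F G) = F * G"
proof -
  have c: "cring (ratfun_ring :: 'k poly fract ring)" ..
  have i: "id \<in> ring_hom ratfun_alg (ratfun_ring :: 'k poly fract ring)"
    by (simp add: id_ring_hom)
  have bal: "id (r \<odot>\<^bsub>ratfun_alg\<^esub> a) \<otimes>\<^bsub>ratfun_ring\<^esub> id b = id a \<otimes>\<^bsub>ratfun_ring\<^esub> id (r \<odot>\<^bsub>ratfun_alg\<^esub> b)"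
    for r :: 'k and a b
    by simp
  note lift = S.tensor_lift[OF c i i bal, folded sq_mult_def sq_ring_def sq_tens_def]
  show "ratfun_sq_mult \<in> ring_hom ratfun_sq (ratfun_ring :: 'k poly fract ring)"
    by (rule lift(1))
  show "ratfun_sq_mult (ratfun_sq_tens F G) = F * G"
    by (subst lift(2)) auto
qed

definition sq_to_dual :: "'k::field poly fract sq \<Rightarrow> 'k poly fract \<times> 'k poly fract" where
  "sq_to_dual = tensor_lift (scalar_ring :: 'k ring) ratfun_alg ratfun_alg dual_numbers
     (\<lambda>F. (F, ratfun_deriv F)) (\<lambda>F. (F, - ratfun_deriv F))"

lemma
  fixes F G :: "'k::field poly fract"
  shows sq_to_dual_hom: "sq_to_dual \<in> ring_hom ratfun_sq (dual_numbers :: ('k poly fract \<times> 'k poly fract) ring)"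
    and sq_to_dual_tens: "sq_to_dual (ratfun_sq_tens F G) = (F * G, ratfun_deriv F * G - F * ratfun_deriv G)"
proof -
  have f: "(\<lambda>F. (F, ratfun_deriv F)) \<in> ring_hom ratfun_alg (dual_numbers :: ('k poly fract \<times> 'k poly fract) ring)"
    and g: "(\<lambda>F. (F, - ratfun_deriv F)) \<in> ring_hom ratfun_alg (dual_numbers :: ('k poly fract \<times> 'k poly fract) ring)"
    using deriv_hom by simp_all
  \<comment> \<open>The derivative is K-linear, so constants may pass between the two
    factors.\<close>
  have bal: "(r \<odot>\<^bsub>ratfun_alg\<^esub> a, ratfun_deriv (r \<odot>\<^bsub>ratfun_alg\<^esub> a)) \<otimes>\<^bsub>dual_numbers\<^esub> (b, - ratfun_deriv b)
      = (a, ratfun_deriv a) \<otimes>\<^bsub>dual_numbers\<^esub> (r \<odot>\<^bsub>ratfun_alg\<^esub> b, - ratfun_deriv (r \<odot>\<^bsub>ratfun_alg\<^esub> b))"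
    for r :: 'k and a b
    by (simp add: ratfun_deriv_mult algebra_simps)
  note lift = S.tensor_lift[OF cring_dual_numbers f g bal, folded sq_to_dual_def sq_ring_def sq_tens_def]
  show "sq_to_dual \<in> ring_hom ratfun_sq (dual_numbers :: ('k poly fract \<times> 'k poly fract) ring)"
    by (rule lift(1))
  show "sq_to_dual (ratfun_sq_tens F G) = (F * G, ratfun_deriv F * G - F * ratfun_deriv G)"
    by (subst lift(2)) auto
qed

lemma Delta_sel [simp]:
  "monoid.mult ratfun_Delta = monoid.mult ratfun_sq"
  "add ratfun_Delta = add ratfun_sq"
  by (simp_all add: Delta_ring_def)

lemma Delta_subset: "x \<in> carrier ratfun_Delta \<Longrightarrow> x \<in> carrier ratfun_sq"
  unfolding Delta_ring_def
  by (simp, rule ring.generate_ring_in_carrier[OF ring_sq]) auto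

lemma Delta_square: "ratfun_sq_tens F F \<in> carrier ratfun_Delta"
  and Delta_const: "ratfun_sq_tens (ratfun_const c) 1 \<in> carrier ratfun_Delta"
  by (auto simp: Delta_ring_def intro: generate_ring.incl)

text \<open>Both sides are ring homomorphisms, so generators suffice: F'F - FF' is 0 on a diagonal
  element, and constants have derivative 0.\<close>

lemma sq_to_dual_Delta:
  fixes x :: "'k::field poly fract sq"
  assumes "x \<in> carrier ratfun_Delta"
  shows "sq_to_dual x = (ratfun_sq_mult x, 0)"
proof -
  have dh: "(\<lambda>x. (ratfun_sq_mult x, 0)) \<in> ring_hom ratfun_sq (dual_numbers :: ('k poly fract \<times> 'k poly fract) ring)"
    using ring_hom_trans[OF sq_mult_hom dual_embed_hom] by (simp add: comp_def)
  have gen: "(\<lambda>r. ratfun_sq_tens (ratfun_const r) \<one>\<^bsub>ratfun_ring\<^esub>) ` carrier scalar_ring \<union>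
      (\<lambda>a. ratfun_sq_tens a a) ` carrier (ratfun_ring :: 'k poly fract ring) \<subseteq> carrier ratfun_sq"
    by auto
  have cl: "y \<in> carrier ratfun_sq" if "y \<in> generate_ring ratfun_sq
      ((\<lambda>r. ratfun_sq_tens (ratfun_const r) \<one>\<^bsub>ratfun_ring\<^esub>) ` carrier scalar_ring \<union>
       (\<lambda>a. ratfun_sq_tens a a) ` carrier (ratfun_ring :: 'k poly fract ring))" for y
    using ring.generate_ring_in_carrier[OF ring_sq gen that] .
  have "x \<in> generate_ring ratfun_sq
      ((\<lambda>r. ratfun_sq_tens (ratfun_const r) \<one>\<^bsub>ratfun_ring\<^esub>) ` carrier scalar_ring \<union>
       (\<lambda>a. ratfun_sq_tens a a) ` carrier ratfun_ring)"
    using assms by (simp add: Delta_ring_def)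
  then show ?thesis
  proof (induction x rule: generate_ring.induct)
    case one
    then show ?case
      using ring_hom_one[OF sq_to_dual_hom[where 'k='k]] ring_hom_one[OF dh] by simp
  next
    case (incl y)
    then show ?case
      by (auto simp: sq_to_dual_tens sq_mult_tens)
  next
    case (a_inv y)
    then show ?case
      using ring_hom_a_inv[OF sq_to_dual_hom[where 'k='k] ring_sq ring_dual_numbers, of y]
        ring_hom_a_inv[OF dh ring_sq ring_dual_numbers, of y] cl[of y]
      by simp
  next
    case (eng_add y z)
    then show ?case
      using ring_hom_add[OF sq_to_dual_hom[where 'k='k], of y z] ring_hom_add[OF dh, of y z] cl[of y] cl[of z] by simp
  next
    case (eng_mult y z)
    then show ?case
      using ring_hom_mult[OF sq_to_dual_hom[where 'k='k], of y z] ring_hom_mult[OF dh, of y z] cl[of y] cl[of z] by simp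
  qed
qed

section \<open>The algebra Q and its map to the dual numbers\<close>

interpretation Q: tensor_algebra "ratfun_Delta :: 'k::field poly fract sq ring" "alg_along ratfun_sq id" "alg_along ratfun_ring ratfun_sq_mult"
proof (rule tensor_algebra.intro)
  show "r \<odot>\<^bsub>alg_along ratfun_sq id\<^esub> a \<in> carrier (alg_along ratfun_sq id)"
    if "r \<in> carrier ratfun_Delta" "a \<in> carrier (alg_along ratfun_sq id)" for r a :: "'k poly fract sq"
    using that Delta_subset[OF that(1)] cring.axioms(2)[OF cring_sq] ring_sq
    by (auto intro!: monoid.m_closed ring.is_monoid)
qed (auto intro: cring_sq)

lemma cring_Q: "cring (ratfun_Q :: 'k::field poly fract qalg ring)"
  unfolding Q_ring_def by (rule Q.cring_T)

lemma ring_Q: "ring (ratfun_Q :: 'k::field poly fract qalg ring)"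
  using cring_Q by (rule cring.axioms)

lemma Q_tens_closed [simp]: "ratfun_Q_tens F G H \<in> carrier ratfun_Q"
  unfolding Q_tens_def Q_ring_def by (rule Q.tens_closed) auto

lemma Q_tens_mult:
  "ratfun_Q_tens F G H \<otimes>\<^bsub>ratfun_Q\<^esub> ratfun_Q_tens F' G' H' = ratfun_Q_tens (F * F') (G * G') (H * H')"
  unfolding Q_tens_def Q_ring_def by (subst Q.tens_mult) (auto simp: sq_tens_mult)

lemma Q_tens_one: "ratfun_Q_tens 1 1 1 = \<one>\<^bsub>ratfun_Q\<^esub>"
  unfolding Q_tens_def Q_ring_def using Q.tens_one by (simp add: sq_tens_one)

lemma Q_tens_hom:
  "(\<lambda>F. ratfun_Q_tens F 1 1) \<in> ring_hom ratfun_ring (ratfun_Q :: 'k::field poly fract qalg ring)"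
  "(\<lambda>F. ratfun_Q_tens 1 F 1) \<in> ring_hom ratfun_ring (ratfun_Q :: 'k::field poly fract qalg ring)"
  "(\<lambda>F. ratfun_Q_tens 1 1 F) \<in> ring_hom ratfun_ring (ratfun_Q :: 'k::field poly fract qalg ring)"
proof -
  have l: "(\<lambda>a. tens ratfun_Delta (alg_along ratfun_sq id) (alg_along ratfun_ring ratfun_sq_mult) a 1)
      \<in> ring_hom ratfun_sq (ratfun_Q :: 'k poly fract qalg ring)"
    using Q.tens_hom_left unfolding Q_ring_def by simp
  show "(\<lambda>F. ratfun_Q_tens F 1 1) \<in> ring_hom ratfun_ring (ratfun_Q :: 'k::field poly fract qalg ring)"
    "(\<lambda>F. ratfun_Q_tens 1 F 1) \<in> ring_hom ratfun_ring (ratfun_Q :: 'k::field poly fract qalg ring)"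
    using ring_hom_trans[OF sq_tens_hom(1) l] ring_hom_trans[OF sq_tens_hom(2) l]
    by (simp_all add: comp_def Q_tens_def)
  show "(\<lambda>F. ratfun_Q_tens 1 1 F) \<in> ring_hom ratfun_ring (ratfun_Q :: 'k::field poly fract qalg ring)"
    using Q.tens_hom_right unfolding Q_ring_def Q_tens_def by (simp add: sq_tens_one)
qed

text \<open>A pure tensor in the diagonal subring passes to the last factor, on which it acts
  through the product of its entries.\<close>

lemma Q_tens_Delta:
  assumes "ratfun_sq_tens F G \<in> carrier ratfun_Delta"
  shows "ratfun_Q_tens F G 1 = ratfun_Q_tens 1 1 (F * G)"
  unfolding Q_tens_def
  using Q.tens_smult[OF assms, of "ratfun_sq_tens 1 1" 1]
  by (simp add: sq_tens_mult sq_mult_tens)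

lemma Q_tens_square: "ratfun_Q_tens F F 1 = ratfun_Q_tens 1 1 (F * F)"
  by (rule Q_tens_Delta[OF Delta_square])

text \<open>A constant is the same in all three places: it passes to the last one as a member of the
  diagonal subring, and the tensor square over K identifies the first two.\<close>

lemma Q_tens_const:
  "ratfun_Q_tens (ratfun_const c) 1 1 = ratfun_Q_tens 1 1 (ratfun_const c)"
  "ratfun_Q_tens 1 (ratfun_const c) 1 = ratfun_Q_tens 1 1 (ratfun_const c)"
proof -
  show "ratfun_Q_tens (ratfun_const c) 1 1 = ratfun_Q_tens 1 1 (ratfun_const c)"
    using Q_tens_Delta[OF Delta_const, of c] by simp
  have "ratfun_sq_tens (ratfun_const c) 1 = ratfun_sq_tens 1 (ratfun_const c)"
    unfolding sq_tens_def using S.tens_smult[of c 1 1] by simp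
  then show "ratfun_Q_tens 1 (ratfun_const c) 1 = ratfun_Q_tens 1 1 (ratfun_const c)"
    using Q_tens_Delta[of 1 "ratfun_const c"] Delta_const[of c] by simp
qed

text \<open>The three copies of K(T) generate Q, and each is determined by K and T. Constants are
  compared in one place only, as they agree in all three.\<close>

lemma Q_hom_eqI:
  fixes h h' :: "'k::field poly fract qalg \<Rightarrow> 'c"
  assumes h: "h \<in> ring_hom ratfun_Q C" and h': "h' \<in> ring_hom ratfun_Q C" and C: "cring C"
    and const: "\<And>c. h (ratfun_Q_tens (ratfun_const c) 1 1) = h' (ratfun_Q_tens (ratfun_const c) 1 1)"
    and vars: "h (ratfun_Q_tens ratfun_var 1 1) = h' (ratfun_Q_tens ratfun_var 1 1)"
      "h (ratfun_Q_tens 1 ratfun_var 1) = h' (ratfun_Q_tens 1 ratfun_var 1)"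
      "h (ratfun_Q_tens 1 1 ratfun_var) = h' (ratfun_Q_tens 1 1 ratfun_var)"
    and x: "x \<in> carrier ratfun_Q"
  shows "h x = h' x"
proof -
  have C': "ring C"
    using C by (rule cring.axioms)
  have 1: "h (ratfun_Q_tens F 1 1) = h' (ratfun_Q_tens F 1 1)" for F
    using ratfun_hom_eq[OF ring_hom_trans[OF Q_tens_hom(1) h] ring_hom_trans[OF Q_tens_hom(1) h'] C]
      const vars(1) by (simp add: fun_eq_iff)
  have 2: "h (ratfun_Q_tens 1 F 1) = h' (ratfun_Q_tens 1 F 1)" for F
    using ratfun_hom_eq[OF ring_hom_trans[OF Q_tens_hom(2) h] ring_hom_trans[OF Q_tens_hom(2) h'] C]
      const vars(2) by (simp add: fun_eq_iff Q_tens_const)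
  have 3: "h (ratfun_Q_tens 1 1 F) = h' (ratfun_Q_tens 1 1 F)" for F
    using ratfun_hom_eq[OF ring_hom_trans[OF Q_tens_hom(3) h] ring_hom_trans[OF Q_tens_hom(3) h'] C]
      const vars(3) by (simp add: fun_eq_iff Q_tens_const)
  let ?t = "tens ratfun_Delta (alg_along ratfun_sq id) (alg_along ratfun_ring ratfun_sq_mult)"
  have l: "(\<lambda>a. ?t a 1) \<in> ring_hom ratfun_sq (ratfun_Q :: 'k poly fract qalg ring)"
    using Q.tens_hom_left unfolding Q_ring_def by simp
  have 4: "h (?t a 1) = h' (?t a 1)" if "a \<in> carrier ratfun_sq" for a
    using sq_hom_eqI[OF ring_hom_trans[OF l h] ring_hom_trans[OF l h'] C' _ _ that] 1 2
    by (simp add: Q_tens_def)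
  show ?thesis
    using Q.tensor_hom_eqI'[OF h[unfolded Q_ring_def] h'[unfolded Q_ring_def] C' _ _ x[unfolded Q_ring_def]] 4 3
    by (simp add: Q_tens_def sq_tens_one)
qed

definition Q_to_dual :: "'k::field poly fract qalg \<Rightarrow> 'k poly fract \<times> 'k poly fract" where
  "Q_to_dual = tensor_lift (ratfun_Delta :: 'k poly fract sq ring) (alg_along ratfun_sq id)
     (alg_along ratfun_ring ratfun_sq_mult) dual_numbers sq_to_dual (\<lambda>F. (F, 0))"

lemma
  fixes F G H :: "'k::field poly fract"
  shows Q_to_dual_hom: "Q_to_dual \<in> ring_hom ratfun_Q (dual_numbers :: ('k poly fract \<times> 'k poly fract) ring)"
    and Q_to_dual_tens: "Q_to_dual (ratfun_Q_tens F G H) = (F * G * H, (ratfun_deriv F * G - F * ratfun_deriv G) * H)"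
proof -
  interpret D: cring "dual_numbers :: ('k poly fract \<times> 'k poly fract) ring"
    by (rule cring_dual_numbers)
  have f: "sq_to_dual \<in> ring_hom (alg_along ratfun_sq id) (dual_numbers :: ('k poly fract \<times> 'k poly fract) ring)"
    and g: "(\<lambda>F. (F, 0)) \<in> ring_hom (alg_along ratfun_ring ratfun_sq_mult) (dual_numbers :: ('k poly fract \<times> 'k poly fract) ring)"
    using sq_to_dual_hom dual_embed_hom by simp_all
  \<comment> \<open>A scalar from the diagonal subring has no e-part, so on both sides it acts as
    multiplication by \<open>ratfun_sq_mult r\<close>.\<close>
  have bal: "sq_to_dual (r \<odot>\<^bsub>alg_along ratfun_sq id\<^esub> a) \<otimes>\<^bsub>dual_numbers\<^esub> (b, 0)
      = sq_to_dual a \<otimes>\<^bsub>dual_numbers\<^esub> (r \<odot>\<^bsub>alg_along ratfun_ring ratfun_sq_mult\<^esub> b, 0)"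
    if "r \<in> carrier ratfun_Delta" "a \<in> carrier (alg_along ratfun_sq id)" for r a :: "'k poly fract sq" and b
  proof -
    have "sq_to_dual (r \<otimes>\<^bsub>ratfun_sq\<^esub> a) = (ratfun_sq_mult r, 0) \<otimes>\<^bsub>dual_numbers\<^esub> sq_to_dual a"
      using that ring_hom_mult[OF sq_to_dual_hom Delta_subset[OF that(1)], of a] sq_to_dual_Delta[OF that(1)] by simp
    then show ?thesis
      by (cases "sq_to_dual a") (simp add: algebra_simps)
  qed
  note lift = Q.tensor_lift[OF cring_dual_numbers f g bal, folded Q_to_dual_def Q_ring_def]
  show "Q_to_dual \<in> ring_hom ratfun_Q (dual_numbers :: ('k poly fract \<times> 'k poly fract) ring)"
    by (rule lift(1))
  show "Q_to_dual (ratfun_Q_tens F G H) = (F * G * H, (ratfun_deriv F * G - F * ratfun_deriv G) * H)"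
    unfolding Q_tens_def by (subst lift(2)) (auto simp: sq_to_dual_tens)
qed

text \<open>Setting e to 0 and the augmentation agree on generators. Hence W corresponds to the
  multiples of e.\<close>

lemma Q_aug_eq:
  fixes x :: "'k::field poly fract qalg"
  assumes "x \<in> carrier ratfun_Q"
  shows "Q_aug scalar_ring ratfun_ring ratfun_const x = fst (Q_to_dual x)"
proof -
  let ?a = "Q_aug (scalar_ring :: 'k ring) ratfun_ring ratfun_const"
  have c: "cring (ratfun_ring :: 'k poly fract ring)" ..
  have r: "ring (ratfun_ring :: 'k poly fract ring)" ..
  have f: "ratfun_sq_mult \<in> ring_hom (alg_along ratfun_sq id) (ratfun_ring :: 'k poly fract ring)"
    and g: "id \<in> ring_hom (alg_along ratfun_ring ratfun_sq_mult) (ratfun_ring :: 'k poly fract ring)"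
    using sq_mult_hom by (simp_all add: id_ring_hom)
  have bal: "ratfun_sq_mult (r \<odot>\<^bsub>alg_along ratfun_sq id\<^esub> a) \<otimes>\<^bsub>ratfun_ring\<^esub> id b
      = ratfun_sq_mult a \<otimes>\<^bsub>ratfun_ring\<^esub> id (r \<odot>\<^bsub>alg_along ratfun_ring ratfun_sq_mult\<^esub> b)"
    if "r \<in> carrier ratfun_Delta" "a \<in> carrier (alg_along ratfun_sq id)" for r a :: "'k poly fract sq" and b
    using that ring_hom_mult[OF sq_mult_hom Delta_subset[OF that(1)], of a] by simp
  note lift = Q.tensor_lift[OF c f g bal, folded Q_aug_def Q_ring_def]
  have t: "?a (ratfun_Q_tens F G H) = F * G * H" for F G H
    unfolding Q_tens_def by (subst lift(2)) (auto simp: sq_mult_tens)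
  have "?a x = (fst \<circ> Q_to_dual) x"
    by (rule Q_hom_eqI[OF lift(1) ring_hom_trans[OF Q_to_dual_hom fst_hom] c _ _ _ _ assms])
      (simp_all add: t Q_to_dual_tens)
  then show ?thesis
    by simp
qed

section \<open>The square-zero element of Q and the inverse map\<close>

abbreviation Q_eps :: "'k::field poly fract qalg" where
  "Q_eps \<equiv> ratfun_Q_tens ratfun_var 1 1 \<ominus>\<^bsub>ratfun_Q\<^esub> ratfun_Q_tens 1 1 ratfun_var"

text \<open>The relations coming from \<open>T \<otimes> T\<close> and \<open>(T + 1) \<otimes> (T + 1)\<close> in the diagonal subring.\<close>

lemma Q_var_relations:
  fixes x y t :: "'k::field poly fract qalg"
  defines "x \<equiv> ratfun_Q_tens ratfun_var 1 1" and "y \<equiv> ratfun_Q_tens 1 ratfun_var 1"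
    and "t \<equiv> ratfun_Q_tens 1 1 ratfun_var"
  shows "x \<otimes>\<^bsub>ratfun_Q\<^esub> y = t \<otimes>\<^bsub>ratfun_Q\<^esub> t" "x \<oplus>\<^bsub>ratfun_Q\<^esub> y = t \<oplus>\<^bsub>ratfun_Q\<^esub> t"
proof -
  interpret Qc: cring "ratfun_Q :: 'k poly fract qalg ring"
    by (rule cring_Q)
  let ?o = "\<one>\<^bsub>ratfun_Q\<^esub> :: 'k poly fract qalg"
  have mem: "x \<in> carrier ratfun_Q" "y \<in> carrier ratfun_Q" "t \<in> carrier ratfun_Q"
    by (simp_all add: x_def y_def t_def)
  show xy: "x \<otimes>\<^bsub>ratfun_Q\<^esub> y = t \<otimes>\<^bsub>ratfun_Q\<^esub> t"
    using Q_tens_square[of "ratfun_var :: 'k poly fract"] by (simp add: x_def y_def t_def Q_tens_mult)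
  have "ratfun_Q_tens (ratfun_var + 1) 1 1 = x \<oplus>\<^bsub>ratfun_Q\<^esub> ?o" "ratfun_Q_tens 1 (ratfun_var + 1) 1 = y \<oplus>\<^bsub>ratfun_Q\<^esub> ?o"
    "ratfun_Q_tens 1 1 (ratfun_var + 1) = t \<oplus>\<^bsub>ratfun_Q\<^esub> ?o"
    using Q_tens_hom[where 'k='k] unfolding mem_ring_hom_of_type_iff x_def y_def t_def by metis+
  then have "(x \<oplus>\<^bsub>ratfun_Q\<^esub> ?o) \<otimes>\<^bsub>ratfun_Q\<^esub> (y \<oplus>\<^bsub>ratfun_Q\<^esub> ?o) = (t \<oplus>\<^bsub>ratfun_Q\<^esub> ?o) \<otimes>\<^bsub>ratfun_Q\<^esub> (t \<oplus>\<^bsub>ratfun_Q\<^esub> ?o)"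
    using Q_tens_square[of "ratfun_var + 1 :: 'k poly fract"]
      Q_tens_mult[of "ratfun_var + 1 :: 'k poly fract" 1 1 1 "ratfun_var + 1" 1]
      Q_tens_mult[of 1 1 "ratfun_var + 1 :: 'k poly fract" 1 1 "ratfun_var + 1"]
    by simp
  \<comment> \<open>Grouped so that, the products being equal already, one left cancellation yields
    the relation between the sums.\<close>
  moreover have "(a \<oplus>\<^bsub>ratfun_Q\<^esub> ?o) \<otimes>\<^bsub>ratfun_Q\<^esub> (b \<oplus>\<^bsub>ratfun_Q\<^esub> ?o) = a \<otimes>\<^bsub>ratfun_Q\<^esub> b \<oplus>\<^bsub>ratfun_Q\<^esub> ?o \<oplus>\<^bsub>ratfun_Q\<^esub> (a \<oplus>\<^bsub>ratfun_Q\<^esub> b)"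
    if "a \<in> carrier ratfun_Q" "b \<in> carrier ratfun_Q" for a b
    using that by algebra
  ultimately have "t \<otimes>\<^bsub>ratfun_Q\<^esub> t \<oplus>\<^bsub>ratfun_Q\<^esub> ?o \<oplus>\<^bsub>ratfun_Q\<^esub> (x \<oplus>\<^bsub>ratfun_Q\<^esub> y) = t \<otimes>\<^bsub>ratfun_Q\<^esub> t \<oplus>\<^bsub>ratfun_Q\<^esub> ?o \<oplus>\<^bsub>ratfun_Q\<^esub> (t \<oplus>\<^bsub>ratfun_Q\<^esub> t)"
    using mem xy by simp
  then show "x \<oplus>\<^bsub>ratfun_Q\<^esub> y = t \<oplus>\<^bsub>ratfun_Q\<^esub> t"
    using mem Qc.add.l_cancel[of "t \<otimes>\<^bsub>ratfun_Q\<^esub> t \<oplus>\<^bsub>ratfun_Q\<^esub> ?o" "x \<oplus>\<^bsub>ratfun_Q\<^esub> y" "t \<oplus>\<^bsub>ratfun_Q\<^esub> t"] by simp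
qed

lemma Q_eps_square: "Q_eps \<otimes>\<^bsub>ratfun_Q\<^esub> Q_eps = (\<zero>\<^bsub>ratfun_Q\<^esub> :: 'k::field poly fract qalg)"
proof -
  interpret Qc: cring "ratfun_Q :: 'k poly fract qalg ring"
    by (rule cring_Q)
  let ?x = "ratfun_Q_tens ratfun_var 1 1 :: 'k poly fract qalg" and ?y = "ratfun_Q_tens 1 ratfun_var 1 :: 'k poly fract qalg"
    and ?t = "ratfun_Q_tens 1 1 ratfun_var :: 'k poly fract qalg"
  have mem: "?x \<in> carrier ratfun_Q" "?y \<in> carrier ratfun_Q" "?t \<in> carrier ratfun_Q"
    by simp_all
  \<comment> \<open>Arranged so that t occurs only in t + t and in t times t, the two expressions
    that the relations replace.\<close>
  have "Q_eps \<otimes>\<^bsub>ratfun_Q\<^esub> Q_eps = ?x \<otimes>\<^bsub>ratfun_Q\<^esub> ?x \<ominus>\<^bsub>ratfun_Q\<^esub> ?x \<otimes>\<^bsub>ratfun_Q\<^esub> (?t \<oplus>\<^bsub>ratfun_Q\<^esub> ?t) \<oplus>\<^bsub>ratfun_Q\<^esub> ?t \<otimes>\<^bsub>ratfun_Q\<^esub> ?t"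
    using mem by algebra
  also have "\<dots> = ?x \<otimes>\<^bsub>ratfun_Q\<^esub> ?x \<ominus>\<^bsub>ratfun_Q\<^esub> ?x \<otimes>\<^bsub>ratfun_Q\<^esub> (?x \<oplus>\<^bsub>ratfun_Q\<^esub> ?y) \<oplus>\<^bsub>ratfun_Q\<^esub> ?x \<otimes>\<^bsub>ratfun_Q\<^esub> ?y"
    by (simp only: Q_var_relations)
  also have "\<dots> = \<zero>\<^bsub>ratfun_Q\<^esub>"
    using mem by algebra
  finally show ?thesis .
qed

definition Q_of_dual :: "'k::field poly fract \<times> 'k poly fract \<Rightarrow> 'k poly fract qalg" where
  "Q_of_dual = (\<lambda>(F, G). ratfun_Q_tens 1 1 F \<oplus>\<^bsub>ratfun_Q\<^esub> ratfun_Q_tens 1 1 G \<otimes>\<^bsub>ratfun_Q\<^esub> Q_eps)"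

lemma Q_eps_closed [simp]: "Q_eps \<in> carrier ratfun_Q"
  using ring_Q by (intro abelian_group.minus_closed) (auto intro: ring.is_abelian_group)

lemma Q_of_dual_hom: "Q_of_dual \<in> ring_hom dual_numbers (ratfun_Q :: 'k::field poly fract qalg ring)"
  unfolding Q_of_dual_def by (rule ring_hom_dual_lift[OF cring_Q Q_tens_hom(3) Q_eps_closed Q_eps_square])

lemma Q_of_dual_closed [simp]: "Q_of_dual x \<in> carrier ratfun_Q"
  using ring_hom_closed[OF Q_of_dual_hom] by simp

lemma Q_of_dual_const: "Q_of_dual (F, 0) = ratfun_Q_tens 1 1 (F :: 'k::field poly fract)"
proof -
  interpret Qc: cring "ratfun_Q :: 'k poly fract qalg ring"
    by (rule cring_Q)
  have "ratfun_Q_tens 1 1 (0 :: 'k poly fract) = \<zero>\<^bsub>ratfun_Q\<^esub>"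
    using ring_hom_zero[OF Q_tens_hom(3)[where 'k='k] _ Qc.ring_axioms] ring_from_type_algebra by force
  then show ?thesis
    by (simp add: Q_of_dual_def)
qed

text \<open>The second equation has the content: t - e is 2 t - x, which x + y = 2 t turns into
  y.\<close>

lemma Q_of_dual_var:
  fixes T :: "'k::field poly fract"
  defines "T \<equiv> ratfun_var"
  shows "Q_of_dual (T, 1) = ratfun_Q_tens T 1 1" "Q_of_dual (T, -1) = ratfun_Q_tens 1 T 1"
    "Q_of_dual (0, 1) = (Q_eps :: 'k poly fract qalg)"
proof -
  interpret Qc: cring "ratfun_Q :: 'k poly fract qalg ring"
    by (rule cring_Q)
  let ?x = "ratfun_Q_tens T 1 1" and ?y = "ratfun_Q_tens 1 T 1" and ?t = "ratfun_Q_tens 1 1 T"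
  have eps: "Q_eps = ?x \<ominus>\<^bsub>ratfun_Q\<^esub> ?t"
    by (simp add: T_def)
  have z: "ratfun_Q_tens 1 1 (0 :: 'k poly fract) = \<zero>\<^bsub>ratfun_Q\<^esub>"
    using ring_hom_zero[OF Q_tens_hom(3)[where 'k='k] _ Qc.ring_axioms] ring_from_type_algebra by force
  have "ratfun_Q_tens 1 1 (1 + -1 :: 'k poly fract) = ratfun_Q_tens 1 1 1 \<oplus>\<^bsub>ratfun_Q\<^esub> ratfun_Q_tens 1 1 (-1)"
    using Q_tens_hom(3)[where 'k='k] unfolding mem_ring_hom_of_type_iff by metis
  then have m: "ratfun_Q_tens 1 1 (-1 :: 'k poly fract) = \<ominus>\<^bsub>ratfun_Q\<^esub> \<one>\<^bsub>ratfun_Q\<^esub>"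
    by (metis Q_tens_closed Q_tens_one z Qc.minus_equality Qc.a_comm add.right_inverse)
  have mem: "?x \<in> carrier ratfun_Q" "?y \<in> carrier ratfun_Q" "?t \<in> carrier ratfun_Q"
    by simp_all
  have "Q_of_dual (T, 1) = ?t \<oplus>\<^bsub>ratfun_Q\<^esub> (?x \<ominus>\<^bsub>ratfun_Q\<^esub> ?t)"
    unfolding Q_of_dual_def eps using mem by (simp add: Q_tens_one)
  also have "\<dots> = ?x"
    using mem by algebra
  finally show "Q_of_dual (T, 1) = ?x" .
  show "Q_of_dual (0, 1) = (Q_eps :: 'k poly fract qalg)"
    unfolding Q_of_dual_def by (simp add: z Q_tens_one)
  have "Q_of_dual (T, -1) = ?t \<oplus>\<^bsub>ratfun_Q\<^esub> \<ominus>\<^bsub>ratfun_Q\<^esub> (?x \<ominus>\<^bsub>ratfun_Q\<^esub> ?t)"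
    unfolding Q_of_dual_def eps using mem by (simp add: m Qc.l_minus)
  also have "\<dots> = (?t \<oplus>\<^bsub>ratfun_Q\<^esub> ?t) \<ominus>\<^bsub>ratfun_Q\<^esub> ?x"
    using mem by algebra
  also have "\<dots> = (?x \<oplus>\<^bsub>ratfun_Q\<^esub> ?y) \<ominus>\<^bsub>ratfun_Q\<^esub> ?x"
    by (simp only: T_def Q_var_relations)
  also have "\<dots> = ?y"
    using mem by algebra
  finally show "Q_of_dual (T, -1) = ?y" .
qed

lemma Q_of_to_dual:
  fixes x :: "'k::field poly fract qalg"
  assumes "x \<in> carrier ratfun_Q"
  shows "Q_of_dual (Q_to_dual x) = x"
proof -
  have "(Q_of_dual \<circ> Q_to_dual) x = id x"
    by (rule Q_hom_eqI[OF ring_hom_trans[OF Q_to_dual_hom Q_of_dual_hom] id_ring_hom cring_Q _ _ _ _ assms])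
      (simp_all add: Q_to_dual_tens Q_of_dual_const Q_of_dual_var Q_tens_const)
  then show ?thesis
    by simp
qed

text \<open>Rests on the value (0, 1) of \<open>Q_to_dual\<close> at \<open>Q_eps\<close>, which
  holds because T has derivative 1.\<close>

lemma Q_to_of_dual [simp]: "Q_to_dual (Q_of_dual x) = x"
proof -
  obtain F G where x: "x = (F, G)"
    by (cases x)
  interpret D: ring "dual_numbers :: ('a poly fract \<times> 'a poly fract) ring"
    by (rule ring_dual_numbers)
  interpret Qc: cring "ratfun_Q :: 'a poly fract qalg ring"
    by (rule cring_Q)
  have "(ratfun_var, 1) = (0, 1) \<oplus>\<^bsub>dual_numbers\<^esub> (ratfun_var :: 'a poly fract, 0)"
    by simp
  then have "(ratfun_var, 1) \<ominus>\<^bsub>dual_numbers\<^esub> (ratfun_var :: 'a poly fract, 0) = (0, 1)"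
    by (metis D.add.inv_solve_right D.minus_eq UNIV_I dual_numbers_sel(1))
  then have "Q_to_dual Q_eps = (0, 1 :: 'a poly fract)"
    using ring_hom_minus[OF Q_to_dual_hom ring_Q ring_dual_numbers,
        of "ratfun_Q_tens ratfun_var 1 1 :: 'a poly fract qalg" "ratfun_Q_tens 1 1 ratfun_var"]
    by (simp add: Q_to_dual_tens)
  then have "Q_to_dual (ratfun_Q_tens 1 1 G \<otimes>\<^bsub>ratfun_Q\<^esub> Q_eps) = (0, G)"
    by (subst ring_hom_mult[OF Q_to_dual_hom]) (simp_all add: Q_to_dual_tens)
  then show ?thesis
    unfolding x Q_of_dual_def
    by (simp, subst ring_hom_add[OF Q_to_dual_hom]) (simp_all add: Q_to_dual_tens)
qed

section \<open>The augmentation kernel\<close>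

lemma W_mod_iso:
  "\<exists>h. h \<in> mod_isos ratfun_ring (W_mod (scalar_ring :: 'k::field ring) ratfun_ring ratfun_const) ratfun_line"
proof -
  let ?W = "W_mod (scalar_ring :: 'k ring) ratfun_ring ratfun_const"
  \<comment> \<open>Only the coefficient of e is left on the kernel. Scalars multiply it, since
    \<open>ratfun_Q_tens 1 1 a\<close> goes to \<open>(a, 0)\<close>.\<close>
  define h where "h = (\<lambda>x\<in>carrier ?W. snd (Q_to_dual x))"
  have W: "carrier ?W = {x \<in> carrier ratfun_Q. fst (Q_to_dual x) = 0}"
    by (auto simp: W_mod_def ker_mod_def Q_alg_def a_kernel_def' Q_aug_eq)
  have add: "x \<oplus>\<^bsub>?W\<^esub> y = x \<oplus>\<^bsub>ratfun_Q\<^esub> y" and smult: "a \<odot>\<^bsub>?W\<^esub> x = ratfun_Q_tens 1 1 a \<otimes>\<^bsub>ratfun_Q\<^esub> x" for x y a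
    by (simp_all add: W_mod_def ker_mod_def Q_alg_def)
  interpret Qc: cring "ratfun_Q :: 'k poly fract qalg ring"
    by (rule cring_Q)
  have d_add: "Q_to_dual (x \<oplus>\<^bsub>?W\<^esub> y) = (0, h x + h y) \<and> x \<oplus>\<^bsub>?W\<^esub> y \<in> carrier ratfun_Q"
    if "x \<in> carrier ?W" "y \<in> carrier ?W" for x y
    using that by (cases "Q_to_dual x"; cases "Q_to_dual y")
      (simp add: W add h_def ring_hom_add[OF Q_to_dual_hom])
  have d_smult: "Q_to_dual (a \<odot>\<^bsub>?W\<^esub> x) = (0, a * h x) \<and> a \<odot>\<^bsub>?W\<^esub> x \<in> carrier ratfun_Q"
    if "x \<in> carrier ?W" for a x
    using that by (cases "Q_to_dual x") (simp add: W smult h_def ring_hom_mult[OF Q_to_dual_hom] Q_to_dual_tens)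
  have "h \<in> mod_homs ratfun_ring ?W ratfun_line"
    unfolding mod_homs_def
  proof (intro CollectI conjI ballI)
    show "h \<in> carrier ?W \<rightarrow>\<^sub>E carrier ratfun_line"
      by (auto simp: h_def)
    show "h (x \<oplus>\<^bsub>?W\<^esub> y) = h x \<oplus>\<^bsub>ratfun_line\<^esub> h y" if "x \<in> carrier ?W" "y \<in> carrier ?W" for x y
      using d_add[OF that] by (simp add: h_def[THEN fun_cong, of "x \<oplus>\<^bsub>?W\<^esub> y"] W)
    show "h (a \<odot>\<^bsub>?W\<^esub> x) = a \<odot>\<^bsub>ratfun_line\<^esub> h x" if "x \<in> carrier ?W" for a x
      using d_smult[OF that, of a] by (simp add: h_def[THEN fun_cong, of "a \<odot>\<^bsub>?W\<^esub> x"] W)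
  qed
  moreover have "bij_betw h (carrier ?W) (carrier ratfun_line)"
  proof (rule bij_betw_byWitness[where f' = "\<lambda>w. Q_of_dual (0, w)"])
    show "\<forall>x\<in>carrier ?W. Q_of_dual (0, h x) = x"
    proof
      fix x assume x: "x \<in> carrier ?W"
      then have "(0, h x) = Q_to_dual x"
        by (cases "Q_to_dual x") (simp add: h_def W)
      then show "Q_of_dual (0, h x) = x"
        using x by (simp add: Q_of_to_dual W)
    qed
  qed (auto simp: h_def W)
  ultimately show ?thesis
    by (auto simp: mod_isos_def)
qed

section \<open>The isomorphisms\<close>

lemma dual_numbers_minus [simp]:
  "(a, b) \<ominus>\<^bsub>dual_numbers\<^esub> (c, d) = (a - c, b - d :: 'k::field poly fract)"
proof -
  interpret D: ring "dual_numbers :: ('k poly fract \<times> 'k poly fract) ring"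
    by (rule ring_dual_numbers)
  have "(a, b) = (a - c, b - d) \<oplus>\<^bsub>dual_numbers\<^esub> (c, d)"
    by simp
  then show ?thesis
    by (metis D.add.inv_solve_right D.minus_eq UNIV_I dual_numbers_sel(1))
qed

text \<open>Moves the operations of the tensor product onto explicit pairs, so that later
  calculations take place in \<open>dual_numbers\<close>.\<close>

lemma of_dual_eqs:
  "dual_tens F \<one>\<^bsub>dual_alg\<^esub> = of_dual (F, 0 :: 'k::field poly fract)"
  "dual_tens 1 dual_var = of_dual (0, 1 :: 'k poly fract)"
  "\<one>\<^bsub>ratfun_dual\<^esub> = of_dual (1, 0 :: 'k poly fract)"
  "of_dual x \<oplus>\<^bsub>ratfun_dual\<^esub> of_dual y = of_dual (x \<oplus>\<^bsub>dual_numbers\<^esub> (y :: 'k poly fract \<times> 'k poly fract))"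
  "of_dual x \<ominus>\<^bsub>ratfun_dual\<^esub> of_dual y = of_dual (x \<ominus>\<^bsub>dual_numbers\<^esub> (y :: 'k poly fract \<times> 'k poly fract))"
  "of_dual x \<otimes>\<^bsub>ratfun_dual\<^esub> of_dual y = of_dual (x \<otimes>\<^bsub>dual_numbers\<^esub> (y :: 'k poly fract \<times> 'k poly fract))"
  by (simp_all add: dual_tens_eq_of_dual ring_hom_one[OF of_dual_hom, symmetric] ring_hom_add[OF of_dual_hom]
      ring_hom_mult[OF of_dual_hom] ring_hom_minus[OF of_dual_hom ring_dual_numbers B.T.ring_axioms])

lemma carrier_ratfun_dual: "carrier ratfun_dual = range of_dual"
proof (intro equalityI subsetI)
  show "x \<in> range of_dual" if "x \<in> carrier ratfun_dual" for x
    by (rule range_eqI, rule of_to_dual[OF that, symmetric])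
qed auto

text \<open>Every element is F + G S, so the values on K, T and S decide.\<close>

lemma ratfun_dual_hom_eqI:
  fixes h h' :: "('k::field poly fract \<times> 'k poly set \<Rightarrow>\<^sub>0 int) set \<Rightarrow> 'c"
  assumes h: "h \<in> ring_hom ratfun_dual C" and h': "h' \<in> ring_hom ratfun_dual C" and C: "cring C"
    and const: "\<And>c. h (of_dual (ratfun_const c, 0)) = h' (of_dual (ratfun_const c, 0))"
    and var: "h (of_dual (ratfun_var, 0)) = h' (of_dual (ratfun_var, 0))"
    and S: "h (of_dual (0, 1)) = h' (of_dual (0, 1))"
    and x: "x \<in> carrier ratfun_dual"
  shows "h x = h' x"
proof -
  have *: "h (of_dual (F, 0)) = h' (of_dual (F, 0))" for F
    using ratfun_hom_eq[OF ring_hom_trans[OF ring_hom_trans[OF dual_embed_hom of_dual_hom] h]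
        ring_hom_trans[OF ring_hom_trans[OF dual_embed_hom of_dual_hom] h'] C]
      const var by (simp add: fun_eq_iff)
  obtain F G where FG: "x = of_dual (F, G)"
    using x by (auto simp: carrier_ratfun_dual)
  have "x = of_dual (F, 0) \<oplus>\<^bsub>ratfun_dual\<^esub> of_dual (G, 0) \<otimes>\<^bsub>ratfun_dual\<^esub> of_dual (0, 1)"
    by (simp add: of_dual_eqs FG)
  then show ?thesis
    using * S by (simp add: ring_hom_add[OF h] ring_hom_mult[OF h] ring_hom_add[OF h'] ring_hom_mult[OF h'])
qed

section \<open>Algebra homomorphisms and the two inverse maps\<close>

text \<open>For a ring homomorphism, compatibility with scalars is its instance at 1, that is,
  agreement of the structure maps.\<close>

lemma mem_alg_homs_iff:
  assumes "ring A" "ring B" and \<phi>: "\<And>c. c \<in> carrier R \<Longrightarrow> \<phi> c \<in> carrier A"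
    and \<psi>: "\<And>c. c \<in> carrier R \<Longrightarrow> \<psi> c \<in> carrier B"
  shows "h \<in> alg_homs R (alg_along A \<phi>) (alg_along B \<psi>) \<longleftrightarrow>
    h \<in> ring_hom A B \<and> h \<in> extensional (carrier A) \<and> (\<forall>c\<in>carrier R. h (\<phi> c) = \<psi> c)"
proof -
  interpret A: ring A by fact
  interpret B: ring B by fact
  have "h (\<phi> c) = \<psi> c"
    if "h \<in> ring_hom A B" "\<forall>r\<in>carrier R. \<forall>x\<in>carrier A. h (\<phi> r \<otimes>\<^bsub>A\<^esub> x) = \<psi> r \<otimes>\<^bsub>B\<^esub> h x" "c \<in> carrier R" for c
    using that(2)[rule_format, OF that(3) A.one_closed] \<phi>[OF that(3)] \<psi>[OF that(3)] ring_hom_one[OF that(1)] by simp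
  then show ?thesis
    by (auto simp: alg_homs_def mod_homs_def PiE_iff ring_hom_mult ring_hom_add ring_hom_closed \<phi>)
qed

abbreviation Q_K :: "('k::field, 'k poly fract qalg) module" where
  "Q_K \<equiv> alg_along ratfun_Q (\<lambda>c. ratfun_Q_tens (ratfun_const c) 1 1)"

abbreviation B_K :: "('k::field, ('k poly fract \<times> 'k poly set \<Rightarrow>\<^sub>0 int) set) module" where
  "B_K \<equiv> alg_along ratfun_dual (\<lambda>c. dual_tens (ratfun_const c) \<one>\<^bsub>dual_alg\<^esub>)"

abbreviation B_A :: "('k::field poly fract, ('k poly fract \<times> 'k poly set \<Rightarrow>\<^sub>0 int) set) module" where
  "B_A \<equiv> alg_along ratfun_dual (\<lambda>F. dual_tens F \<one>\<^bsub>dual_alg\<^esub>)"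

lemma mem_alg_homs_Q_B:
  fixes h :: "'k::field poly fract qalg \<Rightarrow> ('k poly fract \<times> 'k poly set \<Rightarrow>\<^sub>0 int) set"
  shows "h \<in> alg_homs scalar_ring Q_K B_K \<longleftrightarrow> h \<in> ring_hom ratfun_Q ratfun_dual \<and>
    h \<in> extensional (carrier ratfun_Q) \<and> (\<forall>c. h (ratfun_Q_tens (ratfun_const c) 1 1) = of_dual (ratfun_const c, 0))"
  by (subst mem_alg_homs_iff[OF ring_Q B.T.ring_axioms]) (simp_all only: of_dual_eqs Q_tens_closed of_dual_closed, simp)

lemma mem_alg_homs_B_Q:
  fixes h :: "('k::field poly fract \<times> 'k poly set \<Rightarrow>\<^sub>0 int) set \<Rightarrow> 'k poly fract qalg"
  shows "h \<in> alg_homs scalar_ring B_K Q_K \<longleftrightarrow> h \<in> ring_hom ratfun_dual ratfun_Q \<and>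
    h \<in> extensional (carrier ratfun_dual) \<and> (\<forall>c. h (of_dual (ratfun_const c, 0)) = ratfun_Q_tens (ratfun_const c) 1 1)"
  by (subst mem_alg_homs_iff[OF B.T.ring_axioms ring_Q]) (simp_all only: of_dual_eqs Q_tens_closed of_dual_closed, simp)

lemma mem_alg_homs_ratfun_B:
  fixes h :: "'k::field poly fract \<Rightarrow> ('k poly fract \<times> 'k poly set \<Rightarrow>\<^sub>0 int) set"
  shows "h \<in> alg_homs scalar_ring ratfun_alg B_K \<longleftrightarrow> h \<in> ring_hom ratfun_ring ratfun_dual \<and>
    (\<forall>c. h (ratfun_const c) = of_dual (ratfun_const c, 0))"
  by (subst mem_alg_homs_iff[OF _ B.T.ring_axioms])
    (auto simp only: of_dual_eqs of_dual_closed ring_from_type_algebra, auto)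

text \<open>Both maps are composites through \<open>dual_numbers\<close>. A singleton states
  existence and uniqueness at once: the prescribed values single out one K-algebra
  homomorphism.\<close>

lemma Q_B_inverse_isos:
  fixes T :: "'k::field poly fract"
  defines "T \<equiv> ratfun_var"
  shows "\<exists>\<Phi> \<Psi>.
    {h \<in> alg_homs scalar_ring Q_K B_K.
       h (ratfun_Q_tens T 1 1) = dual_tens T \<one>\<^bsub>dual_alg\<^esub> \<oplus>\<^bsub>ratfun_dual\<^esub> dual_tens 1 dual_var \<and>
       h (ratfun_Q_tens 1 T 1) = dual_tens T \<one>\<^bsub>dual_alg\<^esub> \<ominus>\<^bsub>ratfun_dual\<^esub> dual_tens 1 dual_var \<and>
       h (ratfun_Q_tens 1 1 T) = dual_tens T \<one>\<^bsub>dual_alg\<^esub>} = {\<Phi>} \<and>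
    {h \<in> alg_homs scalar_ring B_K Q_K.
       h (dual_tens T \<one>\<^bsub>dual_alg\<^esub>) = ratfun_Q_tens 1 1 T \<and>
       h (dual_tens 1 dual_var) = ratfun_Q_tens T 1 1 \<ominus>\<^bsub>ratfun_Q\<^esub> ratfun_Q_tens 1 1 T} = {\<Psi>} \<and>
    \<Phi> \<in> ring_iso ratfun_Q ratfun_dual \<and> \<Psi> \<in> ring_iso ratfun_dual ratfun_Q \<and>
    (\<forall>x\<in>carrier ratfun_Q. \<Psi> (\<Phi> x) = x) \<and> (\<forall>y\<in>carrier ratfun_dual. \<Phi> (\<Psi> y) = y)"
proof -
  define \<Phi> :: "'k poly fract qalg \<Rightarrow> ('k poly fract \<times> 'k poly set \<Rightarrow>\<^sub>0 int) set"
    where "\<Phi> = restrict (of_dual \<circ> Q_to_dual) (carrier ratfun_Q)"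
  define \<Psi> :: "('k poly fract \<times> 'k poly set \<Rightarrow>\<^sub>0 int) set \<Rightarrow> 'k poly fract qalg"
    where "\<Psi> = restrict (Q_of_dual \<circ> to_dual) (carrier ratfun_dual)"
  have \<Phi>_hom: "\<Phi> \<in> ring_hom ratfun_Q ratfun_dual"
    unfolding \<Phi>_def by (rule restrict_ring_hom[OF ring_hom_trans[OF Q_to_dual_hom of_dual_hom] ring_Q])
  have \<Psi>_hom: "\<Psi> \<in> ring_hom ratfun_dual ratfun_Q"
    unfolding \<Psi>_def by (rule restrict_ring_hom[OF ring_hom_trans[OF to_dual_hom Q_of_dual_hom] B.T.ring_axioms])
  have \<Phi>_val: "\<Phi> (ratfun_Q_tens F G H) = of_dual (F * G * H, (ratfun_deriv F * G - F * ratfun_deriv G) * H)" for F G H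
    by (simp add: \<Phi>_def Q_to_dual_tens)
  have \<Psi>_val: "\<Psi> (of_dual p) = Q_of_dual p" for p
    by (simp add: \<Psi>_def)
  have \<Psi>\<Phi>: "\<forall>x\<in>carrier ratfun_Q. \<Psi> (\<Phi> x) = x"
    by (simp add: \<Phi>_def \<Psi>_val Q_of_to_dual)
  have \<Phi>\<Psi>: "\<forall>y\<in>carrier ratfun_dual. \<Phi> (\<Psi> y) = y"
    by (simp add: \<Phi>_def \<Psi>_def of_to_dual)
  have "\<Phi> \<in> ring_iso ratfun_Q ratfun_dual"
    unfolding ring_iso_def using \<Phi>_hom ring_hom_closed[OF \<Phi>_hom] ring_hom_closed[OF \<Psi>_hom] \<Psi>\<Phi> \<Phi>\<Psi>
    by (auto intro!: bij_betw_byWitness[where f' = \<Psi>])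
  moreover have "\<Psi> \<in> ring_iso ratfun_dual ratfun_Q"
    unfolding ring_iso_def using \<Psi>_hom ring_hom_closed[OF \<Phi>_hom] ring_hom_closed[OF \<Psi>_hom] \<Psi>\<Phi> \<Phi>\<Psi>
    by (auto intro!: bij_betw_byWitness[where f' = \<Phi>])
  moreover have "{h \<in> alg_homs scalar_ring Q_K B_K.
       h (ratfun_Q_tens T 1 1) = dual_tens T \<one>\<^bsub>dual_alg\<^esub> \<oplus>\<^bsub>ratfun_dual\<^esub> dual_tens 1 dual_var \<and>
       h (ratfun_Q_tens 1 T 1) = dual_tens T \<one>\<^bsub>dual_alg\<^esub> \<ominus>\<^bsub>ratfun_dual\<^esub> dual_tens 1 dual_var \<and>
       h (ratfun_Q_tens 1 1 T) = dual_tens T \<one>\<^bsub>dual_alg\<^esub>} = {\<Phi>}" (is "{h \<in> ?H. ?P h} = _")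
  proof -
    have mem: "\<Phi> \<in> ?H" "?P \<Phi>"
      unfolding mem_alg_homs_Q_B using \<Phi>_hom
      by (simp_all only: of_dual_eqs \<Phi>_val) (simp_all add: \<Phi>_def T_def)
    \<comment> \<open>Members of \<open>alg_homs\<close> are extensional, so agreement on generators
      yields equality of functions.\<close>
    moreover have "h = \<Phi>" if h: "h \<in> ?H" "?P h" for h
    proof (rule extensionalityI[of _ "carrier ratfun_Q"])
      show "h x = \<Phi> x" if "x \<in> carrier ratfun_Q" for x
      proof (rule Q_hom_eqI[OF _ \<Phi>_hom B.cring_T _ _ _ _ that])
        show "h \<in> ring_hom ratfun_Q ratfun_dual"
          "h (ratfun_Q_tens (ratfun_const c) 1 1) = \<Phi> (ratfun_Q_tens (ratfun_const c) 1 1)" for c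
          using h(1) mem(1) unfolding mem_alg_homs_Q_B by metis+
        show "h (ratfun_Q_tens ratfun_var 1 1) = \<Phi> (ratfun_Q_tens ratfun_var 1 1)"
          "h (ratfun_Q_tens 1 ratfun_var 1) = \<Phi> (ratfun_Q_tens 1 ratfun_var 1)"
          "h (ratfun_Q_tens 1 1 ratfun_var) = \<Phi> (ratfun_Q_tens 1 1 ratfun_var)"
          using h(2) mem(2) unfolding T_def by metis+
      qed
    qed (use h(1) mem(1) in \<open>auto simp only: mem_alg_homs_Q_B\<close>)
    ultimately show ?thesis
      by blast
  qed
  moreover have "{h \<in> alg_homs scalar_ring B_K Q_K.
       h (dual_tens T \<one>\<^bsub>dual_alg\<^esub>) = ratfun_Q_tens 1 1 T \<and>
       h (dual_tens 1 dual_var) = ratfun_Q_tens T 1 1 \<ominus>\<^bsub>ratfun_Q\<^esub> ratfun_Q_tens 1 1 T} = {\<Psi>}" (is "{h \<in> ?H. ?P h} = _")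
  proof -
    have mem: "\<Psi> \<in> ?H" "?P \<Psi>"
      unfolding mem_alg_homs_B_Q using \<Psi>_hom
      by (simp_all only: of_dual_eqs \<Psi>_val) (simp_all add: \<Psi>_def T_def Q_of_dual_const Q_of_dual_var Q_tens_const)
    moreover have "h = \<Psi>" if h: "h \<in> ?H" "?P h" for h
    proof (rule extensionalityI[of _ "carrier ratfun_dual"])
      show "h x = \<Psi> x" if "x \<in> carrier ratfun_dual" for x
      proof (rule ratfun_dual_hom_eqI[OF _ \<Psi>_hom cring_Q _ _ _ that])
        show "h \<in> ring_hom ratfun_dual ratfun_Q"
          "h (of_dual (ratfun_const c, 0)) = \<Psi> (of_dual (ratfun_const c, 0))" for c
          using h(1) mem(1) unfolding mem_alg_homs_B_Q by metis+
        show "h (of_dual (ratfun_var, 0)) = \<Psi> (of_dual (ratfun_var, 0))" "h (of_dual (0, 1)) = \<Psi> (of_dual (0, 1))"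
          using h(2) mem(2) unfolding of_dual_eqs T_def by metis+
      qed
    qed (use h(1) mem(1) in \<open>auto simp only: mem_alg_homs_B_Q\<close>)
    ultimately show ?thesis
      by blast
  qed
  ultimately show ?thesis
    using \<Psi>\<Phi> \<Phi>\<Psi> by (intro exI[of _ \<Phi>] exI[of _ \<Psi>] conjI)
qed

section \<open>Substitution of T + S and T - S\<close>

text \<open>Evaluates the definite description in \<open>ratfun_subst\<close>: a homomorphism to the
  dual numbers that respects K and has the right value at T must be the substitution.\<close>

lemma ratfun_B_hom_unique:
  fixes u :: "'k::field poly fract \<Rightarrow> 'k poly fract \<times> 'k poly fract"
  assumes u: "u \<in> ring_hom ratfun_ring dual_numbers" and const: "\<And>c. u (ratfun_const c) = (ratfun_const c, 0)"
  shows "\<exists>!h. h \<in> alg_homs scalar_ring ratfun_alg B_K \<and> h ratfun_var = of_dual (u ratfun_var)"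
    and "ratfun_subst B_K (of_dual (u ratfun_var)) = of_dual \<circ> u"
proof -
  have mem: "of_dual \<circ> u \<in> alg_homs scalar_ring ratfun_alg B_K"
    unfolding mem_alg_homs_ratfun_B using ring_hom_trans[OF u of_dual_hom] const by simp
  have uniq: "h = of_dual \<circ> u" if "h \<in> alg_homs scalar_ring ratfun_alg B_K \<and> h ratfun_var = of_dual (u ratfun_var)" for h
    using that mem unfolding mem_alg_homs_ratfun_B
    by (intro ratfun_hom_eq[OF _ _ B.cring_T]) auto
  show ex1: "\<exists>!h. h \<in> alg_homs scalar_ring ratfun_alg B_K \<and> h ratfun_var = of_dual (u ratfun_var)"
    using mem uniq by (intro ex1I[of _ "of_dual \<circ> u"]) auto
  have "(THE h. h \<in> alg_homs scalar_ring ratfun_alg B_K \<and> h ratfun_var = of_dual (u ratfun_var)) = of_dual \<circ> u"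
    using mem uniq by (intro the_equality) auto
  then show "ratfun_subst B_K (of_dual (u ratfun_var)) = of_dual \<circ> u"
    unfolding ratfun_subst_def by simp
qed

text \<open>Taylor expansion to first order, F(T + S) = F + F' S and F(T - S) = F - F' S, with
  \<open>deriv_hom\<close> as the source of the homomorphisms.\<close>

lemma
  fixes T :: "'k::field poly fract"
  defines "T \<equiv> ratfun_var"
  shows plus_subst_unique: "\<exists>!h. h \<in> alg_homs scalar_ring ratfun_alg B_K \<and>
      h T = dual_tens T \<one>\<^bsub>dual_alg\<^esub> \<oplus>\<^bsub>ratfun_dual\<^esub> dual_tens 1 dual_var"
    and minus_subst_unique: "\<exists>!h. h \<in> alg_homs scalar_ring ratfun_alg B_K \<and>
      h T = dual_tens T \<one>\<^bsub>dual_alg\<^esub> \<ominus>\<^bsub>ratfun_dual\<^esub> dual_tens 1 dual_var"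
    and plus_subst: "ratfun_subst B_K (dual_tens T \<one>\<^bsub>dual_alg\<^esub> \<oplus>\<^bsub>ratfun_dual\<^esub> dual_tens 1 dual_var) F = of_dual (F, ratfun_deriv F)"
    and minus_subst: "ratfun_subst B_K (dual_tens T \<one>\<^bsub>dual_alg\<^esub> \<ominus>\<^bsub>ratfun_dual\<^esub> dual_tens 1 dual_var) F = of_dual (F, - ratfun_deriv F)"
  using ratfun_B_hom_unique[where u = "\<lambda>F :: 'k poly fract. (F, ratfun_deriv F)", OF deriv_hom(1)]
    ratfun_B_hom_unique[where u = "\<lambda>F :: 'k poly fract. (F, - ratfun_deriv F)", OF deriv_hom(2)]
  unfolding T_def of_dual_eqs by simp_all

section \<open>Modules of functionals\<close>

text \<open>If the operations of both modules have the same formulas in the parameters, then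
  matching parameters is linear. Injectivity of \<open>n\<close> passes to \<open>h\<close>, which
  carries \<open>m x\<close> to \<open>n x\<close>.\<close>

lemma mod_isos_param:
  assumes M: "carrier M = range m" and N: "carrier N = range n" and inj: "inj n"
    and "\<And>x y. m x \<oplus>\<^bsub>M\<^esub> m y = m (pl x y)" "\<And>x y. n x \<oplus>\<^bsub>N\<^esub> n y = n (pl x y)"
    and "\<And>r x. r \<odot>\<^bsub>M\<^esub> m x = m (sc r x)" "\<And>r x. r \<odot>\<^bsub>N\<^esub> n x = n (sc r x)"
    and ext: "h \<in> extensional (carrier M)" and h: "\<And>x. h (m x) = n x"
  shows "h \<in> mod_isos R M N"
proof -
  have "h \<in> mod_homs R M N"
    using ext by (auto simp: mod_homs_def PiE_iff assms)
  moreover have "bij_betw h (carrier M) (carrier N)"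
    by (auto simp: bij_betw_def inj_on_def M N h image_image inj_eq[OF inj])
  ultimately show ?thesis
    by (simp add: mod_isos_def)
qed

text \<open>The functional with value \<open>c\<close> at 1 and \<open>d\<close> at S.\<close>

definition dual_form ::
  "'k::field poly fract \<times> 'k poly fract \<Rightarrow> ('k poly fract \<times> 'k poly set \<Rightarrow>\<^sub>0 int) set \<Rightarrow> 'k poly fract" where
  "dual_form = (\<lambda>(c, d). \<lambda>x\<in>carrier ratfun_dual. c * fst (to_dual x) + d * snd (to_dual x))"

lemma dual_form_of_dual [simp]: "dual_form (c, d) (of_dual (F, G)) = c * F + d * G"
  by (simp add: dual_form_def)

text \<open>1 and S span the algebra over K(T), so a functional is given by its values
  there.\<close>

lemma mod_homs_B: "mod_homs ratfun_ring B_A ratfun_line = range (dual_form :: 'k::field poly fract \<times> 'k poly fract \<Rightarrow> _)"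
proof (intro equalityI subsetI)
  fix f :: "('k poly fract \<times> 'k poly set \<Rightarrow>\<^sub>0 int) set \<Rightarrow> 'k poly fract"
  assume f: "f \<in> mod_homs ratfun_ring B_A ratfun_line"
  have add: "f (of_dual x \<oplus>\<^bsub>ratfun_dual\<^esub> of_dual y) = f (of_dual x) + f (of_dual y)"
    and smult: "f (of_dual (F, 0) \<otimes>\<^bsub>ratfun_dual\<^esub> of_dual x) = F * f (of_dual x)" for x y F
    using f unfolding mod_homs_def of_dual_eqs(1) by simp_all
  have eq: "f (of_dual (F, G)) = dual_form (f (of_dual (1, 0)), f (of_dual (0, 1))) (of_dual (F, G))" for F G
    using add[of "(F, 0)" "(0, G)"] smult[of F "(1, 0)"] smult[of G "(0, 1)"] by (simp add: of_dual_eqs)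
  have ext: "f x = dual_form (f (of_dual (1, 0)), f (of_dual (0, 1))) x" if x: "x \<in> carrier ratfun_dual" for x
  proof -
    obtain F G where "x = of_dual (F, G)"
      using x by (auto simp: carrier_ratfun_dual)
    then show ?thesis
      by (elim ssubst) (rule eq)
  qed
  have "f = dual_form (f (of_dual (1, 0)), f (of_dual (0, 1)))"
  proof (rule extensionalityI[OF _ _ ext])
    show "f \<in> extensional (carrier ratfun_dual)"
      using f by (simp add: mod_homs_def PiE_iff)
    show "dual_form p \<in> extensional (carrier ratfun_dual)" for p :: "'k poly fract \<times> 'k poly fract"
      by (simp add: dual_form_def split: prod.split)
  qed
  then show "f \<in> range dual_form"
    by blast
next
  fix f :: "('k poly fract \<times> 'k poly set \<Rightarrow>\<^sub>0 int) set \<Rightarrow> 'k poly fract"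
  assume "f \<in> range dual_form"
  then obtain c d where f: "f = dual_form (c, d)"
    by auto
  have "f \<in> extensional (carrier ratfun_dual)"
    by (simp add: f dual_form_def)
  then show "f \<in> mod_homs ratfun_ring B_A ratfun_line"
    unfolding mod_homs_def of_dual_eqs(1)
    by (auto simp: carrier_ratfun_dual of_dual_eqs(4,6) f algebra_simps PiE_iff)
qed

text \<open>\<open>dual_form\<close> restricted to the second tensor factor, with the same values at
  1 and S.\<close>

definition dual_class_form :: "'k::field poly fract \<times> 'k poly fract \<Rightarrow> 'k poly set \<Rightarrow> 'k poly fract" where
  "dual_class_form = (\<lambda>(c, d). \<lambda>l\<in>range dual_class. c * ratfun_const (dual_coeff 0 l) + d * ratfun_const (dual_coeff 1 l))"

lemma dual_class_form_class [simp]: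
  "dual_class_form (c, d) (dual_class p) = c * ratfun_const (coeff p 0) + d * ratfun_const (coeff p (Suc 0))"
  by (simp add: dual_class_form_def)

lemma mod_homs_dual_alg:
  "mod_homs scalar_ring dual_alg ratfun_alg = range (dual_class_form :: 'k::field poly fract \<times> 'k poly fract \<Rightarrow> _)"
proof (intro equalityI subsetI)
  fix f :: "'k poly set \<Rightarrow> 'k poly fract"
  assume f: "f \<in> mod_homs scalar_ring dual_alg ratfun_alg"
  have add: "f (dual_class p \<oplus>\<^bsub>dual_ring\<^esub> dual_class r) = f (dual_class p) + f (dual_class r)"
    and smult: "f (dual_class (smult c p)) = ratfun_const c * f (dual_class p)" for p r c
    using f unfolding mod_homs_def by auto
  have eq: "f (dual_class p) = dual_class_form (f (dual_class 1), f dual_var) (dual_class p)" for p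
  proof -
    have "dual_class p = dual_class (smult (coeff p 0) 1 + smult (coeff p 1) [:0, 1:])"
      by (simp add: dual_class_eq_iff)
    then show ?thesis
      using add[of "smult (coeff p 0) 1" "smult (coeff p 1) [:0, 1:]"] smult[of "coeff p 0" 1] smult[of "coeff p 1" "[:0, 1:]"]
      by (simp add: dual_class_add mult.commute)
  qed
  have "f = dual_class_form (f (dual_class 1), f dual_var)"
  proof (rule extensionalityI)
    show "f \<in> extensional (range dual_class)"
      using f by (simp add: mod_homs_def PiE_iff)
    show "dual_class_form p \<in> extensional (range dual_class)" for p :: "'k poly fract \<times> 'k poly fract"
      by (simp add: dual_class_form_def split: prod.split)
    show "f l = dual_class_form (f (dual_class 1), f dual_var) l" if "l \<in> range dual_class" for l
      using that by (elim rangeE ssubst) (rule eq)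
  qed
  then show "f \<in> range dual_class_form"
    by blast
next
  fix f :: "'k poly set \<Rightarrow> 'k poly fract"
  assume "f \<in> range dual_class_form"
  then obtain c d where f: "f = dual_class_form (c, d)"
    by auto
  have "f \<in> extensional (range dual_class)"
    by (simp add: f dual_class_form_def)
  then show "f \<in> mod_homs scalar_ring dual_alg ratfun_alg"
    unfolding mod_homs_def
    by (auto simp: f dual_class_add ratfun_const_add ratfun_const_mult algebra_simps PiE_iff)
qed

abbreviation Hom_B :: "('k::field poly fract, ('k poly fract \<times> 'k poly set \<Rightarrow>\<^sub>0 int) set \<Rightarrow> 'k poly fract) module" where
  "Hom_B \<equiv> fun_mod B_A ratfun_line (mod_homs ratfun_ring B_A ratfun_line)"

abbreviation Hom_\<Lambda> :: "('k::field poly fract, 'k poly set \<Rightarrow> 'k poly fract) module" where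
  "Hom_\<Lambda> \<equiv> fun_mod dual_alg ratfun_line (mod_homs scalar_ring dual_alg ratfun_alg)"

lemma carrier_Hom:
  "carrier Hom_B = range dual_form" "carrier Hom_\<Lambda> = range dual_class_form"
  by (simp_all only: fun_mod_sel mod_homs_B mod_homs_dual_alg)

lemma Hom_ops:
  "dual_form (c, d) \<oplus>\<^bsub>Hom_B\<^esub> dual_form (c', d') = dual_form (c + c', d + d')"
  "r \<odot>\<^bsub>Hom_B\<^esub> dual_form (c, d) = dual_form (r * c, r * d)"
  "dual_class_form (c, d) \<oplus>\<^bsub>Hom_\<Lambda>\<^esub> dual_class_form (c', d') = dual_class_form (c + c', d + d')"
  "r \<odot>\<^bsub>Hom_\<Lambda>\<^esub> dual_class_form (c, d) = dual_class_form (r * c, r * d)"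
  by (auto simp: dual_form_def dual_class_form_def algebra_simps intro!: restrict_ext)

text \<open>Extension of scalars: a K(T)-linear map on the tensor product amounts to its K-linear
  restriction to the second factor. On the pairs (c, d) this is the identity.\<close>

lemma Hom_B_\<Lambda>_iso: "(\<lambda>f\<in>carrier Hom_B. \<lambda>l\<in>carrier dual_alg. f (dual_tens 1 l)) \<in> mod_isos ratfun_ring Hom_B Hom_\<Lambda>"
proof (rule mod_isos_param[where m = dual_form and n = dual_class_form
      and pl = "\<lambda>(c, d) (c', d'). (c + c', d + d')" and sc = "\<lambda>r (c, d). (r * c, r * d)"])
  show "inj (dual_class_form :: 'a poly fract \<times> 'a poly fract \<Rightarrow> _)"
  proof (rule injI)
    fix x y :: "'a poly fract \<times> 'a poly fract"
    assume eq: "dual_class_form x = dual_class_form y"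
    show "x = y"
      using fun_cong[OF eq, of "dual_class 1"] fun_cong[OF eq, of dual_var] by (cases x; cases y) simp
  qed
  fix x :: "'a poly fract \<times> 'a poly fract"
  obtain c d where x: "x = (c, d)"
    by (cases x)
  have mem: "dual_form x \<in> carrier Hom_B"
    unfolding carrier_Hom by blast
  have "(\<lambda>l\<in>carrier dual_alg. dual_form x (dual_tens 1 l)) = dual_class_form x"
    unfolding dual_class_form_def x
    by (auto simp: dual_tens_eq_of_dual intro!: restrict_ext)
  with mem show "(\<lambda>f\<in>carrier Hom_B. \<lambda>l\<in>carrier dual_alg. f (dual_tens 1 l)) (dual_form x) = dual_class_form x"
    by (simp only: restrict_apply if_True)
qed (auto simp only: carrier_Hom Hom_ops split_paired_all prod.case restrict_extensional)

lemma Hom_\<Lambda>_plane_iso: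
  "(\<lambda>g\<in>carrier Hom_\<Lambda>. (g \<one>\<^bsub>dual_alg\<^esub>, g dual_var)) \<in> mod_isos ratfun_ring Hom_\<Lambda> ratfun_plane"
proof (rule mod_isos_param[where m = dual_class_form and n = id
      and pl = "\<lambda>(c, d) (c', d'). (c + c', d + d')" and sc = "\<lambda>r (c, d). (r * c, r * d)"])
  fix x :: "'a poly fract \<times> 'a poly fract"
  have "dual_class_form x \<in> carrier Hom_\<Lambda>"
    unfolding carrier_Hom by blast
  then have "(\<lambda>g\<in>carrier Hom_\<Lambda>. (g \<one>\<^bsub>dual_alg\<^esub>, g dual_var)) (dual_class_form x)
      = (dual_class_form x \<one>\<^bsub>dual_alg\<^esub>, dual_class_form x dual_var)"
    by (simp only: restrict_apply if_True)
  then show "(\<lambda>g\<in>carrier Hom_\<Lambda>. (g \<one>\<^bsub>dual_alg\<^esub>, g dual_var)) (dual_class_form x) = id x"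
    by (cases x) (simp del: fun_mod_sel)
qed (auto simp only: carrier_Hom Hom_ops split_paired_all prod.case restrict_extensional id_apply prod_mod_sel
     alg_along_simps ring_of_type_algebra_sel, auto)

section \<open>Functionals as forms vanishing on both axes\<close>

abbreviation Quad_kernel :: "('k::field poly fract, 'k poly fract \<times> 'k poly fract \<Rightarrow> 'k poly fract) module" where
  "Quad_kernel \<equiv> ker_mod (Quad (scalar_ring :: 'k ring) ratfun_ring ratfun_const ratfun_plane ratfun_line)
      (prod_mod (Quad ratfun_ring ratfun_ring id ratfun_line ratfun_line)
        (Quad ratfun_ring ratfun_ring id ratfun_line ratfun_line))
      (restrict_summands ratfun_line ratfun_line)"

abbreviation subst_plus :: "'k::field poly fract \<Rightarrow> ('k poly fract \<times> 'k poly set \<Rightarrow>\<^sub>0 int) set" where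
  "subst_plus \<equiv> ratfun_subst B_K (dual_tens ratfun_var \<one>\<^bsub>dual_alg\<^esub> \<oplus>\<^bsub>ratfun_dual\<^esub> dual_tens 1 dual_var)"

abbreviation subst_minus :: "'k::field poly fract \<Rightarrow> ('k poly fract \<times> 'k poly set \<Rightarrow>\<^sub>0 int) set" where
  "subst_minus \<equiv> ratfun_subst B_K (dual_tens ratfun_var \<one>\<^bsub>dual_alg\<^esub> \<ominus>\<^bsub>ratfun_dual\<^esub> dual_tens 1 dual_var)"

text \<open>The expansion of (F + F' S)(G - G' S) with S^2 = 0; the coefficient of S is the
  Wronskian.\<close>

lemma subst_product:
  "subst_plus F \<otimes>\<^bsub>ratfun_dual\<^esub> subst_minus G = of_dual (F * G, ratfun_deriv F * G - F * ratfun_deriv G)"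
  unfolding plus_subst minus_subst by (simp add: of_dual_eqs algebra_simps)

text \<open>By \<open>subst_product\<close> the functional with parameters (c, d) yields the form
  with the same \<open>c\<close> and \<open>d\<close> and no axis part.\<close>

lemma Hom_B_kernel_iso:
  "(\<lambda>f\<in>carrier Hom_B. \<lambda>(F, G). f (subst_plus F \<otimes>\<^bsub>ratfun_dual\<^esub> subst_minus G)) \<in> mod_isos ratfun_ring Hom_B Quad_kernel"
proof (rule mod_isos_param[where m = dual_form and n = "\<lambda>(c, d). plane_form 0 0 c d"
      and pl = "\<lambda>(c, d) (c', d'). (c + c', d + d')" and sc = "\<lambda>r (c, d). (r * c, r * d)"])
  show "carrier Quad_kernel = range (\<lambda>(c, d). plane_form 0 0 c d)"
    unfolding carrier_Ker by force
  show "inj (\<lambda>(c, d). plane_form 0 0 c d)"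
    by (auto simp: inj_def plane_form_eq_iff)
  fix x :: "'a poly fract \<times> 'a poly fract"
  obtain c d where x: "x = (c, d)"
    by (cases x)
  have "dual_form x \<in> carrier Hom_B"
    unfolding carrier_Hom by blast
  moreover have "(\<lambda>(F, G). dual_form x (subst_plus F \<otimes>\<^bsub>ratfun_dual\<^esub> subst_minus G)) = plane_form 0 0 c d"
    unfolding subst_product by (auto simp: x plane_form_def)
  ultimately show "(\<lambda>f\<in>carrier Hom_B. \<lambda>(F, G). f (subst_plus F \<otimes>\<^bsub>ratfun_dual\<^esub> subst_minus G)) (dual_form x)
      = (case x of (c, d) \<Rightarrow> plane_form 0 0 c d)"
    by (simp only: restrict_apply if_True x prod.case)
next
  show "(case x of (c, d) \<Rightarrow> plane_form 0 0 c d) \<oplus>\<^bsub>Quad_kernel\<^esub> (case y of (c, d) \<Rightarrow> plane_form 0 0 c d) =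
      (case case x of (c, d) \<Rightarrow> \<lambda>(c', d'). (c + c', d + d') of f \<Rightarrow> case f y of (c, d) \<Rightarrow> plane_form 0 0 c d)"
    for x y :: "'a poly fract \<times> 'a poly fract"
    by (cases x; cases y) (simp add: ker_mod_def restrict_UNIV plane_form_add)
  show "r \<odot>\<^bsub>Quad_kernel\<^esub> (case x of (c, d) \<Rightarrow> plane_form 0 0 c d) =
      (case case x of (c, d) \<Rightarrow> (r * c, r * d) of (c, d) \<Rightarrow> plane_form 0 0 c d)"
    for r and x :: "'a poly fract \<times> 'a poly fract"
    by (cases x) (simp add: ker_mod_def restrict_UNIV plane_form_smult)
qed (auto simp only: carrier_Hom Hom_ops split_paired_all prod.case restrict_extensional)

lemma Hom_B_subst_eval:
  "\<forall>f\<in>carrier Hom_B. \<forall>F G. f (subst_plus F \<otimes>\<^bsub>ratfun_dual\<^esub> subst_minus G)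
    = F * G * f \<one>\<^bsub>ratfun_dual\<^esub> + (ratfun_deriv F * G - F * ratfun_deriv G) * f (dual_tens 1 dual_var)"
proof (intro ballI allI)
  fix f :: "('a poly fract \<times> 'a poly set \<Rightarrow>\<^sub>0 int) set \<Rightarrow> 'a poly fract" and F G
  assume "f \<in> carrier Hom_B"
  then obtain c d where "f = dual_form (c, d)"
    unfolding carrier_Hom by auto
  then show "f (subst_plus F \<otimes>\<^bsub>ratfun_dual\<^esub> subst_minus G)
      = F * G * f \<one>\<^bsub>ratfun_dual\<^esub> + (ratfun_deriv F * G - F * ratfun_deriv G) * f (dual_tens 1 dual_var)"
    unfolding subst_product by (simp add: of_dual_eqs)
qed

text \<open>The two unique-existence clauses justify the definite description in
  \<open>ratfun_subst\<close>, and linearity of the restriction makes \<open>Ker\<close> the kernel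
  of a module homomorphism. The maps from \<open>Hom_B\<close> to \<open>Hom_\<Lambda>\<close> and
  from there to \<open>A2\<close> make the two identifications of the Hom spaces explicit.\<close>

theorem proposition4p1:
  shows
  "let K = (ring_of_type_algebra :: 'k::field ring);
       A = (ring_of_type_algebra :: 'k poly fract ring);
       \<iota> = (ratfun_const :: 'k \<Rightarrow> 'k poly fract);
       T = (ratfun_var :: 'k poly fract);
       A1 = alg_along A id;
       A2 = prod_mod A1 A1;
       \<Lambda> = (dual_alg :: ('k, 'k poly set) module);
       Q = Q_ring K A \<iota>;
       q = Q_tens K A \<iota>;
       Q\<^sub>K = alg_along Q (\<lambda>c. q (\<iota> c) 1 1);
       B = tensor_ring K (alg_along A \<iota>) \<Lambda>;
       b = tens K (alg_along A \<iota>) \<Lambda>;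
       B\<^sub>K = alg_along B (\<lambda>c. b (\<iota> c) \<one>\<^bsub>\<Lambda>\<^esub>);
       B\<^sub>A = alg_along B (\<lambda>F. b F \<one>\<^bsub>\<Lambda>\<^esub>);
       S\<^sub>\<Lambda> = dual_class [:0, 1:];
       T\<^sub>B = b T \<one>\<^bsub>\<Lambda>\<^esub>;
       S = b 1 S\<^sub>\<Lambda>;
       plus_subst = ratfun_subst B\<^sub>K (T\<^sub>B \<oplus>\<^bsub>B\<^esub> S);
       minus_subst = ratfun_subst B\<^sub>K (T\<^sub>B \<ominus>\<^bsub>B\<^esub> S);
       Hom_B = fun_mod B\<^sub>A A1 (mod_homs A B\<^sub>A A1);
       Hom_\<Lambda> = fun_mod \<Lambda> A1 (mod_homs K \<Lambda> (alg_along A \<iota>));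
       Res = prod_mod (Quad A A id A1 A1) (Quad A A id A1 A1);
       Ker = ker_mod (Quad K A \<iota> A2 A1) Res (restrict_summands A1 A1)
   in
     (\<exists>\<Phi> \<Psi>.
        {h \<in> alg_homs K Q\<^sub>K B\<^sub>K.
           h (q T 1 1) = T\<^sub>B \<oplus>\<^bsub>B\<^esub> S \<and> h (q 1 T 1) = T\<^sub>B \<ominus>\<^bsub>B\<^esub> S \<and> h (q 1 1 T) = T\<^sub>B} = {\<Phi>} \<and>
        {h \<in> alg_homs K B\<^sub>K Q\<^sub>K.
           h T\<^sub>B = q 1 1 T \<and> h S = q T 1 1 \<ominus>\<^bsub>Q\<^esub> q 1 1 T} = {\<Psi>} \<and>
        \<Phi> \<in> ring_iso Q B \<and> \<Psi> \<in> ring_iso B Q \<and>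
        (\<forall>x\<in>carrier Q. \<Psi> (\<Phi> x) = x) \<and> (\<forall>y\<in>carrier B. \<Phi> (\<Psi> y) = y)) \<and>
     (\<exists>h. h \<in> mod_isos A (W_mod K A \<iota>) A1) \<and>
     (\<exists>!h. h \<in> alg_homs K (alg_along A \<iota>) B\<^sub>K \<and> h T = T\<^sub>B \<oplus>\<^bsub>B\<^esub> S) \<and>
     (\<exists>!h. h \<in> alg_homs K (alg_along A \<iota>) B\<^sub>K \<and> h T = T\<^sub>B \<ominus>\<^bsub>B\<^esub> S) \<and>
     (\<lambda>f\<in>carrier (Quad K A \<iota> A2 A1). restrict_summands A1 A1 f)
        \<in> mod_homs A (Quad K A \<iota> A2 A1) Res \<and>
     (\<lambda>f\<in>carrier Hom_B. \<lambda>l\<in>carrier \<Lambda>. f (b 1 l)) \<in> mod_isos A Hom_B Hom_\<Lambda> \<and>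
     (\<lambda>g\<in>carrier Hom_\<Lambda>. (g \<one>\<^bsub>\<Lambda>\<^esub>, g S\<^sub>\<Lambda>)) \<in> mod_isos A Hom_\<Lambda> A2 \<and>
     (\<lambda>f\<in>carrier Hom_B. \<lambda>(F, G). f (plus_subst F \<otimes>\<^bsub>B\<^esub> minus_subst G)) \<in> mod_isos A Hom_B Ker \<and>
     (\<forall>f\<in>carrier Hom_B. \<forall>F G.
        f (plus_subst F \<otimes>\<^bsub>B\<^esub> minus_subst G)
          = F * G * f \<one>\<^bsub>B\<^esub> + (ratfun_deriv F * G - F * ratfun_deriv G) * f S) \<and>
     (\<exists>h. h \<in> mod_isos A (Quad K A \<iota> A2 A1) (prod_mod (Quad A A id A2 A1) A1))"
  unfolding Let_def
  by (intro conjI Q_B_inverse_isos W_mod_iso plus_subst_unique minus_subst_unique restrict_summands_hom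
      Hom_B_\<Lambda>_iso Hom_\<Lambda>_plane_iso Hom_B_kernel_iso Hom_B_subst_eval Quad_plane_iso)

end
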